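(* Let $R$ be a commutative ring and let $n\ge 0$ be an integer. The following statements are equivalent: (1) $\mathrm{fPD}(R)\le n$. (2) For every prime ideal $\mathfrak p$ of $R$, $\mathrm{FT}\text{-}\mathrm{fd}_R(R/\mathfrak p)\le n$. (3) For every maximal ideal $\mathfrak m$ of $R$, $\mathrm{FT}\text{-}\mathrm{fd}_R(R/\mathfrak m)\le n$. (4) For all $R$-modules $M,N\in\mathcal{FPR}(R)$, $\mathrm{Ext}_R^{n+1}(M,N)=0$. Moreover, consider the condition (5) For every $R$-module $M\in\mathcal{FPR}(R)$ and every integer $m\ge 0$, $\mathrm{Ext}_R^{n+1+m}(M,R)=0$. If, in addition, (5) implies (1), then (5) is also equivalent to (1)--(4).
   Context: All rings are commutative with identity. For a ring $R$, $\mathcal{FPR}(R)$ is the class of $R$-modules $M$ admitting an exact sequence $0\to P_k\to\cdots\to P_1\to P_0\to M\to 0$ (some $k\ge 0$) with every $P_i$ a finitely generated projective $R$-module. The small finitistic dimension is $\mathrm{fPD}(R)=\sup\{\mathrm{pd}_R M\mid M\in\mathcal{FPR}(R)\}$, where $\mathrm{pd}_R$ is projective dimension. An $R$-module $M$ is called FT-flat if $\mathrm{Tor}_1^R(N,M)=0$ for every $N\in\mathcal{FPR}(R)$. One writes $\mathrm{FT}\text{-}\mathrm{fd}_R M\le n$ (for an integer $n\ge 0$) if there is an exact sequence $0\to P_n\to\cdots\to P_1\to P_0\to M\to 0$ with every $P_i$ an FT-flat $R$-module; $\mathrm{FT}\text{-}\mathrm{fd}_R M$ is the least such $n$, and is $\infty$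 if no such $n$ exists. *)

theory Defs
  imports "HOL-Algebra.Algebra" "HOL-Library.Extended_Nat"
begin

text \<open>
  All modules of the form \<open>('a, 'm) module\<close> have their elements in the type \<open>'m\<close>, which plays the
  role of the universe. Quantification over ``all \<open>R\<close>-modules'' is quantification over
  \<open>('a, 'm) module\<close>, where \<open>'m\<close> is an arbitrary type that admits an injection from the finite
  sequences of elements of \<open>R\<close>. Then every module of cardinality at most
  \<open>max |R| \<aleph>\<^sub>0\<close>, in particular every finitely generated module, has an isomorphic
  copy in \<open>'m\<close>, and every module in \<open>'m\<close> has a free resolution in \<open>'m\<close>.
  When \<open>'m\<close> cannot be read off the other arguments it is passed as \<open>TYPE('m)\<close>.
\<close>

section \<open>Modules\<close>

definition module_hom ::
  "('a, 'r) ring_scheme \<Rightarrow> ('a, 'b) module \<Rightarrow> ('a, 'c) module \<Rightarrow> ('b \<Rightarrow> 'c) set" where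
  "module_hom R M N = {h \<in> hom (add_monoid M) (add_monoid N).
     \<forall>r \<in> carrier R. \<forall>x \<in> carrier M. h (r \<odot>\<^bsub>M\<^esub> x) = r \<odot>\<^bsub>N\<^esub> h x}"

text \<open>The fields \<open>mult\<close> and \<open>one\<close> of a module record carry no information in the following.\<close>

definition regular_module :: "('a, 'r) ring_scheme \<Rightarrow> ('a, 'a) module" where
  "regular_module R = \<lparr>carrier = carrier R, monoid.mult = monoid.mult R, one = \<one>\<^bsub>R\<^esub>,
     ring.zero = \<zero>\<^bsub>R\<^esub>, add = add R, smult = monoid.mult R\<rparr>"

definition quotient_module :: "('a, 'r) ring_scheme \<Rightarrow> 'a set \<Rightarrow> ('a, 'a set) module" where
  "quotient_module R I = \<lparr>carrier = carrier (R Quot I), monoid.mult = monoid.mult (R Quot I),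
     one = \<one>\<^bsub>R Quot I\<^esub>, ring.zero = \<zero>\<^bsub>R Quot I\<^esub>, add = add (R Quot I),
     smult = (\<lambda>r C. (I +>\<^bsub>R\<^esub> r) \<otimes>\<^bsub>R Quot I\<^esub> C)\<rparr>"

definition free_module :: "('a, 'r) ring_scheme \<Rightarrow> 'x set \<Rightarrow> ('a, 'x \<Rightarrow> 'a) module" where
  "free_module R B = \<lparr>
     carrier = {f. (\<forall>x \<in> B. f x \<in> carrier R) \<and> (\<forall>x. x \<notin> B \<longrightarrow> f x = \<zero>\<^bsub>R\<^esub>) \<and>
                   finite {x. f x \<noteq> \<zero>\<^bsub>R\<^esub>}},
     monoid.mult = (\<lambda>f g x. f x \<otimes>\<^bsub>R\<^esub> g x), one = (\<lambda>x. \<zero>\<^bsub>R\<^esub>), ring.zero = (\<lambda>x. \<zero>\<^bsub>R\<^esub>),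
     add = (\<lambda>f g x. f x \<oplus>\<^bsub>R\<^esub> g x), smult = (\<lambda>r f x. r \<otimes>\<^bsub>R\<^esub> f x)\<rparr>"

definition fin_gen :: "('a, 'r) ring_scheme \<Rightarrow> ('a, 'm) module \<Rightarrow> bool" where
  "fin_gen R M \<longleftrightarrow> (\<exists>S. finite S \<and> S \<subseteq> carrier M \<and>
     \<Inter>{H. submodule H R M \<and> S \<subseteq> H} = carrier M)"

text \<open>
  Projective: a direct summand, up to isomorphism, of a free module. Index sets \<open>B :: 'm set\<close>
  suffice, because one may always take \<open>B = carrier P\<close>.
\<close>

definition projective :: "('a, 'r) ring_scheme \<Rightarrow> ('a, 'm) module \<Rightarrow> bool" where
  "projective R P \<longleftrightarrow> module R P \<and> (\<exists>(B :: 'm set) s p.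
     s \<in> module_hom R P (free_module R B) \<and> p \<in> module_hom R (free_module R B) P \<and>
     (\<forall>x \<in> carrier P. p (s x) = x))"

section \<open>Resolutions\<close>

text \<open>Exactness of \<open>\<dots> \<rightarrow> P 2 \<rightarrow> P 1 \<rightarrow> P 0 \<rightarrow> M \<rightarrow> 0\<close>, with \<open>d i : P (i + 1) \<rightarrow> P i\<close> and
  \<open>e : P 0 \<rightarrow> M\<close>.\<close>

definition resolution ::
  "('a, 'r) ring_scheme \<Rightarrow> (nat \<Rightarrow> ('a, 'm) module) \<Rightarrow> (nat \<Rightarrow> 'm \<Rightarrow> 'm) \<Rightarrow> ('m \<Rightarrow> 'b) \<Rightarrow>
   ('a, 'b) module \<Rightarrow> bool" where
  "resolution R P d e M \<longleftrightarrow> module R M \<and> (\<forall>i. module R (P i)) \<and>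
     (\<forall>i. d i \<in> module_hom R (P (Suc i)) (P i)) \<and> e \<in> module_hom R (P 0) M \<and>
     e ` carrier (P 0) = carrier M \<and>
     d 0 ` carrier (P 1) = a_kernel (P 0) M e \<and>
     (\<forall>i. d (Suc i) ` carrier (P (Suc (Suc i))) = a_kernel (P (Suc i)) (P i) (d i))"

text \<open>Exactness of \<open>0 \<rightarrow> P n \<rightarrow> \<dots> \<rightarrow> P 0 \<rightarrow> M \<rightarrow> 0\<close>: the sequence is continued by zero modules.\<close>

definition resolution_of_length ::
  "('a, 'r) ring_scheme \<Rightarrow> nat \<Rightarrow> (nat \<Rightarrow> ('a, 'm) module) \<Rightarrow> (nat \<Rightarrow> 'm \<Rightarrow> 'm) \<Rightarrow>
   ('m \<Rightarrow> 'b) \<Rightarrow> ('a, 'b) module \<Rightarrow> bool" where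
  "resolution_of_length R n P d e M \<longleftrightarrow>
     resolution R P d e M \<and> (\<forall>i > n. carrier (P i) = {\<zero>\<^bsub>P i\<^esub>})"

definition FPR :: "('a, 'r) ring_scheme \<Rightarrow> ('a, 'm) module set" where
  "FPR R = {M. \<exists>k (P :: nat \<Rightarrow> ('a, 'm) module) d e. resolution_of_length R k P d e M \<and>
     (\<forall>i \<le> k. fin_gen R (P i) \<and> projective R (P i))}"

definition pd :: "('a, 'r) ring_scheme \<Rightarrow> ('a, 'm) module \<Rightarrow> enat" where
  "pd R M = Inf (enat ` {n. \<exists>(P :: nat \<Rightarrow> ('a, 'm) module) d e.
     resolution_of_length R n P d e M \<and> (\<forall>i \<le> n. projective R (P i))})"

definition fPD :: "'m itself \<Rightarrow> ('a, 'r) ring_scheme \<Rightarrow> enat" where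
  "fPD (_ :: 'm itself) R = (SUP M \<in> (FPR R :: ('a, 'm) module set). pd R M)"

text \<open>The projective resolution from which Ext and Tor are computed; up to isomorphism they do not
  depend on its choice.\<close>

definition proj_resolution ::
  "('a, 'r) ring_scheme \<Rightarrow> ('a, 'm) module \<Rightarrow> (nat \<Rightarrow> ('a, 'm) module) \<times> (nat \<Rightarrow> 'm \<Rightarrow> 'm)"
  where
  "proj_resolution R M = (SOME (P, d). (\<exists>e. resolution R P d e M) \<and> (\<forall>i. projective R (P i)))"

section \<open>Ext\<close>

text \<open>Homomorphisms are made extensional, so that they are determined by their values on
  \<open>carrier M\<close>.\<close>

definition Hom_group ::
  "('a, 'r) ring_scheme \<Rightarrow> ('a, 'b) module \<Rightarrow> ('a, 'c) module \<Rightarrow> ('b \<Rightarrow> 'c) monoid" where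
  "Hom_group R M N = \<lparr>carrier = module_hom R M N \<inter> extensional (carrier M),
     monoid.mult = (\<lambda>f g. \<lambda>x \<in> carrier M. f x \<oplus>\<^bsub>N\<^esub> g x),
     one = (\<lambda>x \<in> carrier M. \<zero>\<^bsub>N\<^esub>)\<rparr>"

text \<open>\<open>Ext R k M N\<close> is the underlying additive group (written multiplicatively) of the \<open>k\<close>-th
  cohomology of \<open>Hom(P, N)\<close>, for a projective resolution \<open>P\<close> of \<open>M\<close>.\<close>

definition Ext ::
  "('a, 'r) ring_scheme \<Rightarrow> nat \<Rightarrow> ('a, 'm) module \<Rightarrow> ('a, 'b) module \<Rightarrow> ('m \<Rightarrow> 'b) set monoid"
  where
  "Ext R k M N =
    (let (P, d) = proj_resolution R M;
         C = (\<lambda>i. Hom_group R (P i) N);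
         \<delta> = (\<lambda>i f. \<lambda>x \<in> carrier (P (Suc i)). f (d i x));
         Z = kernel (C k) (C (Suc k)) (\<delta> k);
         B = (case k of 0 \<Rightarrow> {\<one>\<^bsub>C 0\<^esub>} | Suc j \<Rightarrow> \<delta> j ` carrier (C j))
     in (C k)\<lparr>carrier := Z\<rparr> Mod B)"

section \<open>Tensor products and Tor\<close>

text \<open>The tensor product over \<open>R\<close>, as an abelian group: the free abelian group on
  \<open>carrier N \<times> carrier M\<close> modulo bilinearity and \<open>r x \<otimes> y = x \<otimes> r y\<close>.\<close>

definition tensor_free ::
  "('a, 'b) module \<Rightarrow> ('a, 'c) module \<Rightarrow> ('b \<times> 'c \<Rightarrow>\<^sub>0 int) monoid" where
  "tensor_free N M = free_Abelian_group (carrier N \<times> carrier M)"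

definition tensor_rel ::
  "('a, 'r) ring_scheme \<Rightarrow> ('a, 'b) module \<Rightarrow> ('a, 'c) module \<Rightarrow> ('b \<times> 'c \<Rightarrow>\<^sub>0 int) set" where
  "tensor_rel R N M = generate (tensor_free N M)
    ({frag_of (x \<oplus>\<^bsub>N\<^esub> x', y) - frag_of (x, y) - frag_of (x', y) | x x' y.
        x \<in> carrier N \<and> x' \<in> carrier N \<and> y \<in> carrier M} \<union>
     {frag_of (x, y \<oplus>\<^bsub>M\<^esub> y') - frag_of (x, y) - frag_of (x, y') | x y y'.
        x \<in> carrier N \<and> y \<in> carrier M \<and> y' \<in> carrier M} \<union>
     {frag_of (r \<odot>\<^bsub>N\<^esub> x, y) - frag_of (x, r \<odot>\<^bsub>M\<^esub> y) | r x y.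
        r \<in> carrier R \<and> x \<in> carrier N \<and> y \<in> carrier M})"

definition tensor ::
  "('a, 'r) ring_scheme \<Rightarrow> ('a, 'b) module \<Rightarrow> ('a, 'c) module \<Rightarrow> ('b \<times> 'c \<Rightarrow>\<^sub>0 int) set monoid"
  where
  "tensor R N M = tensor_free N M Mod tensor_rel R N M"

text \<open>The map \<open>f \<otimes> M : N \<otimes> M \<rightarrow> N' \<otimes> M\<close> induced by \<open>f : N \<rightarrow> N'\<close>, on cosets. It depends on \<open>N'\<close>
  but not on \<open>N\<close>.\<close>

definition tensor_map ::
  "('a, 'r) ring_scheme \<Rightarrow> ('a, 'b') module \<Rightarrow> ('a, 'c) module \<Rightarrow> ('b \<Rightarrow> 'b') \<Rightarrow>
   ('b \<times> 'c \<Rightarrow>\<^sub>0 int) set \<Rightarrow> ('b' \<times> 'c \<Rightarrow>\<^sub>0 int) set" where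
  "tensor_map R N' M f C =
     (\<Union>u \<in> C. tensor_rel R N' M #>\<^bsub>tensor_free N' M\<^esub>
                 frag_extend (\<lambda>(x, y). frag_of (f x, y)) u)"

text \<open>\<open>Tor R k N M\<close> is the \<open>k\<close>-th homology group of \<open>P \<otimes> M\<close>, for a projective resolution \<open>P\<close>
  of \<open>N\<close>.\<close>

definition Tor ::
  "('a, 'r) ring_scheme \<Rightarrow> nat \<Rightarrow> ('a, 'm) module \<Rightarrow> ('a, 'b) module \<Rightarrow>
   ('m \<times> 'b \<Rightarrow>\<^sub>0 int) set set monoid" where
  "Tor R k N M =
    (let (P, d) = proj_resolution R N;
         T = (\<lambda>i. tensor R (P i) M);
         D = (\<lambda>i. tensor_map R (P i) M (d i));
         Z = (case k of 0 \<Rightarrow> carrier (T 0) | Suc j \<Rightarrow> kernel (T (Suc j)) (T j) (D j));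
         B = D k ` carrier (T (Suc k))
     in (T k)\<lparr>carrier := Z\<rparr> Mod B)"

section \<open>FT-flat modules\<close>

definition FT_flat :: "('a, 'r) ring_scheme \<Rightarrow> ('a, 'm) module \<Rightarrow> bool" where
  "FT_flat R M \<longleftrightarrow> module R M \<and>
     (\<forall>N \<in> (FPR R :: ('a, 'm) module set). trivial_group (Tor R 1 N M))"

text \<open>The modules of the resolution live in \<open>'m\<close>, whereas \<open>M\<close> itself may have any type.\<close>

definition FT_fd :: "'m itself \<Rightarrow> ('a, 'r) ring_scheme \<Rightarrow> ('a, 'b) module \<Rightarrow> enat" where
  "FT_fd (_ :: 'm itself) R M = Inf (enat ` {n. \<exists>(P :: nat \<Rightarrow> ('a, 'm) module) d e.
     resolution_of_length R n P d e M \<and> (\<forall>i \<le> n. FT_flat R (P i))})"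

end

theory Submission
  imports Defs
begin

text \<open>
  Everything rests on dimension shifting along syzygies. If \<open>fPD(R) \<le> n\<close>, then \<open>Tor\<^sub>n\<^sub>+\<^sub>1(N, M) = 0\<close> for
  all \<open>N \<in> FPR(R)\<close> and all \<open>M\<close>, so the \<open>n\<close>-th syzygy in a free resolution of \<open>M\<close> is FT-flat.
  Conversely, FT-flat resolutions of length \<open>n\<close> of the residue fields give \<open>Tor\<^sub>j(N, R/m) = 0\<close> for
  \<open>j > n\<close>. Then the \<open>n\<close>-th syzygy of \<open>N \<in> FPR(R)\<close> is projective: by induction on the length of a
  resolution it suffices to split an inclusion \<open>K \<rightarrow> P\<close> of finitely generated projectives that is
  injective modulo every maximal ideal, and this follows from linear algebra over the residue
  fields and Nakayama's lemma. Finally, if \<open>Ext\<^sup>n\<^sup>+\<^sup>1(M, N) = 0\<close> for the \<open>(n+1)\<close>-st syzygy \<open>N\<close> of \<open>M\<close>,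
  then the surjection onto \<open>N\<close> extends along the resolution to a retraction, so the \<open>n\<close>-th
  syzygy is a direct summand of a projective module.
\<close>

section \<open>Module homomorphisms and sums over lists\<close>

text \<open>Tensors are cosets of formal sums, and comparing cosets directly would mean exhibiting
  relations. Over a module \<open>P\<close> with local dual bases a tensor is determined by its
  contractions with the functionals of \<open>P\<close>, so every statement about Tor is rephrased
  through lists of pairs and sums in \<open>M\<close>; the bridge back to the coset groups is
  \<open>trivial_Tor_iff\<close>. Since \<open>Ext\<close> and \<open>Tor\<close> are computed from
  an arbitrarily chosen resolution, a homotopy equivalence first carries their vanishing over to the
  resolution at hand. No localization occurs: instead of gluing local splittings, the scalars that
  make all coordinate functionals of \<open>K\<close> extend to \<open>P\<close> are shown to form
  an ideal that lies in no maximal ideal. Types shape the statements. Test modules and FT-flat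
  modules live in \<open>'m\<close>, quotients of \<open>R\<close> in \<open>'a set\<close>, free
  modules in a function type. Vanishing is therefore formulated for modules of any type, and
  constructions are made on copies in \<open>'m\<close>.\<close>

lemma module_homI:
  assumes "\<And>x. x \<in> carrier M \<Longrightarrow> h x \<in> carrier N"
    and "\<And>x y. x \<in> carrier M \<Longrightarrow> y \<in> carrier M \<Longrightarrow> h (x \<oplus>\<^bsub>M\<^esub> y) = h x \<oplus>\<^bsub>N\<^esub> h y"
    and "\<And>r x. r \<in> carrier R \<Longrightarrow> x \<in> carrier M \<Longrightarrow> h (r \<odot>\<^bsub>M\<^esub> x) = r \<odot>\<^bsub>N\<^esub> h x"
  shows "h \<in> module_hom R M N"
  using assms by (auto simp: module_hom_def hom_def)

lemma mh_closed: "h \<in> module_hom R M N \<Longrightarrow> x \<in> carrier M \<Longrightarrow> h x \<in> carrier N"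
  and mh_add: "h \<in> module_hom R M N \<Longrightarrow> x \<in> carrier M \<Longrightarrow> y \<in> carrier M \<Longrightarrow>
    h (x \<oplus>\<^bsub>M\<^esub> y) = h x \<oplus>\<^bsub>N\<^esub> h y"
  and mh_smult: "h \<in> module_hom R M N \<Longrightarrow> r \<in> carrier R \<Longrightarrow> x \<in> carrier M \<Longrightarrow>
    h (r \<odot>\<^bsub>M\<^esub> x) = r \<odot>\<^bsub>N\<^esub> h x"
  by (auto simp: module_hom_def hom_def)

lemma module_abelian_group: "module R M \<Longrightarrow> abelian_group M"
  by (simp add: module_def)

lemma module_cring: "module R M \<Longrightarrow> cring R"
  by (simp add: module_def)

lemma mh_group_hom:
  assumes "h \<in> module_hom R M N" "module R M" "module R N"
  shows "group_hom (add_monoid M) (add_monoid N) h"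
proof -
  interpret M: module R M by fact
  interpret N: module R N by fact
  show ?thesis
    using assms(1) M.a_group N.a_group
    by (auto simp: group_hom_def group_hom_axioms_def module_hom_def)
qed

lemma mh_zero:
  assumes "h \<in> module_hom R M N" "module R M" "module R N"
  shows "h \<zero>\<^bsub>M\<^esub> = \<zero>\<^bsub>N\<^esub>"
  using group_hom.hom_one[OF mh_group_hom[OF assms]] by simp

lemma mh_neg:
  assumes "h \<in> module_hom R M N" "module R M" "module R N" "x \<in> carrier M"
  shows "h (\<ominus>\<^bsub>M\<^esub> x) = \<ominus>\<^bsub>N\<^esub> h x"
  using group_hom.hom_inv[OF mh_group_hom[OF assms(1-3)]] assms(4) by (simp add: a_inv_def)

lemma neg_zero:
  assumes "module R M" shows "\<ominus>\<^bsub>M\<^esub> \<zero>\<^bsub>M\<^esub> = \<zero>\<^bsub>M\<^esub>"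
proof -
  interpret M: module R M by fact
  show ?thesis using M.M.r_neg[of "\<zero>\<^bsub>M\<^esub>"] by simp
qed

lemma mh_diff:
  assumes "h \<in> module_hom R M N" "module R M" "module R N" "x \<in> carrier M" "y \<in> carrier M"
  shows "h (x \<ominus>\<^bsub>M\<^esub> y) = h x \<ominus>\<^bsub>N\<^esub> h y"
proof -
  interpret M: module R M by fact
  show ?thesis
    using assms by (simp add: a_minus_def mh_add mh_neg)
qed

lemma mh_comp:
  "g \<in> module_hom R N L \<Longrightarrow> h \<in> module_hom R M N \<Longrightarrow> (\<lambda>x. g (h x)) \<in> module_hom R M L"
  by (auto intro!: module_homI simp: mh_closed mh_add mh_smult)

lemma mh_id: "(\<lambda>x. x) \<in> module_hom R M M"
  by (auto intro!: module_homI)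

text \<open>Being a homomorphism constrains values on the carrier only. Needed because
  \<open>Hom_group\<close> consists of restricted functions, which differ from the original maps
  elsewhere.\<close>

lemma mh_cong:
  assumes "h \<in> module_hom R M N" "module R M" "\<And>x. x \<in> carrier M \<Longrightarrow> g x = h x"
  shows "g \<in> module_hom R M N"
proof -
  interpret M: module R M by fact
  show ?thesis
    using assms by (auto intro!: module_homI simp: mh_closed mh_add mh_smult)
qed

lemma mh_zero_fun: "module R M \<Longrightarrow> module R N \<Longrightarrow> (\<lambda>x. \<zero>\<^bsub>N\<^esub>) \<in> module_hom R M N"
  by (auto intro!: module_homI simp: module.smult_r_null abelian_groupE(2)[OF module_abelian_group]
      abelian_groupE(5)[OF module_abelian_group])

lemma mh_add_fun:
  assumes "g \<in> module_hom R M N" "h \<in> module_hom R M N" "module R M" "module R N"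
  shows "(\<lambda>x. g x \<oplus>\<^bsub>N\<^esub> h x) \<in> module_hom R M N"
proof -
  interpret N: module R N by fact
  show ?thesis
    using assms
    by (auto intro!: module_homI simp: mh_closed mh_add mh_smult N.smult_r_distr N.M.a_ac)
qed

lemma mh_neg_fun:
  assumes "h \<in> module_hom R M N" "module R M" "module R N"
  shows "(\<lambda>x. \<ominus>\<^bsub>N\<^esub> h x) \<in> module_hom R M N"
proof -
  interpret N: module R N by fact
  show ?thesis
    using assms
    by (auto intro!: module_homI simp: mh_closed mh_add mh_smult N.smult_r_minus N.M.minus_add)
qed

lemma mh_diff_fun:
  assumes "g \<in> module_hom R M N" "h \<in> module_hom R M N" "module R M" "module R N"
  shows "(\<lambda>x. g x \<ominus>\<^bsub>N\<^esub> h x) \<in> module_hom R M N"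
  using mh_add_fun[OF assms(1) mh_neg_fun[OF assms(2-4)] assms(3,4)] by (simp add: a_minus_def)

lemma mh_smult_fun:
  assumes "h \<in> module_hom R M N" "module R M" "module R N" "r \<in> carrier R"
  shows "(\<lambda>x. r \<odot>\<^bsub>N\<^esub> h x) \<in> module_hom R M N"
proof -
  interpret N: module R N by fact
  show ?thesis
    using assms
    by (auto intro!: module_homI simp: mh_closed mh_add mh_smult N.smult_r_distr
        N.smult_assoc1[symmetric] N.R.m_comm)
qed

lemma mh_sub: "h \<in> module_hom R M N \<Longrightarrow> K \<subseteq> carrier M \<Longrightarrow> h \<in> module_hom R (M\<lparr>carrier := K\<rparr>) N"
  by (auto intro!: module_homI simp: mh_closed mh_add mh_smult subset_iff)

lemma mh_into: "h \<in> module_hom R M N \<Longrightarrow> (\<And>x. x \<in> carrier M \<Longrightarrow> h x \<in> K) \<Longrightarrow>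
   h \<in> module_hom R M (N\<lparr>carrier := K\<rparr>)"
  by (auto intro!: module_homI simp: mh_closed mh_add mh_smult subset_iff)

lemma mh_from_sub: "h \<in> module_hom R M (N\<lparr>carrier := K\<rparr>) \<Longrightarrow> K \<subseteq> carrier N \<Longrightarrow> h \<in> module_hom R M N"
  by (auto simp: module_hom_def hom_def subset_iff)

section \<open>The ring as a module; submodules and kernels\<close>

lemma regular_module_simps [simp]:
  "carrier (regular_module R) = carrier R" "add (regular_module R) = add R"
  "ring.zero (regular_module R) = ring.zero R" "smult (regular_module R) = monoid.mult R"
  by (simp_all add: regular_module_def)

lemma a_inv_regular_module [simp]: "a_inv (regular_module R) = a_inv R"
  by (simp add: a_inv_def m_inv_def fun_eq_iff)

lemma module_regular:
  assumes "cring R" shows "module R (regular_module R)"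
proof -
  interpret cring R by fact
  show ?thesis
    by (rule moduleI)
      (auto intro!: abelian_groupI simp: a_ac l_distr r_distr m_assoc add.l_inv_ex cring_axioms)
qed

lemma submodule_module:
  assumes "module R M" "submodule K R M" shows "module R (M\<lparr>carrier := K\<rparr>)"
  using submodule.submodule_is_module[OF assms(2,1)] .

lemma submodule_subset: "submodule K R M \<Longrightarrow> K \<subseteq> carrier M"
  using subgroup.subset[OF submodule.axioms(1)] by fastforce

lemma a_kernel_submodule:
  assumes "h \<in> module_hom R M N" "module R M" "module R N"
  shows "submodule (a_kernel M N h) R M"
proof -
  interpret M: module R M by fact
  interpret N: module R N by fact
  show ?thesis
    by (rule M.submoduleI)
      (use assms in \<open>auto simp: a_kernel_def' mh_zero mh_neg mh_add mh_smult\<close>)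
qed

lemma module_a_kernel:
  assumes "h \<in> module_hom R M N" "module R M" "module R N"
  shows "module R (M\<lparr>carrier := a_kernel M N h\<rparr>)"
  by (rule submodule_module[OF assms(2) a_kernel_submodule[OF assms]])

text \<open>A fold over a list instead of \<open>finsum\<close>: repeated entries count separately,
  as a formal sum of pairs requires, and proofs go by list induction.\<close>

definition msum :: "('a, 'm) module \<Rightarrow> ('i \<Rightarrow> 'm) \<Rightarrow> 'i list \<Rightarrow> 'm" where
  "msum M h xs = foldr (\<lambda>x s. h x \<oplus>\<^bsub>M\<^esub> s) xs \<zero>\<^bsub>M\<^esub>"

lemma msum_simps [simp]:
  "msum M h [] = \<zero>\<^bsub>M\<^esub>" "msum M h (x # xs) = h x \<oplus>\<^bsub>M\<^esub> msum M h xs"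
  by (simp_all add: msum_def)

lemma msum_restrict [simp]: "msum (M\<lparr>carrier := K\<rparr>) h xs = msum M h xs"
  by (simp add: msum_def)

lemma msum_map [simp]: "msum M h (map k xs) = msum M (\<lambda>x. h (k x)) xs"
  by (induction xs) auto

lemma msum_cong: "(\<And>x. x \<in> set xs \<Longrightarrow> h x = g x) \<Longrightarrow> msum M h xs = msum M g xs"
  by (induction xs) auto

lemma msum_closed:
  assumes "module R M" "\<And>x. x \<in> set xs \<Longrightarrow> h x \<in> carrier M"
  shows "msum M h xs \<in> carrier M"
proof -
  interpret M: module R M by fact
  show ?thesis using assms(2) by (induction xs) auto
qed

lemma msum_append:
  assumes "module R M" "\<And>x. x \<in> set xs \<union> set ys \<Longrightarrow> h x \<in> carrier M"
  shows "msum M h (xs @ ys) = msum M h xs \<oplus>\<^bsub>M\<^esub> msum M h ys"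
proof -
  interpret M: module R M by fact
  show ?thesis using assms(2)
    by (induction xs) (auto simp: msum_closed[OF assms(1)] M.a_assoc)
qed

lemma msum_add:
  assumes "module R M" "\<And>x. x \<in> set xs \<Longrightarrow> h x \<in> carrier M" "\<And>x. x \<in> set xs \<Longrightarrow> g x \<in> carrier M"
  shows "msum M (\<lambda>x. h x \<oplus>\<^bsub>M\<^esub> g x) xs = msum M h xs \<oplus>\<^bsub>M\<^esub> msum M g xs"
proof -
  interpret M: module R M by fact
  show ?thesis using assms(2,3)
    by (induction xs) (auto simp: msum_closed[OF assms(1)] M.a_ac)
qed

lemma msum_smult:
  assumes "module R M" "r \<in> carrier R" "\<And>x. x \<in> set xs \<Longrightarrow> h x \<in> carrier M"
  shows "r \<odot>\<^bsub>M\<^esub> msum M h xs = msum M (\<lambda>x. r \<odot>\<^bsub>M\<^esub> h x) xs"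
proof -
  interpret M: module R M by fact
  show ?thesis using assms(2,3)
    by (induction xs) (auto simp: msum_closed[OF assms(1)] M.smult_r_distr)
qed

lemma msum_smult_left:
  assumes "module R M" "m \<in> carrier M" "\<And>x. x \<in> set xs \<Longrightarrow> h x \<in> carrier R"
  shows "msum (regular_module R) h xs \<odot>\<^bsub>M\<^esub> m = msum M (\<lambda>x. h x \<odot>\<^bsub>M\<^esub> m) xs"
proof -
  interpret M: module R M by fact
  show ?thesis using assms(3)
  proof (induction xs)
    case (Cons a xs)
    have "msum (regular_module R) h xs \<in> carrier R"
      using msum_closed[OF module_regular[OF M.is_cring], of xs h] Cons.prems by auto
    then show ?case using Cons assms(2) by (auto simp: M.smult_l_distr)
  qed (use assms(2) in auto)
qed

lemma msum_zero:
  assumes "module R M" "\<And>x. x \<in> set xs \<Longrightarrow> h x = \<zero>\<^bsub>M\<^esub>"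
  shows "msum M h xs = \<zero>\<^bsub>M\<^esub>"
proof -
  interpret M: module R M by fact
  show ?thesis using assms(2) by (induction xs) auto
qed

lemma msum_neg:
  assumes "module R M" "\<And>x. x \<in> set xs \<Longrightarrow> h x \<in> carrier M"
  shows "msum M (\<lambda>x. \<ominus>\<^bsub>M\<^esub> h x) xs = \<ominus>\<^bsub>M\<^esub> msum M h xs"
proof -
  interpret M: module R M by fact
  show ?thesis using assms(2)
    by (induction xs) (auto simp: msum_closed[OF assms(1)] M.minus_add neg_zero[OF assms(1)])
qed

lemma msum_hom:
  assumes "g \<in> module_hom R M N" "module R M" "module R N" "\<And>x. x \<in> set xs \<Longrightarrow> h x \<in> carrier M"
  shows "g (msum M h xs) = msum N (\<lambda>x. g (h x)) xs"
  using assms(4)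
  by (induction xs) (auto simp: mh_zero[OF assms(1-3)] mh_add[OF assms(1)] msum_closed[OF assms(2)])

lemma msum_swap:
  assumes "module R M" "\<And>x y. x \<in> set xs \<Longrightarrow> y \<in> set ys \<Longrightarrow> h x y \<in> carrier M"
  shows "msum M (\<lambda>x. msum M (h x) ys) xs = msum M (\<lambda>y. msum M (\<lambda>x. h x y) xs) ys"
  using assms(2)
proof (induction xs)
  case Nil then show ?case by (simp add: msum_zero[OF assms(1)])
next
  case (Cons a xs)
  then show ?case
    by (simp add: msum_add[OF assms(1)] msum_closed[OF assms(1)])
qed

section \<open>Local dual bases\<close>

abbreviation dual :: "('a, 'r) ring_scheme \<Rightarrow> ('a, 'p) module \<Rightarrow> ('p \<Rightarrow> 'a) set" where
  "dual R P \<equiv> module_hom R P (regular_module R)"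

text \<open>\<open>ldb\<close> asks for a dual basis on each finite set separately. This covers all projective modules
  without a finiteness condition, and it suffices for the arguments on tensor products; a finite
  dual basis of the whole module (\<open>fdb\<close>) is only needed for the splitting argument.\<close>

definition ldb :: "('a, 'r) ring_scheme \<Rightarrow> ('a, 'p) module \<Rightarrow> bool" where
  "ldb R P \<longleftrightarrow> module R P \<and> (\<forall>S. finite S \<longrightarrow> S \<subseteq> carrier P \<longrightarrow>
     (\<exists>L. set L \<subseteq> dual R P \<times> carrier P \<and>
          (\<forall>x \<in> S. x = msum P (\<lambda>(f, y). f x \<odot>\<^bsub>P\<^esub> y) L)))"

definition fdb :: "('a, 'r) ring_scheme \<Rightarrow> ('a, 'p) module \<Rightarrow> bool" where
  "fdb R P \<longleftrightarrow> module R P \<and> (\<exists>L. set L \<subseteq> dual R P \<times> carrier P \<and>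
          (\<forall>x \<in> carrier P. x = msum P (\<lambda>(f, y). f x \<odot>\<^bsub>P\<^esub> y) L))"

lemma ldb_module: "ldb R P \<Longrightarrow> module R P" by (simp add: ldb_def)

lemma ldbE:
  assumes "ldb R P" "finite S" "S \<subseteq> carrier P"
  obtains L where "set L \<subseteq> dual R P \<times> carrier P"
    "\<And>x. x \<in> S \<Longrightarrow> x = msum P (\<lambda>(f, y). f x \<odot>\<^bsub>P\<^esub> y) L"
  using assms by (auto simp: ldb_def)

text \<open>A dual basis \<open>(f, y)\<close> for the image of \<open>S\<close> in \<open>F\<close>
  is pulled back to \<open>(f o s, p y)\<close>; applying \<open>p\<close> to the expansion of
  \<open>s x\<close> recovers \<open>x\<close>.\<close>

lemma ldb_retract:
  assumes "ldb R F" "module R P" "s \<in> module_hom R P F" "p \<in> module_hom R F P"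
    "\<And>x. x \<in> carrier P \<Longrightarrow> p (s x) = x"
  shows "ldb R P"
  unfolding ldb_def
proof (intro conjI allI impI assms)
  fix S assume S: "finite S" "S \<subseteq> carrier P"
  have mF: "module R F" by (rule ldb_module) fact
  interpret F: module R F by fact
  obtain L where L: "set L \<subseteq> dual R F \<times> carrier F"
    "\<And>x. x \<in> s ` S \<Longrightarrow> x = msum F (\<lambda>(f, y). f x \<odot>\<^bsub>F\<^esub> y) L"
    by (rule ldbE[OF assms(1), of "s ` S"]) (use S assms(3) in \<open>auto simp: mh_closed\<close>)
  let ?L = "map (\<lambda>(f, y). (\<lambda>x. f (s x), p y)) L"
  show "\<exists>L. set L \<subseteq> dual R P \<times> carrier P \<and> (\<forall>x\<in>S. x = msum P (\<lambda>(f, y). f x \<odot>\<^bsub>P\<^esub> y) L)"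
  proof (intro exI[of _ ?L] conjI ballI)
    show "set ?L \<subseteq> dual R P \<times> carrier P"
      using L(1) assms(3,4) by (auto simp: mh_closed intro: mh_comp)
    fix x assume x: "x \<in> S"
    have sx: "s x \<in> carrier F" using mh_closed[OF assms(3)] x S(2) by auto
    have cl: "f (s x) \<in> carrier R" "y \<in> carrier F" if "(f, y) \<in> set L" for f y
    proof -
      have "f \<in> dual R F" using that L(1) by auto
      then show "f (s x) \<in> carrier R" using mh_closed[OF _ sx] by fastforce
      show "y \<in> carrier F" using that L(1) by auto
    qed
    have "x = p (s x)" using x S assms(5) by auto
    also have "\<dots> = p (msum F (\<lambda>(f, y). f (s x) \<odot>\<^bsub>F\<^esub> y) L)" using L(2) x by simp
    also have "\<dots> = msum P (\<lambda>fy. p ((\<lambda>(f, y). f (s x) \<odot>\<^bsub>F\<^esub> y) fy)) L"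
      by (rule msum_hom[OF assms(4) mF assms(2)]) (use cl in auto)
    also have "\<dots> = msum P (\<lambda>(f, y). f x \<odot>\<^bsub>P\<^esub> y) ?L"
      unfolding msum_map by (rule msum_cong) (use cl in \<open>auto simp: mh_smult[OF assms(4)]\<close>)
    finally show "x = msum P (\<lambda>(f, y). f x \<odot>\<^bsub>P\<^esub> y) ?L" .
  qed
qed

text \<open>Functionals separate points, because all coefficients in an expansion of
  \<open>x\<close> vanish.\<close>

lemma ldb_zero_iff:
  assumes "ldb R P" "x \<in> carrier P" "\<And>f. f \<in> dual R P \<Longrightarrow> f x = \<zero>\<^bsub>R\<^esub>"
  shows "x = \<zero>\<^bsub>P\<^esub>"
proof -
  interpret P: module R P using ldb_module[OF assms(1)] .
  obtain L where L: "set L \<subseteq> dual R P \<times> carrier P" "x = msum P (\<lambda>(f, y). f x \<odot>\<^bsub>P\<^esub> y) L"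
    using ldbE[OF assms(1), of "{x}"] assms(2) by auto
  have "msum P (\<lambda>(f, y). f x \<odot>\<^bsub>P\<^esub> y) L = \<zero>\<^bsub>P\<^esub>"
    by (rule msum_zero[OF ldb_module[OF assms(1)]]) (use L(1) assms(3) in \<open>auto simp: subset_iff assms(3)\<close>)
  then show ?thesis using L(2) by simp
qed

section \<open>Tensors as lists\<close>

text \<open>A list \<open>u\<close> of pairs represents the tensor \<open>\<Sum> x \<otimes> y\<close> in \<open>P \<otimes> M\<close>. When \<open>P\<close> has local dual
  bases, a tensor vanishes iff all its contractions \<open>\<Sum> f x \<odot> y\<close> with functionals \<open>f\<close> vanish.\<close>

definition contract :: "('a, 'm) module \<Rightarrow> ('p \<Rightarrow> 'a) \<Rightarrow> ('p \<times> 'm) list \<Rightarrow> 'm" where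
  "contract M f u = msum M (\<lambda>(x, y). f x \<odot>\<^bsub>M\<^esub> y) u"

definition teq :: "('a, 'r) ring_scheme \<Rightarrow> ('a, 'p) module \<Rightarrow> ('a, 'm) module \<Rightarrow>
    ('p \<times> 'm) list \<Rightarrow> ('p \<times> 'm) list \<Rightarrow> bool" where
  "teq R P M u v \<longleftrightarrow> (\<forall>f \<in> dual R P. contract M f u = contract M f v)"

text \<open>A list offers no subtraction, so the sign is moved into the second entry of each
  pair.\<close>

definition negt :: "('a, 'm) module \<Rightarrow> ('p \<times> 'm) list \<Rightarrow> ('p \<times> 'm) list" where
  "negt M = map (map_prod id (a_inv M))"

lemma contract_Nil [simp]: "contract M f [] = \<zero>\<^bsub>M\<^esub>"
  by (simp add: contract_def)

lemma contract_restrict [simp]: "contract (M\<lparr>carrier := K\<rparr>) f u = contract M f u"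
  by (simp add: contract_def)

lemma contract_closed:
  assumes "module R M" "f \<in> dual R P" "set u \<subseteq> carrier P \<times> carrier M"
  shows "contract M f u \<in> carrier M"
proof -
  interpret M: module R M by fact
  show ?thesis
    unfolding contract_def
    by (rule msum_closed[OF assms(1)]) (use assms mh_closed[OF assms(2)] in auto)
qed

text \<open>Under contraction, a map on the left factor turns into precomposition of the functional;
  the differential of \<open>P\<close> tensor \<open>M\<close> is seen only through
  \<open>f (d x)\<close>.\<close>

lemma contract_map_left: "contract M f (map (map_prod d id) u) = contract M (\<lambda>x. f (d x)) u"
  by (simp add: contract_def case_prod_unfold)

lemma contract_map_right:
  assumes "g \<in> module_hom R M N" "module R M" "module R N" "f \<in> dual R P"
    "set u \<subseteq> carrier P \<times> carrier M"
  shows "contract N f (map (map_prod id g) u) = g (contract M f u)"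
proof -
  interpret M: module R M by fact
  have cl: "f x \<in> carrier R" "y \<in> carrier M" if "(x, y) \<in> set u" for x y
    using that assms(5) mh_closed[OF assms(4)] by auto
  have "g (contract M f u) = msum N (\<lambda>z. g ((\<lambda>(x, y). f x \<odot>\<^bsub>M\<^esub> y) z)) u"
    unfolding contract_def by (rule msum_hom[OF assms(1-3)]) (use cl in auto)
  also have "\<dots> = contract N f (map (map_prod id g) u)"
    unfolding contract_def msum_map by (rule msum_cong) (use cl in \<open>auto simp: mh_smult[OF assms(1)]\<close>)
  finally show ?thesis by simp
qed

lemma contract_append:
  assumes "module R M" "f \<in> dual R P" "set u \<subseteq> carrier P \<times> carrier M" "set v \<subseteq> carrier P \<times> carrier M"
  shows "contract M f (u @ v) = contract M f u \<oplus>\<^bsub>M\<^esub> contract M f v"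
proof -
  interpret M: module R M by fact
  show ?thesis
    unfolding contract_def
    by (rule msum_append[OF assms(1)]) (use assms mh_closed[OF assms(2)] in auto)
qed

lemma contract_negt:
  assumes "module R M" "f \<in> dual R P" "set u \<subseteq> carrier P \<times> carrier M"
  shows "contract M f (negt M u) = \<ominus>\<^bsub>M\<^esub> contract M f u"
proof -
  interpret M: module R M by fact
  have cl: "f x \<in> carrier R" "y \<in> carrier M" if "(x, y) \<in> set u" for x y
    using that assms(3) mh_closed[OF assms(2)] by auto
  have "contract M f (negt M u) = msum M (\<lambda>z. \<ominus>\<^bsub>M\<^esub> (\<lambda>(x, y). f x \<odot>\<^bsub>M\<^esub> y) z) u"
    unfolding contract_def negt_def msum_map
    by (rule msum_cong) (use cl in \<open>auto simp: M.smult_r_minus\<close>)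
  also have "\<dots> = \<ominus>\<^bsub>M\<^esub> contract M f u"
    unfolding contract_def by (rule msum_neg[OF assms(1)]) (use cl in auto)
  finally show ?thesis .
qed

lemma set_negt: "module R M \<Longrightarrow> set u \<subseteq> S \<times> carrier M \<Longrightarrow> set (negt M u) \<subseteq> S \<times> carrier M"
  using abelian_group.a_inv_closed[OF module_abelian_group] by (fastforce simp: negt_def)

lemma contract_fun_add:
  assumes "module R M" "f \<in> dual R P" "g \<in> dual R P" "set u \<subseteq> carrier P \<times> carrier M"
  shows "contract M (\<lambda>x. f x \<oplus>\<^bsub>R\<^esub> g x) u = contract M f u \<oplus>\<^bsub>M\<^esub> contract M g u"
proof -
  interpret M: module R M by fact
  have cl: "f x \<in> carrier R" "g x \<in> carrier R" "y \<in> carrier M" if "(x, y) \<in> set u" for x y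
    using that assms(4) mh_closed[OF assms(2)] mh_closed[OF assms(3)] by auto
  have "contract M (\<lambda>x. f x \<oplus>\<^bsub>R\<^esub> g x) u =
     msum M (\<lambda>z. (\<lambda>(x, y). f x \<odot>\<^bsub>M\<^esub> y) z \<oplus>\<^bsub>M\<^esub> (\<lambda>(x, y). g x \<odot>\<^bsub>M\<^esub> y) z) u"
    unfolding contract_def by (rule msum_cong) (use cl in \<open>auto simp: M.smult_l_distr\<close>)
  also have "\<dots> = contract M f u \<oplus>\<^bsub>M\<^esub> contract M g u"
    unfolding contract_def by (rule msum_add[OF assms(1)]) (use cl in auto)
  finally show ?thesis .
qed

lemma contract_cong: "(\<And>x y. (x, y) \<in> set u \<Longrightarrow> f x = g x) \<Longrightarrow> contract M f u = contract M g u"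
  unfolding contract_def by (rule msum_cong) auto

text \<open>Expand each first entry of \<open>w\<close> in the dual basis and move the coefficients
  across the tensor sign.\<close>

lemma teq_dual_basis:
  assumes "module R P" "module R M" "set w \<subseteq> carrier P \<times> carrier M" "set L \<subseteq> dual R P \<times> carrier P"
    and eq: "\<And>x. x \<in> fst ` set w \<Longrightarrow> x = msum P (\<lambda>(f, y). f x \<odot>\<^bsub>P\<^esub> y) L"
  shows "teq R P M (map (\<lambda>(f, y). (y, contract M f w)) L) w"
  unfolding teq_def
proof
  fix g assume g: "g \<in> dual R P"
  interpret M: module R M by fact
  interpret P: module R P by fact
  note mR = module_regular[OF M.is_cring]
  have cl: "x \<in> carrier P" "y \<in> carrier M" if "(x, y) \<in> set w" for x y
    using that assms(3) by auto
  have cl2: "f \<in> dual R P" "z \<in> carrier P" if "(f, z) \<in> set L" for f z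
    using that assms(4) by auto
  have cl3: "f x \<in> carrier R" "g z \<in> carrier R" if "(f, z) \<in> set L" "(x, y) \<in> set w" for f z x y
    using mh_closed[OF cl2(1)[OF that(1)] cl(1)[OF that(2)]] mh_closed[OF g cl2(2)[OF that(1)]] by auto
  have "contract M g (map (\<lambda>(f, y). (y, contract M f w)) L) =
      msum M (\<lambda>fz. msum M (\<lambda>xy. (g (snd fz) \<otimes>\<^bsub>R\<^esub> fst fz (fst xy)) \<odot>\<^bsub>M\<^esub> snd xy) w) L"
    unfolding contract_def msum_map
  proof (rule msum_cong, clarsimp)
    fix f z assume fz: "(f, z) \<in> set L"
    have "g z \<odot>\<^bsub>M\<^esub> msum M (\<lambda>(x, y). f x \<odot>\<^bsub>M\<^esub> y) w =
       msum M (\<lambda>xy. g z \<odot>\<^bsub>M\<^esub> (\<lambda>(x, y). f x \<odot>\<^bsub>M\<^esub> y) xy) w"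
      by (rule msum_smult[OF assms(2)]) (use mh_closed[OF g] cl2[OF fz] cl3[OF fz] cl in auto)
    also have "\<dots> = msum M (\<lambda>xy. (g z \<otimes>\<^bsub>R\<^esub> f (fst xy)) \<odot>\<^bsub>M\<^esub> snd xy) w"
      by (rule msum_cong) (use cl3[OF fz] cl in \<open>auto simp: M.smult_assoc1\<close>)
    finally show "g z \<odot>\<^bsub>M\<^esub> msum M (\<lambda>(x, y). f x \<odot>\<^bsub>M\<^esub> y) w =
      msum M (\<lambda>xy. (g z \<otimes>\<^bsub>R\<^esub> f (fst xy)) \<odot>\<^bsub>M\<^esub> snd xy) w" .
  qed
  \<comment> \<open>Exchanging the summations groups the terms by the pairs \<open>(x, y)\<close> of
    \<open>w\<close>; by the dual basis, the coefficient of \<open>y\<close> in each group is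
    \<open>g x\<close>.\<close>
  also have "\<dots> = msum M (\<lambda>xy. msum M (\<lambda>fz. (g (snd fz) \<otimes>\<^bsub>R\<^esub> fst fz (fst xy)) \<odot>\<^bsub>M\<^esub> snd xy) L) w"
    by (rule msum_swap[OF assms(2)]) (use cl3 cl in auto)
  also have "\<dots> = contract M g w"
    unfolding contract_def
  proof (rule msum_cong, clarsimp)
    fix x y assume xy: "(x, y) \<in> set w"
    then have x: "x = msum P (\<lambda>(f, y). f x \<odot>\<^bsub>P\<^esub> y) L" by (intro eq) force
    have "g x = g (msum P (\<lambda>(f, y). f x \<odot>\<^bsub>P\<^esub> y) L)" using x by simp
    also have "\<dots> = msum (regular_module R) (\<lambda>fz. g ((\<lambda>(f, y). f x \<odot>\<^bsub>P\<^esub> y) fz)) L"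
      by (rule msum_hom[OF g assms(1) mR]) (use cl2 cl3[OF _ xy] in auto)
    also have "\<dots> = msum (regular_module R) (\<lambda>fz. g (snd fz) \<otimes>\<^bsub>R\<^esub> fst fz x) L"
      by (rule msum_cong) (use cl2 cl3[OF _ xy] in \<open>auto simp: mh_smult[OF g] M.R.m_comm\<close>)
    finally show "msum M (\<lambda>fz. (g (snd fz) \<otimes>\<^bsub>R\<^esub> fst fz x) \<odot>\<^bsub>M\<^esub> y) L = g x \<odot>\<^bsub>M\<^esub> y"
      by (simp, subst msum_smult_left[OF assms(2)]) (use cl3[OF _ xy] cl[OF xy] in auto)
  qed
  finally show "contract M g (map (\<lambda>(f, y). (y, contract M f w)) L) = contract M g w" .
qed

text \<open>The list produced by \<open>teq_dual_basis\<close> has contractions as second entries,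
  so these lie in \<open>K\<close>. With \<open>K\<close> a kernel this replaces exactness of the
  tensor product with \<open>P\<close>.\<close>

lemma teq_lift_submodule:
  assumes "ldb R P" "module R M" "set w \<subseteq> carrier P \<times> carrier M"
    "\<And>f. f \<in> dual R P \<Longrightarrow> contract M f w \<in> K"
  shows "\<exists>v. set v \<subseteq> carrier P \<times> K \<and> teq R P M v w"
proof -
  obtain L where L: "set L \<subseteq> dual R P \<times> carrier P"
    "\<And>x. x \<in> fst ` set w \<Longrightarrow> x = msum P (\<lambda>(f, y). f x \<odot>\<^bsub>P\<^esub> y) L"
    by (rule ldbE[OF assms(1), of "fst ` set w"]) (use assms(3) in auto)
  show ?thesis
    by (rule exI[of _ "map (\<lambda>(f, y). (y, contract M f w)) L"])
      (use L(1) assms(4) teq_dual_basis[OF ldb_module[OF assms(1)] assms(2,3) L] in auto)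
qed

section \<open>Free and projective modules\<close>

lemma free_module_simps [simp]:
  "add (free_module R B) = (\<lambda>f g x. f x \<oplus>\<^bsub>R\<^esub> g x)"
  "ring.zero (free_module R B) = (\<lambda>x. \<zero>\<^bsub>R\<^esub>)"
  "smult (free_module R B) = (\<lambda>r f x. r \<otimes>\<^bsub>R\<^esub> f x)"
  by (simp_all add: free_module_def)

lemma carrier_free_module: "f \<in> carrier (free_module R B) \<longleftrightarrow>
    (\<forall>x \<in> B. f x \<in> carrier R) \<and> (\<forall>x. x \<notin> B \<longrightarrow> f x = \<zero>\<^bsub>R\<^esub>) \<and> finite {x. f x \<noteq> \<zero>\<^bsub>R\<^esub>}"
  by (simp add: free_module_def)

lemma free_module_value:
  assumes "cring R" "f \<in> carrier (free_module R B)"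
  shows "f x \<in> carrier R"
proof -
  interpret cring R by fact
  show ?thesis using assms(2) by (cases "x \<in> B") (auto simp: carrier_free_module)
qed

lemma module_free_module:
  fixes R (structure)
  assumes "cring R" shows "module R (free_module R B)"
proof -
  interpret cring R by fact
  note val = free_module_value[OF assms, of _ B]
  have add: "f \<oplus>\<^bsub>free_module R B\<^esub> g \<in> carrier (free_module R B)"
    if "f \<in> carrier (free_module R B)" "g \<in> carrier (free_module R B)" for f g
  proof -
    have "{x. f x \<oplus> g x \<noteq> \<zero>} \<subseteq> {x. f x \<noteq> \<zero>} \<union> {x. g x \<noteq> \<zero>}" by auto
    then have "finite {x. f x \<oplus> g x \<noteq> \<zero>}"
      using that by (auto simp: carrier_free_module intro: finite_subset)
    then show ?thesis using that by (auto simp: carrier_free_module)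
  qed
  have sm: "r \<odot>\<^bsub>free_module R B\<^esub> f \<in> carrier (free_module R B)"
    if "r \<in> carrier R" "f \<in> carrier (free_module R B)" for r f
  proof -
    have "{x. r \<otimes> f x \<noteq> \<zero>} \<subseteq> {x. f x \<noteq> \<zero>}" using that by auto
    then have "finite {x. r \<otimes> f x \<noteq> \<zero>}"
      using that by (auto simp: carrier_free_module intro: finite_subset)
    then show ?thesis using that by (auto simp: carrier_free_module)
  qed
  show ?thesis
  proof (rule moduleI)
    show "abelian_group (free_module R B)"
    proof (rule abelian_groupI)
      fix f assume f: "f \<in> carrier (free_module R B)"
      \<comment> \<open>The negative is taken as the multiple by \<open>- 1\<close>, whose finite
        support is already known from \<open>sm\<close>.\<close>
      have "(\<ominus> \<one>) \<odot>\<^bsub>free_module R B\<^esub> f \<in> carrier (free_module R B)" by (rule sm) (use f in auto)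
      moreover have "((\<ominus> \<one>) \<odot>\<^bsub>free_module R B\<^esub> f) \<oplus>\<^bsub>free_module R B\<^esub> f = \<zero>\<^bsub>free_module R B\<^esub>"
        using val[OF f] by (auto simp: l_minus l_neg)
      ultimately show "\<exists>g\<in>carrier (free_module R B). g \<oplus>\<^bsub>free_module R B\<^esub> f = \<zero>\<^bsub>free_module R B\<^esub>"
        by blast
    next
      show "\<zero>\<^bsub>free_module R B\<^esub> \<in> carrier (free_module R B)" by (simp add: carrier_free_module)
    qed (use add val in \<open>auto simp: a_ac fun_eq_iff\<close>)
  qed (use sm add val assms in \<open>auto simp: l_distr r_distr m_assoc fun_eq_iff\<close>)
qed

definition unit_vec :: "('a, 'r) ring_scheme \<Rightarrow> 'x \<Rightarrow> 'x \<Rightarrow> 'a" where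
  "unit_vec R b = (\<lambda>x. if x = b then \<one>\<^bsub>R\<^esub> else \<zero>\<^bsub>R\<^esub>)"

lemma unit_vec_closed: "cring R \<Longrightarrow> b \<in> B \<Longrightarrow> unit_vec R b \<in> carrier (free_module R B)"
  by (auto simp: unit_vec_def carrier_free_module cring.cring_simprules
      intro: rev_finite_subset[of "{b}"])

text \<open>\<open>T\<close> may be larger than the support of \<open>f\<close>, so that one list
  can expand several elements at once.\<close>

lemma free_module_expand:
  fixes R (structure) and f :: "'x \<Rightarrow> 'a"
  assumes "cring R" "f \<in> carrier (free_module R B)" "distinct T" "{x. f x \<noteq> \<zero>\<^bsub>R\<^esub>} \<subseteq> set T"
  shows "f = msum (free_module R B) (\<lambda>b. f b \<odot>\<^bsub>free_module R B\<^esub> unit_vec R b) T"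
proof
  interpret cring R by fact
  fix c
  note val = free_module_value[OF assms(1,2)]
  have 1: "msum (free_module R B) h xs c = msum (regular_module R) (\<lambda>i. h i c) xs" for h and xs :: "'x list"
    by (induction xs) auto
  have 2: "msum (regular_module R) (\<lambda>b. f b \<otimes> unit_vec R b c) xs = (if c \<in> set xs then f c else \<zero>)"
    if "distinct xs" for xs
    using that val by (induction xs) (auto simp: unit_vec_def)
  show "f c = msum (free_module R B) (\<lambda>b. f b \<odot>\<^bsub>free_module R B\<^esub> unit_vec R b) T c"
    unfolding 1 using assms(3,4) by (auto simp: 2)
qed

text \<open>Finitely many elements have a finite joint support; the coordinates and unit vectors
  there form a dual basis for all of them.\<close>

lemma ldb_free_module:
  assumes "cring R" shows "ldb R (free_module R B)"
  unfolding ldb_def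
proof (intro conjI allI impI module_free_module assms)
  fix S assume S: "finite S" "S \<subseteq> carrier (free_module R B)"
  let ?T = "\<Union>f\<in>S. {x. f x \<noteq> \<zero>\<^bsub>R\<^esub>}"
  have fin: "finite {x. f x \<noteq> \<zero>\<^bsub>R\<^esub>}" and sB: "{x. f x \<noteq> \<zero>\<^bsub>R\<^esub>} \<subseteq> B" if "f \<in> S" for f
    using subsetD[OF S(2) that] unfolding carrier_free_module by blast+
  have T1: "finite ?T" by (rule finite_UN_I[OF S(1) fin])
  have T2: "?T \<subseteq> B" by (rule UN_least[OF sB])
  obtain xs where xs: "set xs = ?T" "distinct xs" using finite_distinct_list[OF T1] by blast
  have xsB: "unit_vec R b \<in> carrier (free_module R B)" if "b \<in> set xs" for b
    by (rule unit_vec_closed[OF assms subsetD[OF T2]]) (use that xs(1) in simp)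
  show "\<exists>L. set L \<subseteq> dual R (free_module R B) \<times> carrier (free_module R B) \<and>
     (\<forall>x\<in>S. x = msum (free_module R B) (\<lambda>(f, y). f x \<odot>\<^bsub>free_module R B\<^esub> y) L)"
  proof (intro exI[of _ "map (\<lambda>b. (\<lambda>f. f b, unit_vec R b)) xs"] conjI ballI)
    have "(\<lambda>f. f b) \<in> dual R (free_module R B)" for b
      by (rule module_homI) (use free_module_value[OF assms] in auto)
    then show "set (map (\<lambda>b. (\<lambda>f. f b, unit_vec R b)) xs)
        \<subseteq> dual R (free_module R B) \<times> carrier (free_module R B)"
      using xsB by auto
    fix f assume "f \<in> S"
    then show "f = msum (free_module R B) (\<lambda>(g, y). g f \<odot>\<^bsub>free_module R B\<^esub> y)
       (map (\<lambda>b. (\<lambda>f. f b, unit_vec R b)) xs)"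
      unfolding msum_map case_prod_conv
      by (intro free_module_expand assms xs) (use S xs in auto)
  qed
qed

lemma projective_module: "projective R P \<Longrightarrow> module R P"
  by (simp add: projective_def)

lemma projective_ldb:
  fixes P :: "('a, 'm) module"
  assumes "projective R P" shows "ldb R P"
proof -
  obtain B :: "'m set" and s p where sp: "s \<in> module_hom R P (free_module R B)"
    "p \<in> module_hom R (free_module R B) P" "\<And>x. x \<in> carrier P \<Longrightarrow> p (s x) = x"
    using assms(1) unfolding projective_def by blast
  note m = projective_module[OF assms]
  show ?thesis
    by (rule ldb_retract[OF ldb_free_module[OF module_cring[OF m]] m sp(1,2)]) (rule sp(3))
qed

section \<open>Maps out of free modules and the lifting property\<close>

lemma msum_finsum:
  assumes "module R A" "distinct xs" "\<And>x. x \<in> set xs \<Longrightarrow> h x \<in> carrier A"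
  shows "msum A h xs = finsum A h (set xs)"
proof -
  interpret A: module R A by fact
  show ?thesis using assms(2,3) by (induction xs) (auto simp: Pi_def)
qed

text \<open>Universal property of the free module. The map is built with \<open>finsum\<close>,
  which needs no ordering of the support; its value is exported as an \<open>msum\<close> over any
  enumeration, so that later proofs stay with lists.\<close>

lemma free_module_hom:
  assumes "module R A" "\<And>b. b \<in> B \<Longrightarrow> a b \<in> carrier A"
  shows "\<exists>\<psi> \<in> module_hom R (free_module R B) A. \<forall>f \<in> carrier (free_module R B). \<forall>xs.
     distinct xs \<longrightarrow> set xs = {x. f x \<noteq> \<zero>\<^bsub>R\<^esub>} \<longrightarrow> \<psi> f = msum A (\<lambda>b. f b \<odot>\<^bsub>A\<^esub> a b) xs"
proof -
  interpret A: module R A by fact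
  let ?F = "free_module R B"
  define \<psi> where "\<psi> f = finsum A (\<lambda>b. f b \<odot>\<^bsub>A\<^esub> a b) {x. f x \<noteq> \<zero>\<^bsub>R\<^esub>}" for f
  note val = free_module_value[OF A.is_cring]
  \<comment> \<open>Supports change under addition and scaling; enlarging the index set to a common
    finite \<open>T\<close> makes the sums comparable.\<close>
  have ext: "\<psi> f = finsum A (\<lambda>b. f b \<odot>\<^bsub>A\<^esub> a b) T"
    if f: "f \<in> carrier ?F" and T: "finite T" "{x. f x \<noteq> \<zero>\<^bsub>R\<^esub>} \<subseteq> T" "T \<subseteq> B" for f T
    unfolding \<psi>_def
    by (rule A.M.add.finprod_mono_neutral_cong_left) (use that val[OF f] assms(2) in auto)
  have supp: "finite {x. f x \<noteq> \<zero>\<^bsub>R\<^esub>}" "{x. f x \<noteq> \<zero>\<^bsub>R\<^esub>} \<subseteq> B" if "f \<in> carrier ?F" for f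
    using that by (auto simp: carrier_free_module)
  interpret F: module R ?F by (rule module_free_module[OF A.is_cring])
  have "\<psi> \<in> module_hom R ?F A"
  proof (rule module_homI)
    fix f assume f: "f \<in> carrier ?F"
    show "\<psi> f \<in> carrier A"
      unfolding \<psi>_def by (rule A.M.finsum_closed) (use val[OF f] supp(2)[OF f] assms(2) in auto)
    {
      fix g assume g: "g \<in> carrier ?F"
      let ?T = "{x. f x \<noteq> \<zero>\<^bsub>R\<^esub>} \<union> {x. g x \<noteq> \<zero>\<^bsub>R\<^esub>}"
      have T: "finite ?T" "?T \<subseteq> B" using supp f g by auto
      have fg: "f \<oplus>\<^bsub>?F\<^esub> g \<in> carrier ?F" using f g by (rule F.M.a_closed)
      have "\<psi> (f \<oplus>\<^bsub>?F\<^esub> g) = finsum A (\<lambda>b. (f \<oplus>\<^bsub>?F\<^esub> g) b \<odot>\<^bsub>A\<^esub> a b) ?T"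
        by (rule ext[OF fg T(1) _ T(2)]) auto
      also have "\<dots> = finsum A (\<lambda>b. f b \<odot>\<^bsub>A\<^esub> a b \<oplus>\<^bsub>A\<^esub> g b \<odot>\<^bsub>A\<^esub> a b) ?T"
        by (rule A.M.finsum_cong') (use T val[OF f] val[OF g] assms(2) in \<open>auto simp: A.smult_l_distr\<close>)
      also have "\<dots> = finsum A (\<lambda>b. f b \<odot>\<^bsub>A\<^esub> a b) ?T \<oplus>\<^bsub>A\<^esub> finsum A (\<lambda>b. g b \<odot>\<^bsub>A\<^esub> a b) ?T"
        by (rule A.M.finsum_addf) (use T val[OF f] val[OF g] assms(2) in auto)
      also have "\<dots> = \<psi> f \<oplus>\<^bsub>A\<^esub> \<psi> g"
        using ext[OF f T(1) _ T(2)] ext[OF g T(1) _ T(2)] by simp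
      finally show "\<psi> (f \<oplus>\<^bsub>?F\<^esub> g) = \<psi> f \<oplus>\<^bsub>A\<^esub> \<psi> g" .
    next
      fix r assume r: "r \<in> carrier R"
      have rf: "r \<odot>\<^bsub>?F\<^esub> f \<in> carrier ?F" using r f by (rule F.smult_closed)
      have "\<psi> (r \<odot>\<^bsub>?F\<^esub> f) = finsum A (\<lambda>b. (r \<odot>\<^bsub>?F\<^esub> f) b \<odot>\<^bsub>A\<^esub> a b) {x. f x \<noteq> \<zero>\<^bsub>R\<^esub>}"
        by (rule ext[OF rf supp(1)[OF f] _ supp(2)[OF f]]) (use r in auto)
      also have "\<dots> = finsum A (\<lambda>b. r \<odot>\<^bsub>A\<^esub> (f b \<odot>\<^bsub>A\<^esub> a b)) {x. f x \<noteq> \<zero>\<^bsub>R\<^esub>}"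
        by (rule A.M.finsum_cong')
          (use supp(2)[OF f] val[OF f] assms(2) r in \<open>auto simp: A.smult_assoc1\<close>)
      also have "\<dots> = r \<odot>\<^bsub>A\<^esub> \<psi> f"
        unfolding \<psi>_def
        by (rule A.finsum_smult_ldistr[symmetric]) (use supp[OF f] val[OF f] assms(2) r in auto)
      finally show "\<psi> (r \<odot>\<^bsub>?F\<^esub> f) = r \<odot>\<^bsub>A\<^esub> \<psi> f" .
    }
  qed
  moreover have "\<psi> f = msum A (\<lambda>b. f b \<odot>\<^bsub>A\<^esub> a b) xs"
    if f: "f \<in> carrier ?F" and xs: "distinct xs" "set xs = {x. f x \<noteq> \<zero>\<^bsub>R\<^esub>}" for f xs
    unfolding \<psi>_def xs(2)[symmetric]
    by (rule msum_finsum[symmetric, OF assms(1) xs(1)]) (use xs supp[OF f] val[OF f] assms(2) in auto)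
  ultimately show ?thesis by blast
qed

text \<open>Lift the images of the unit vectors, extend over the free module and restrict along
  \<open>s\<close>. The condition on \<open>h\<close> is pointwise because in the applications
  \<open>q\<close> is a differential, which need not be onto.\<close>

lemma projective_lift:
  fixes P :: "('a, 'm) module"
  assumes "projective R P" "q \<in> module_hom R A C" "module R A" "module R C"
    "h \<in> module_hom R P C" "\<And>x. x \<in> carrier P \<Longrightarrow> \<exists>a \<in> carrier A. q a = h x"
  shows "\<exists>\<psi> \<in> module_hom R P A. \<forall>x \<in> carrier P. q (\<psi> x) = h x"
proof -
  obtain B :: "'m set" and s p where sp: "s \<in> module_hom R P (free_module R B)"
    "p \<in> module_hom R (free_module R B) P" "\<And>x. x \<in> carrier P \<Longrightarrow> p (s x) = x"
    using assms(1) unfolding projective_def by blast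
  interpret A: module R A by fact
  interpret C: module R C by fact
  let ?F = "free_module R B"
  note cr = A.is_cring
  have e: "unit_vec R b \<in> carrier ?F" if "b \<in> B" for b by (rule unit_vec_closed[OF cr that])
  have "\<exists>a \<in> carrier A. q a = h (p (unit_vec R b))" if "b \<in> B" for b
    by (rule assms(6)[OF mh_closed[OF sp(2) e[OF that]]])
  then obtain a where a: "\<And>b. b \<in> B \<Longrightarrow> a b \<in> carrier A" "\<And>b. b \<in> B \<Longrightarrow> q (a b) = h (p (unit_vec R b))"
    by metis
  have hp: "(\<lambda>x. h (p x)) \<in> module_hom R ?F C" by (rule mh_comp[OF assms(5) sp(2)])
  obtain \<psi> where \<psi>: "\<psi> \<in> module_hom R ?F A" "\<And>f xs. f \<in> carrier ?F \<Longrightarrow> distinct xs \<Longrightarrow>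
     set xs = {x. f x \<noteq> \<zero>\<^bsub>R\<^esub>} \<Longrightarrow> \<psi> f = msum A (\<lambda>b. f b \<odot>\<^bsub>A\<^esub> a b) xs"
    using free_module_hom[OF assms(3), of B a] a(1) by blast
  have q\<psi>: "q (\<psi> f) = h (p f)" if f: "f \<in> carrier ?F" for f
  proof -
    have "finite {x. f x \<noteq> \<zero>\<^bsub>R\<^esub>}" and sB: "{x. f x \<noteq> \<zero>\<^bsub>R\<^esub>} \<subseteq> B" using f by (auto simp: carrier_free_module)
    then obtain xs where xs: "distinct xs" "set xs = {x. f x \<noteq> \<zero>\<^bsub>R\<^esub>}" using finite_distinct_list by metis
    then have xB: "x \<in> B" if "x \<in> set xs" for x using sB that by auto
    note val = free_module_value[OF cr f]
    have "q (\<psi> f) = msum C (\<lambda>b. q (f b \<odot>\<^bsub>A\<^esub> a b)) xs"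
      unfolding \<psi>(2)[OF f xs] by (rule msum_hom[OF assms(2-4)]) (use val a(1) xB in auto)
    also have "\<dots> = msum C (\<lambda>b. h (p (f b \<odot>\<^bsub>?F\<^esub> unit_vec R b))) xs"
    proof (rule msum_cong)
      fix b assume "b \<in> set xs"
      then have b: "b \<in> B" by (rule xB)
      show "q (f b \<odot>\<^bsub>A\<^esub> a b) = h (p (f b \<odot>\<^bsub>?F\<^esub> unit_vec R b))"
        using mh_smult[OF assms(2) val a(1)[OF b]] mh_smult[OF hp val e[OF b]] a(2)[OF b] by simp
    qed
    also have "\<dots> = h (p (msum ?F (\<lambda>b. f b \<odot>\<^bsub>?F\<^esub> unit_vec R b) xs))"
      by (rule msum_hom[symmetric, OF hp module_free_module[OF cr] assms(4)])
        (intro module.smult_closed[OF module_free_module[OF cr]] val e xB)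
    also have "\<dots> = h (p f)"
      using free_module_expand[OF cr f xs(1)] xs(2) by simp
    finally show ?thesis .
  qed
  show ?thesis
    by (intro bexI[OF _ mh_comp[OF \<psi>(1) sp(1)]] ballI) (use q\<psi> mh_closed[OF sp(1)] sp(3) in auto)
qed

lemma projective_retract:
  fixes P Q :: "('a, 'm) module"
  assumes "projective R P" "module R Q" "s \<in> module_hom R Q P" "p \<in> module_hom R P Q"
    "\<And>x. x \<in> carrier Q \<Longrightarrow> p (s x) = x"
  shows "projective R Q"
proof -
  obtain B :: "'m set" and s' p' where sp: "s' \<in> module_hom R P (free_module R B)"
    "p' \<in> module_hom R (free_module R B) P" "\<And>x. x \<in> carrier P \<Longrightarrow> p' (s' x) = x"
    using assms(1) unfolding projective_def by blast
  have "\<forall>x\<in>carrier Q. p (p' (s' (s x))) = x"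
    using sp(3) assms(5) mh_closed[OF assms(3)] by auto
  then show ?thesis unfolding projective_def
    using assms(2) mh_comp[OF sp(1) assms(3)] mh_comp[OF assms(4) sp(2)]
    by (intro conjI exI[of _ B] exI[of _ "\<lambda>x. s' (s x)"] exI[of _ "\<lambda>x. p (p' x)"]) auto
qed

lemma zero_module_projective:
  assumes "module R P" "carrier P = {\<zero>\<^bsub>P\<^esub>}"
  shows "projective R P"
proof -
  interpret P: module R P by fact
  note F = module_free_module[OF P.is_cring]
  show ?thesis
    unfolding projective_def
    using mh_zero_fun[OF assms(1) F] mh_zero_fun[OF F assms(1)] assms
    by (intro conjI exI[of _ "{}"] exI[of _ "\<lambda>x. \<zero>\<^bsub>free_module R {}\<^esub>"] exI[of _ "\<lambda>x. \<zero>\<^bsub>P\<^esub>"]) auto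
qed

section \<open>Comparison of projective resolutions\<close>

text \<open>The complexes are augmented: index 0 carries the resolved module, hence projectivity is
  asked from index 1 on. Each step lifts \<open>a o dU n\<close> through \<open>dV n\<close>, using
  surjectivity of \<open>dV 0\<close> at first and exactness afterwards.\<close>

lemma comparison_map:
  assumes U: "\<And>i. module R (U i)" "\<And>i. projective R (U (Suc i))"
    "\<And>i. dU i \<in> module_hom R (U (Suc i)) (U i)"
    "\<And>i x. x \<in> carrier (U (Suc (Suc i))) \<Longrightarrow> dU i (dU (Suc i) x) = \<zero>\<^bsub>U i\<^esub>"
    and V: "\<And>i. module R (V i)" "\<And>i. dV i \<in> module_hom R (V (Suc i)) (V i)"
    "carrier (V 0) \<subseteq> dV 0 ` carrier (V (Suc 0))"
    "\<And>i. a_kernel (V (Suc i)) (V i) (dV i) \<subseteq> dV (Suc i) ` carrier (V (Suc (Suc i)))"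
    and \<phi>: "\<phi> \<in> module_hom R (U 0) (V 0)"
  shows "\<exists>\<alpha>. \<alpha> 0 = \<phi> \<and> (\<forall>i. \<alpha> i \<in> module_hom R (U i) (V i)) \<and>
    (\<forall>i. \<forall>x \<in> carrier (U (Suc i)). dV i (\<alpha> (Suc i) x) = \<alpha> i (dU i x))"
proof -
  \<comment> \<open>The last conjunct is the invariant of the recursion: \<open>a o dU n\<close>
    takes cycles as values, so the next lift exists.\<close>
  let ?P = "\<lambda>n a. a \<in> module_hom R (U n) (V n) \<and> (n = 0 \<longrightarrow> a = \<phi>) \<and>
     (\<forall>m. n = Suc m \<longrightarrow> (\<forall>x \<in> carrier (U (Suc n)). dV m (a (dU n x)) = \<zero>\<^bsub>V m\<^esub>))"
  let ?Q = "\<lambda>n a b. \<forall>x \<in> carrier (U (Suc n)). dV n (b x) = a (dU n x)"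
  have "\<exists>\<alpha>. \<forall>n. ?P n (\<alpha> n) \<and> ?Q n (\<alpha> n) (\<alpha> (Suc n))"
  proof (rule dependent_nat_choice)
    show "\<exists>a. ?P 0 a" using \<phi> by auto
  next
    fix a n assume a: "?P n a"
    have h: "(\<lambda>x. a (dU n x)) \<in> module_hom R (U (Suc n)) (V n)" using a U(3) by (blast intro: mh_comp)
    have "\<exists>b \<in> module_hom R (U (Suc n)) (V (Suc n)). ?Q n a b"
    proof (rule projective_lift[OF U(2) V(2) V(1) V(1) h])
      fix x assume x: "x \<in> carrier (U (Suc n))"
      show "\<exists>y\<in>carrier (V (Suc n)). dV n y = a (dU n x)"
      proof (cases n)
        case 0
        then show ?thesis using V(3) mh_closed[OF h x] by (metis imageE subsetD)
      next
        case (Suc m)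
        then have "a (dU n x) \<in> a_kernel (V (Suc m)) (V m) (dV m)"
          using a x mh_closed[OF h x] Suc by (auto simp: a_kernel_def')
        then have "a (dU n x) \<in> dV (Suc m) ` carrier (V (Suc (Suc m)))"
          by (rule subsetD[OF V(4)])
        then show ?thesis unfolding Suc by (elim imageE) (rule bexI, rule sym)
      qed
    qed
    then obtain b where b: "b \<in> module_hom R (U (Suc n)) (V (Suc n))" "?Q n a b" by blast
    have "dV n (b (dU (Suc n) x)) = \<zero>\<^bsub>V n\<^esub>" if x: "x \<in> carrier (U (Suc (Suc n)))" for x
      using b(2) mh_closed[OF U(3) x] U(4)[OF x] a mh_zero[OF _ U(1) V(1)] by simp
    then show "\<exists>b. ?P (Suc n) b \<and> ?Q n a b" using b by (intro exI[of _ b]) auto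
  qed
  then show ?thesis by blast
qed

text \<open>The recursion starts with the zero map, as \<open>\<theta> 0\<close> vanishes. The
  component \<open>h (n + 1)\<close> lifts \<open>\<theta> (n + 1) - h n o dU n\<close>, which takes
  cycles as values by the formula for \<open>h n\<close>.\<close>

lemma null_homotopy:
  assumes U: "\<And>i. module R (U i)" "\<And>i. projective R (U (Suc i))"
    "\<And>i. dU i \<in> module_hom R (U (Suc i)) (U i)"
    "\<And>i x. x \<in> carrier (U (Suc (Suc i))) \<Longrightarrow> dU i (dU (Suc i) x) = \<zero>\<^bsub>U i\<^esub>"
    and V: "\<And>i. module R (V i)" "\<And>i. dV i \<in> module_hom R (V (Suc i)) (V i)"
    "\<And>i. a_kernel (V (Suc i)) (V i) (dV i) \<subseteq> dV (Suc i) ` carrier (V (Suc (Suc i)))"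
    and \<theta>: "\<And>i. \<theta> i \<in> module_hom R (U i) (V i)" "\<And>x. x \<in> carrier (U 0) \<Longrightarrow> \<theta> 0 x = \<zero>\<^bsub>V 0\<^esub>"
      "\<And>i x. x \<in> carrier (U (Suc i)) \<Longrightarrow> dV i (\<theta> (Suc i) x) = \<theta> i (dU i x)"
  shows "\<exists>h. (\<forall>i. h i \<in> module_hom R (U i) (V (Suc i))) \<and> (\<forall>i. \<forall>x \<in> carrier (U (Suc i)).
    \<theta> (Suc i) x = dV (Suc i) (h (Suc i) x) \<oplus>\<^bsub>V (Suc i)\<^esub> h i (dU i x))"
proof -
  let ?P = "\<lambda>n h. h \<in> module_hom R (U n) (V (Suc n)) \<and>
     (\<forall>x \<in> carrier (U (Suc n)). dV n (\<theta> (Suc n) x \<ominus>\<^bsub>V (Suc n)\<^esub> h (dU n x)) = \<zero>\<^bsub>V n\<^esub>)"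
  let ?Q = "\<lambda>n h h'. \<forall>x \<in> carrier (U (Suc n)).
     dV (Suc n) (h' x) = \<theta> (Suc n) x \<ominus>\<^bsub>V (Suc n)\<^esub> h (dU n x)"
  have "\<exists>h. \<forall>n. ?P n (h n) \<and> ?Q n (h n) (h (Suc n))"
  proof (rule dependent_nat_choice)
    interpret V1: module R "V (Suc 0)" by (rule V)
    have "dV 0 (\<theta> (Suc 0) x \<ominus>\<^bsub>V (Suc 0)\<^esub> \<zero>\<^bsub>V (Suc 0)\<^esub>) = \<zero>\<^bsub>V 0\<^esub>" if "x \<in> carrier (U (Suc 0))" for x
      using mh_closed[OF \<theta>(1) that] \<theta>(3)[OF that] \<theta>(2)[OF mh_closed[OF U(3) that]]
      by (simp add: a_minus_def neg_zero[OF V(1)])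
    then show "\<exists>h. ?P 0 h" using mh_zero_fun[OF U(1)[of 0] V(1)[of "Suc 0"]] by blast
  next
    fix h n assume h: "?P n h"
    interpret Vn: module R "V n" by (rule V)
    interpret V1: module R "V (Suc n)" by (rule V)
    have h1: "h \<in> module_hom R (U n) (V (Suc n))" using h by simp
    have hd: "(\<lambda>x. h (dU n x)) \<in> module_hom R (U (Suc n)) (V (Suc n))" by (rule mh_comp[OF h1 U(3)])
    have g: "(\<lambda>x. \<theta> (Suc n) x \<ominus>\<^bsub>V (Suc n)\<^esub> h (dU n x)) \<in> module_hom R (U (Suc n)) (V (Suc n))"
      by (rule mh_diff_fun[OF \<theta>(1) hd U(1) V(1)])
    have "\<exists>h' \<in> module_hom R (U (Suc n)) (V (Suc (Suc n))). ?Q n h h'"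
    proof (rule projective_lift[OF U(2) V(2) V(1) V(1) g])
      fix x assume x: "x \<in> carrier (U (Suc n))"
      have "\<theta> (Suc n) x \<ominus>\<^bsub>V (Suc n)\<^esub> h (dU n x) \<in> a_kernel (V (Suc n)) (V n) (dV n)"
        using mh_closed[OF g x] h x by (auto simp: a_kernel_def')
      then have "\<theta> (Suc n) x \<ominus>\<^bsub>V (Suc n)\<^esub> h (dU n x) \<in> dV (Suc n) ` carrier (V (Suc (Suc n)))"
        by (rule subsetD[OF V(3)])
      then show "\<exists>a\<in>carrier (V (Suc (Suc n))). dV (Suc n) a = \<theta> (Suc n) x \<ominus>\<^bsub>V (Suc n)\<^esub> h (dU n x)"
        by (elim imageE) (rule bexI, rule sym)
    qed
    then obtain h' where h': "h' \<in> module_hom R (U (Suc n)) (V (Suc (Suc n)))" "?Q n h h'" by blast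
    have "dV (Suc n) (\<theta> (Suc (Suc n)) x \<ominus>\<^bsub>V (Suc (Suc n))\<^esub> h' (dU (Suc n) x)) = \<zero>\<^bsub>V (Suc n)\<^esub>"
      if x: "x \<in> carrier (U (Suc (Suc n)))" for x
    proof -
      note dx = mh_closed[OF U(3) x]
      have "dV (Suc n) (\<theta> (Suc (Suc n)) x \<ominus>\<^bsub>V (Suc (Suc n))\<^esub> h' (dU (Suc n) x)) =
         dV (Suc n) (\<theta> (Suc (Suc n)) x) \<ominus>\<^bsub>V (Suc n)\<^esub> dV (Suc n) (h' (dU (Suc n) x))"
        by (rule mh_diff[OF V(2) V(1) V(1) mh_closed[OF \<theta>(1) x] mh_closed[OF h'(1) dx]])
      also have "\<dots> = \<theta> (Suc n) (dU (Suc n) x) \<ominus>\<^bsub>V (Suc n)\<^esub>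
          (\<theta> (Suc n) (dU (Suc n) x) \<ominus>\<^bsub>V (Suc n)\<^esub> h (dU n (dU (Suc n) x)))"
        using \<theta>(3)[OF x] h'(2) dx by simp
      also have "\<dots> = \<zero>\<^bsub>V (Suc n)\<^esub>"
        using mh_closed[OF \<theta>(1) dx] U(4)[OF x] mh_zero[OF h1 U(1) V(1)]
        by (simp add: a_minus_def neg_zero[OF V(1)] V1.M.r_neg)
      finally show ?thesis .
    qed
    then show "\<exists>h'. ?P (Suc n) h' \<and> ?Q n h h'" using h' by (intro exI[of _ h']) auto
  qed
  then obtain h where h: "\<And>n. ?P n (h n)" "\<And>n. ?Q n (h n) (h (Suc n))" by blast
  have "\<theta> (Suc i) x = dV (Suc i) (h (Suc i) x) \<oplus>\<^bsub>V (Suc i)\<^esub> h i (dU i x)"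
    if x: "x \<in> carrier (U (Suc i))" for i x
  proof -
    interpret V1: module R "V (Suc i)" by (rule V)
    have "h i \<in> module_hom R (U i) (V (Suc i))" using h(1) by blast
    then have "h i (dU i x) \<in> carrier (V (Suc i))" "\<theta> (Suc i) x \<in> carrier (V (Suc i))"
      using mh_closed[OF _ mh_closed[OF U(3) x]] mh_closed[OF \<theta>(1) x] by auto
    then show ?thesis using h(2)[of i] x by (simp add: a_minus_def V1.M.a_assoc V1.M.l_neg)
  qed
  then show ?thesis using h(1) by blast
qed

lemma resolutionD:
  assumes "resolution R P d e M"
  shows "module R M" "module R (P i)" "d i \<in> module_hom R (P (Suc i)) (P i)"
    "e \<in> module_hom R (P 0) M" "e ` carrier (P 0) = carrier M"
    "d 0 ` carrier (P (Suc 0)) = a_kernel (P 0) M e"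
    "d (Suc i) ` carrier (P (Suc (Suc i))) = a_kernel (P (Suc i)) (P i) (d i)"
  using assms by (auto simp: resolution_def)

lemma resolution_dd:
  assumes "resolution R P d e M"
  shows "x \<in> carrier (P (Suc 0)) \<Longrightarrow> e (d 0 x) = \<zero>\<^bsub>M\<^esub>"
    "x \<in> carrier (P (Suc (Suc i))) \<Longrightarrow> d i (d (Suc i) x) = \<zero>\<^bsub>P i\<^esub>"
  using resolutionD(6)[OF assms] resolutionD(7)[OF assms, of i] by (auto simp: a_kernel_def' set_eq_iff)

text \<open>The identity of \<open>M\<close> extends to chain maps both ways, and \<open>h\<close>
  is a homotopy for \<open>1 - \<alpha> \<beta>\<close>. The formula is stated in positive degrees,
  where Ext and Tor are tested below.\<close>

lemma resolution_homotopy: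
  fixes P :: "nat \<Rightarrow> ('a, 'p) module" and Q :: "nat \<Rightarrow> ('a, 'p) module" and M :: "('a, 'p) module"
  assumes P: "resolution R P d e M" "\<And>i. projective R (P i)"
    and Q: "resolution R Q d' e' M" "\<And>i. projective R (Q i)"
  obtains \<alpha> \<beta> h where
    "\<And>i. \<alpha> i \<in> module_hom R (P i) (Q i)" "\<And>i. \<beta> i \<in> module_hom R (Q i) (P i)"
    "\<And>i. h i \<in> module_hom R (Q i) (Q (Suc i))"
    "\<And>i x. x \<in> carrier (P (Suc i)) \<Longrightarrow> d' i (\<alpha> (Suc i) x) = \<alpha> i (d i x)"
    "\<And>i x. x \<in> carrier (Q (Suc i)) \<Longrightarrow> d i (\<beta> (Suc i) x) = \<beta> i (d' i x)"
    "\<And>i x. x \<in> carrier (Q (Suc i)) \<Longrightarrow> x = \<alpha> (Suc i) (\<beta> (Suc i) x) \<oplus>\<^bsub>Q (Suc i)\<^esub>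
       (d' (Suc i) (h (Suc i) x) \<oplus>\<^bsub>Q (Suc i)\<^esub> h i (d' i x))"
proof -
  \<comment> \<open>Shifting by one makes the augmentation an ordinary differential, so that it
    needs no separate treatment.\<close>
  define U where "U i = (case i of 0 \<Rightarrow> M | Suc j \<Rightarrow> P j)" for i
  define dU where "dU i = (case i of 0 \<Rightarrow> e | Suc j \<Rightarrow> d j)" for i
  define V where "V i = (case i of 0 \<Rightarrow> M | Suc j \<Rightarrow> Q j)" for i
  define dV where "dV i = (case i of 0 \<Rightarrow> e' | Suc j \<Rightarrow> d' j)" for i
  note PD = resolutionD[OF P(1)] and QD = resolutionD[OF Q(1)]
  have U: "\<And>i. module R (U i)" "\<And>i. projective R (U (Suc i))"
    "\<And>i. dU i \<in> module_hom R (U (Suc i)) (U i)"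
    "\<And>i x. x \<in> carrier (U (Suc (Suc i))) \<Longrightarrow> dU i (dU (Suc i) x) = \<zero>\<^bsub>U i\<^esub>"
    "carrier (U 0) \<subseteq> dU 0 ` carrier (U (Suc 0))"
    "\<And>i. a_kernel (U (Suc i)) (U i) (dU i) \<subseteq> dU (Suc i) ` carrier (U (Suc (Suc i)))"
    using PD P(2) resolution_dd[OF P(1)] by (auto simp: U_def dU_def split: nat.split)
  have V: "\<And>i. module R (V i)" "\<And>i. projective R (V (Suc i))"
    "\<And>i. dV i \<in> module_hom R (V (Suc i)) (V i)"
    "\<And>i x. x \<in> carrier (V (Suc (Suc i))) \<Longrightarrow> dV i (dV (Suc i) x) = \<zero>\<^bsub>V i\<^esub>"
    "carrier (V 0) \<subseteq> dV 0 ` carrier (V (Suc 0))"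
    "\<And>i. a_kernel (V (Suc i)) (V i) (dV i) \<subseteq> dV (Suc i) ` carrier (V (Suc (Suc i)))"
    using QD Q(2) resolution_dd[OF Q(1)] by (auto simp: V_def dV_def split: nat.split)
  have id0: "(\<lambda>x. x) \<in> module_hom R (U 0) (V 0)" "(\<lambda>x. x) \<in> module_hom R (V 0) (U 0)"
    by (auto simp: U_def V_def mh_id)
  obtain \<alpha> where \<alpha>: "\<alpha> 0 = (\<lambda>x. x)" "\<And>i. \<alpha> i \<in> module_hom R (U i) (V i)"
    "\<And>i x. x \<in> carrier (U (Suc i)) \<Longrightarrow> dV i (\<alpha> (Suc i) x) = \<alpha> i (dU i x)"
    using comparison_map[OF U(1-4) V(1,3,5,6) id0(1)] by blast
  obtain \<beta> where \<beta>: "\<beta> 0 = (\<lambda>x. x)" "\<And>i. \<beta> i \<in> module_hom R (V i) (U i)"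
    "\<And>i x. x \<in> carrier (V (Suc i)) \<Longrightarrow> dU i (\<beta> (Suc i) x) = \<beta> i (dV i x)"
    using comparison_map[OF V(1-4) U(1,3,5,6) id0(2)] by blast
  define \<theta> where "\<theta> i x = x \<ominus>\<^bsub>V i\<^esub> \<alpha> i (\<beta> i x)" for i x
  have \<theta>1: "\<theta> i \<in> module_hom R (V i) (V i)" for i
    unfolding \<theta>_def by (rule mh_diff_fun[OF mh_id mh_comp[OF \<alpha>(2) \<beta>(2)] V(1) V(1)])
  have \<theta>2: "\<theta> 0 x = \<zero>\<^bsub>V 0\<^esub>" if "x \<in> carrier (V 0)" for x
    using that abelian_group.r_neg[OF module_abelian_group[OF V(1)], of x 0]
    by (simp add: \<theta>_def \<alpha>(1) \<beta>(1) a_minus_def)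
  have \<theta>3: "dV i (\<theta> (Suc i) x) = \<theta> i (dV i x)" if x: "x \<in> carrier (V (Suc i))" for i x
    unfolding \<theta>_def
    using mh_diff[OF V(3) V(1) V(1) x mh_closed[OF \<alpha>(2) mh_closed[OF \<beta>(2) x]]]
      \<alpha>(3)[OF mh_closed[OF \<beta>(2) x]] \<beta>(3)[OF x] by simp
  obtain h where h: "\<And>i. h i \<in> module_hom R (V i) (V (Suc i))"
    "\<And>i x. x \<in> carrier (V (Suc i)) \<Longrightarrow>
       \<theta> (Suc i) x = dV (Suc i) (h (Suc i) x) \<oplus>\<^bsub>V (Suc i)\<^esub> h i (dV i x)"
    using null_homotopy[OF V(1-4) V(1,3,6) \<theta>1 \<theta>2 \<theta>3] by blast
  show thesis
  proof (rule that[of "\<lambda>i. \<alpha> (Suc i)" "\<lambda>i. \<beta> (Suc i)" "\<lambda>i. h (Suc i)"])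
    fix i
    show "\<alpha> (Suc i) \<in> module_hom R (P i) (Q i)" using \<alpha>(2)[of "Suc i"] by (simp add: U_def V_def)
    show "\<beta> (Suc i) \<in> module_hom R (Q i) (P i)" using \<beta>(2)[of "Suc i"] by (simp add: U_def V_def)
    show "h (Suc i) \<in> module_hom R (Q i) (Q (Suc i))" using h(1)[of "Suc i"] by (simp add: V_def)
    show "d' i (\<alpha> (Suc (Suc i)) x) = \<alpha> (Suc i) (d i x)" if "x \<in> carrier (P (Suc i))" for x
      using \<alpha>(3)[of x "Suc i"] that by (simp add: U_def dU_def dV_def)
    show "d i (\<beta> (Suc (Suc i)) x) = \<beta> (Suc i) (d' i x)" if "x \<in> carrier (Q (Suc i))" for x
      using \<beta>(3)[of x "Suc i"] that by (simp add: V_def dU_def dV_def)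
    fix x assume x: "x \<in> carrier (Q (Suc i))"
    interpret Q: module R "Q (Suc i)" by (rule QD)
    let ?i = "Suc (Suc i)"
    have x': "x \<in> carrier (V ?i)" using x by (simp add: V_def)
    have ab: "\<alpha> ?i (\<beta> ?i x) \<in> carrier (V ?i)" by (rule mh_closed[OF \<alpha>(2) mh_closed[OF \<beta>(2) x']])
    have "\<alpha> ?i (\<beta> ?i x) \<oplus>\<^bsub>V ?i\<^esub> \<theta> ?i x = x"
      using x' ab unfolding \<theta>_def a_minus_def by (simp add: V_def Q.M.a_ac Q.M.r_neg)
    then show "x = \<alpha> ?i (\<beta> ?i x) \<oplus>\<^bsub>Q (Suc i)\<^esub>
       (d' (Suc i) (h ?i x) \<oplus>\<^bsub>Q (Suc i)\<^esub> h (Suc i) (d' i x))"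
      using h(2)[OF x'] by (simp add: V_def dV_def)
  qed
qed

section \<open>Vanishing of Ext and Tor\<close>

text \<open>These two predicates express \<open>H\<^sup>j\<^sup>+\<^sup>1(Hom(P, N)) = 0\<close> and \<open>H\<^sub>j\<^sub>+\<^sub>1(P \<otimes> M) = 0\<close>; the index shift
  avoids the boundary case.\<close>

definition ext_vanish :: "('a, 'r) ring_scheme \<Rightarrow> (nat \<Rightarrow> ('a, 'p) module) \<Rightarrow> (nat \<Rightarrow> 'p \<Rightarrow> 'p) \<Rightarrow>
    ('a, 'n) module \<Rightarrow> nat \<Rightarrow> bool" where
  "ext_vanish R P d N j \<longleftrightarrow> (\<forall>f \<in> module_hom R (P (Suc j)) N.
     (\<forall>x \<in> carrier (P (Suc (Suc j))). f (d (Suc j) x) = \<zero>\<^bsub>N\<^esub>) \<longrightarrow>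
     (\<exists>g \<in> module_hom R (P j) N. \<forall>x \<in> carrier (P (Suc j)). f x = g (d j x)))"

definition tor_vanish :: "('a, 'r) ring_scheme \<Rightarrow> (nat \<Rightarrow> ('a, 'p) module) \<Rightarrow> (nat \<Rightarrow> 'p \<Rightarrow> 'p) \<Rightarrow>
    ('a, 'n) module \<Rightarrow> nat \<Rightarrow> bool" where
  "tor_vanish R P d M j \<longleftrightarrow> (\<forall>u. set u \<subseteq> carrier (P (Suc j)) \<times> carrier M \<longrightarrow>
     teq R (P j) M (map (map_prod (d j) id) u) [] \<longrightarrow>
     (\<exists>v. set v \<subseteq> carrier (P (Suc (Suc j))) \<times> carrier M \<and>
        teq R (P (Suc j)) M (map (map_prod (d (Suc j)) id) v) u))"

lemma tor_vanishD:
  assumes "tor_vanish R P d M j" "set u \<subseteq> carrier (P (Suc j)) \<times> carrier M"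
    "\<And>f. f \<in> dual R (P j) \<Longrightarrow> contract M (\<lambda>x. f (d j x)) u = \<zero>\<^bsub>M\<^esub>"
  obtains v where "set v \<subseteq> carrier (P (Suc (Suc j))) \<times> carrier M"
    "\<And>f. f \<in> dual R (P (Suc j)) \<Longrightarrow> contract M (\<lambda>x. f (d (Suc j) x)) v = contract M f u"
  using assms unfolding tor_vanish_def teq_def contract_map_left by (metis contract_Nil)

lemma tor_vanishI:
  assumes "\<And>u. set u \<subseteq> carrier (P (Suc j)) \<times> carrier M \<Longrightarrow>
    (\<And>f. f \<in> dual R (P j) \<Longrightarrow> contract M (\<lambda>x. f (d j x)) u = \<zero>\<^bsub>M\<^esub>) \<Longrightarrow>
    \<exists>v. set v \<subseteq> carrier (P (Suc (Suc j))) \<times> carrier M \<and>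
      (\<forall>f \<in> dual R (P (Suc j)). contract M (\<lambda>x. f (d (Suc j) x)) v = contract M f u)"
  shows "tor_vanish R P d M j"
  using assms unfolding tor_vanish_def teq_def contract_map_left by (metis contract_Nil)

section \<open>Independence of the chosen projective resolution\<close>

lemma map_left_set:
  assumes "set u \<subseteq> carrier A \<times> S" "h \<in> module_hom R A B"
  shows "set (map (map_prod h id) u) \<subseteq> carrier B \<times> S"
  using assms(1) by (auto simp: mh_closed[OF assms(2)])

lemma map_right_set:
  assumes "set u \<subseteq> S \<times> carrier A" "h \<in> module_hom R A B"
  shows "set (map (map_prod id h) u) \<subseteq> S \<times> carrier B"
  using assms(1) by (auto simp: mh_closed[OF assms(2)])

text \<open>Pull \<open>f\<close> back along \<open>\<alpha>\<close>, solve there by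
  \<open>g\<close>, and return along \<open>\<beta>\<close>. Of the homotopy terms,
  \<open>f o d' o h\<close> is zero by the cocycle condition and \<open>f o h o d'\<close> is itself
  a coboundary.\<close>

lemma ext_vanish_change:
  fixes P Q :: "nat \<Rightarrow> ('a, 'p) module" and M :: "('a, 'p) module"
  assumes P: "resolution R P d e M" "\<And>i. projective R (P i)"
    and Q: "resolution R Q d' e' M" "\<And>i. projective R (Q i)"
    and N: "module R N" and van: "ext_vanish R P d N j"
  shows "ext_vanish R Q d' N j"
  unfolding ext_vanish_def
proof (intro ballI impI)
  fix f assume f: "f \<in> module_hom R (Q (Suc j)) N"
    and cocycle: "\<forall>x\<in>carrier (Q (Suc (Suc j))). f (d' (Suc j) x) = \<zero>\<^bsub>N\<^esub>"
  obtain \<alpha> \<beta> h where \<alpha>: "\<And>i. \<alpha> i \<in> module_hom R (P i) (Q i)"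
    and \<beta>: "\<And>i. \<beta> i \<in> module_hom R (Q i) (P i)"
    and h: "\<And>i. h i \<in> module_hom R (Q i) (Q (Suc i))"
    and \<alpha>d: "\<And>i x. x \<in> carrier (P (Suc i)) \<Longrightarrow> d' i (\<alpha> (Suc i) x) = \<alpha> i (d i x)"
    and \<beta>d: "\<And>i x. x \<in> carrier (Q (Suc i)) \<Longrightarrow> d i (\<beta> (Suc i) x) = \<beta> i (d' i x)"
    and hd: "\<And>i x. x \<in> carrier (Q (Suc i)) \<Longrightarrow> x = \<alpha> (Suc i) (\<beta> (Suc i) x) \<oplus>\<^bsub>Q (Suc i)\<^esub>
       (d' (Suc i) (h (Suc i) x) \<oplus>\<^bsub>Q (Suc i)\<^esub> h i (d' i x))"
    by (rule resolution_homotopy[OF P Q]) blast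
  note PD = resolutionD[OF P(1)] and QD = resolutionD[OF Q(1)]
  interpret N: module R N by fact
  interpret Q1: module R "Q (Suc j)" by (rule QD)
  have f\<alpha>: "(\<lambda>x. f (\<alpha> (Suc j) x)) \<in> module_hom R (P (Suc j)) N" by (rule mh_comp[OF f \<alpha>])
  have "\<forall>x\<in>carrier (P (Suc (Suc j))). f (\<alpha> (Suc j) (d (Suc j) x)) = \<zero>\<^bsub>N\<^esub>"
    using cocycle mh_closed[OF \<alpha>] \<alpha>d[symmetric] by simp
  then obtain g where g: "g \<in> module_hom R (P j) N"
    "\<And>x. x \<in> carrier (P (Suc j)) \<Longrightarrow> f (\<alpha> (Suc j) x) = g (d j x)"
    using bspec[OF van[unfolded ext_vanish_def] f\<alpha>] by auto
  let ?g = "\<lambda>x. g (\<beta> j x) \<oplus>\<^bsub>N\<^esub> f (h j x)"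
  have gh: "?g \<in> module_hom R (Q j) N"
    by (rule mh_add_fun[OF mh_comp[OF g(1) \<beta>] mh_comp[OF f h] QD(2) N])
  show "\<exists>g \<in> module_hom R (Q j) N. \<forall>x \<in> carrier (Q (Suc j)). f x = g (d' j x)"
  proof (intro bexI[OF _ gh] ballI)
    fix x assume x: "x \<in> carrier (Q (Suc j))"
    note c1 = mh_closed[OF \<alpha> mh_closed[OF \<beta> x]] and c2 = mh_closed[OF h x]
      and c3 = mh_closed[OF h mh_closed[OF QD(3) x]]
    note c4 = mh_closed[OF QD(3) c2]
    have "f x = f (\<alpha> (Suc j) (\<beta> (Suc j) x) \<oplus>\<^bsub>Q (Suc j)\<^esub>
       (d' (Suc j) (h (Suc j) x) \<oplus>\<^bsub>Q (Suc j)\<^esub> h j (d' j x)))" using hd[OF x] by simp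
    also have "\<dots> = f (\<alpha> (Suc j) (\<beta> (Suc j) x)) \<oplus>\<^bsub>N\<^esub>
       (f (d' (Suc j) (h (Suc j) x)) \<oplus>\<^bsub>N\<^esub> f (h j (d' j x)))"
      using c1 c3 c4 by (simp add: mh_add[OF f])
    also have "\<dots> = g (\<beta> j (d' j x)) \<oplus>\<^bsub>N\<^esub> f (h j (d' j x))"
      using cocycle c2 c3 g(2) \<beta>d[OF x] mh_closed[OF \<beta> x] mh_closed[OF f] by simp
    finally show "f x = g (\<beta> j (d' j x)) \<oplus>\<^bsub>N\<^esub> f (h j (d' j x))" .
  qed
qed

text \<open>Transport \<open>u\<close> along \<open>\<beta>\<close>, fill it there by
  \<open>v\<close>, and return along \<open>\<alpha>\<close>. The homotopy term
  \<open>h o d'\<close> vanishes on the cycle and \<open>d' o h\<close> gives a boundary, so the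
  images of \<open>v\<close> under \<open>\<alpha>\<close> and of \<open>u\<close> under
  \<open>h\<close> together fill \<open>u\<close>.\<close>

lemma tor_vanish_change:
  fixes P Q :: "nat \<Rightarrow> ('a, 'p) module" and N :: "('a, 'p) module"
  assumes P: "resolution R P d e N" "\<And>i. projective R (P i)"
    and Q: "resolution R Q d' e' N" "\<And>i. projective R (Q i)"
    and M: "module R M" and van: "tor_vanish R P d M j"
  shows "tor_vanish R Q d' M j"
proof (rule tor_vanishI)
  fix u assume u: "set u \<subseteq> carrier (Q (Suc j)) \<times> carrier M"
    and cycle: "\<And>f. f \<in> dual R (Q j) \<Longrightarrow> contract M (\<lambda>x. f (d' j x)) u = \<zero>\<^bsub>M\<^esub>"
  obtain \<alpha> \<beta> h where \<alpha>: "\<And>i. \<alpha> i \<in> module_hom R (P i) (Q i)"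
    and \<beta>: "\<And>i. \<beta> i \<in> module_hom R (Q i) (P i)"
    and h: "\<And>i. h i \<in> module_hom R (Q i) (Q (Suc i))"
    and \<alpha>d: "\<And>i x. x \<in> carrier (P (Suc i)) \<Longrightarrow> d' i (\<alpha> (Suc i) x) = \<alpha> i (d i x)"
    and \<beta>d: "\<And>i x. x \<in> carrier (Q (Suc i)) \<Longrightarrow> d i (\<beta> (Suc i) x) = \<beta> i (d' i x)"
    and hd: "\<And>i x. x \<in> carrier (Q (Suc i)) \<Longrightarrow> x = \<alpha> (Suc i) (\<beta> (Suc i) x) \<oplus>\<^bsub>Q (Suc i)\<^esub>
       (d' (Suc i) (h (Suc i) x) \<oplus>\<^bsub>Q (Suc i)\<^esub> h i (d' i x))"
    by (rule resolution_homotopy[OF P Q]) blast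
  note PD = resolutionD[OF P(1)] and QD = resolutionD[OF Q(1)]
  interpret M: module R M by fact
  interpret Q1: module R "Q (Suc j)" by (rule QD)
  let ?u = "map (map_prod (\<beta> (Suc j)) id) u"
  have uQ: "x \<in> carrier (Q (Suc j))" if "(x, y) \<in> set u" for x y using that u by auto
  have u': "set ?u \<subseteq> carrier (P (Suc j)) \<times> carrier M"
    by (rule map_left_set[OF u \<beta>])
  have "contract M (\<lambda>x. f (d j x)) ?u = \<zero>\<^bsub>M\<^esub>" if f: "f \<in> dual R (P j)" for f
  proof -
    have "contract M (\<lambda>x. f (d j x)) ?u = contract M (\<lambda>x. f (\<beta> j (d' j x))) u"
      unfolding contract_map_left by (rule contract_cong) (use uQ \<beta>d in simp)
    also have "\<dots> = \<zero>\<^bsub>M\<^esub>" by (rule cycle[OF mh_comp[OF f \<beta>]])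
    finally show ?thesis .
  qed
  then obtain v where v: "set v \<subseteq> carrier (P (Suc (Suc j))) \<times> carrier M"
    "\<And>f. f \<in> dual R (P (Suc j)) \<Longrightarrow> contract M (\<lambda>x. f (d (Suc j) x)) v = contract M f ?u"
    using tor_vanishD[OF van u'] by blast
  let ?v1 = "map (map_prod (\<alpha> (Suc (Suc j))) id) v"
  let ?v2 = "map (map_prod (h (Suc j)) id) u"
  have v1: "set ?v1 \<subseteq> carrier (Q (Suc (Suc j))) \<times> carrier M"
    by (rule map_left_set[OF v(1) \<alpha>])
  have v2: "set ?v2 \<subseteq> carrier (Q (Suc (Suc j))) \<times> carrier M"
    by (rule map_left_set[OF u h])
  show "\<exists>v. set v \<subseteq> carrier (Q (Suc (Suc j))) \<times> carrier M \<and>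
    (\<forall>f\<in>dual R (Q (Suc j)). contract M (\<lambda>x. f (d' (Suc j) x)) v = contract M f u)"
  proof (intro exI[of _ "?v1 @ ?v2"] conjI ballI)
    show "set (?v1 @ ?v2) \<subseteq> carrier (Q (Suc (Suc j))) \<times> carrier M" using v1 v2 by auto
    fix f assume f: "f \<in> dual R (Q (Suc j))"
    have fd: "(\<lambda>x. f (d' (Suc j) x)) \<in> dual R (Q (Suc (Suc j)))" by (rule mh_comp[OF f QD(3)])
    have f\<alpha>: "(\<lambda>x. f (\<alpha> (Suc j) x)) \<in> dual R (P (Suc j))" by (rule mh_comp[OF f \<alpha>])
    have fh: "(\<lambda>x. f (h j x)) \<in> dual R (Q j)" by (rule mh_comp[OF f h])
    have A: "contract M (\<lambda>x. f (d' (Suc j) x)) ?v1 = contract M (\<lambda>x. f (\<alpha> (Suc j) (\<beta> (Suc j) x))) u"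
    proof -
      have "contract M (\<lambda>x. f (d' (Suc j) x)) ?v1 = contract M (\<lambda>x. f (\<alpha> (Suc j) (d (Suc j) x))) v"
        unfolding contract_map_left by (rule contract_cong) (use v(1) \<alpha>d in auto)
      also have "\<dots> = contract M (\<lambda>x. f (\<alpha> (Suc j) x)) ?u" by (rule v(2)[OF f\<alpha>])
      finally show ?thesis unfolding contract_map_left .
    qed
    let ?a = "\<lambda>x. f (\<alpha> (Suc j) (\<beta> (Suc j) x))" and ?b = "\<lambda>x. f (d' (Suc j) (h (Suc j) x))"
      and ?c = "\<lambda>x. f (h j (d' j x))"
    have abc: "?a \<in> dual R (Q (Suc j))" "?b \<in> dual R (Q (Suc j))" "?c \<in> dual R (Q (Suc j))"
      by (rule mh_comp[OF f\<alpha> \<beta>] mh_comp[OF fd h] mh_comp[OF fh QD(3)])+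
    have bc: "(\<lambda>x. ?b x \<oplus>\<^bsub>R\<^esub> ?c x) \<in> dual R (Q (Suc j))"
      using mh_add_fun[OF abc(2,3) QD(2) module_regular[OF M.is_cring]] by simp
    have "contract M f u = contract M (\<lambda>x. ?a x \<oplus>\<^bsub>R\<^esub> (?b x \<oplus>\<^bsub>R\<^esub> ?c x)) u"
    proof (rule contract_cong)
      fix x y assume "(x, y) \<in> set u"
      then have x: "x \<in> carrier (Q (Suc j))" by (rule uQ)
      note c1 = mh_closed[OF \<alpha> mh_closed[OF \<beta> x]] and c2 = mh_closed[OF h x]
        and c3 = mh_closed[OF h mh_closed[OF QD(3) x]]
      note c4 = mh_closed[OF QD(3) c2]
      have "f x = f (\<alpha> (Suc j) (\<beta> (Suc j) x) \<oplus>\<^bsub>Q (Suc j)\<^esub>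
         (d' (Suc j) (h (Suc j) x) \<oplus>\<^bsub>Q (Suc j)\<^esub> h j (d' j x)))" using hd[OF x] by simp
      also have "\<dots> = ?a x \<oplus>\<^bsub>R\<^esub> (?b x \<oplus>\<^bsub>R\<^esub> ?c x)"
        using c1 c3 c4 by (simp add: mh_add[OF f])
      finally show "f x = ?a x \<oplus>\<^bsub>R\<^esub> (?b x \<oplus>\<^bsub>R\<^esub> ?c x)" .
    qed
    also have "\<dots> = contract M ?a u \<oplus>\<^bsub>M\<^esub> (contract M ?b u \<oplus>\<^bsub>M\<^esub> contract M ?c u)"
      by (simp add: contract_fun_add[OF M abc(1) bc u] contract_fun_add[OF M abc(2,3) u])
    also have "contract M ?c u = \<zero>\<^bsub>M\<^esub>" by (rule cycle[OF fh])
    also have "contract M ?b u = contract M (\<lambda>x. f (d' (Suc j) x)) ?v2" by (simp add: contract_map_left)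
    also have "contract M ?a u = contract M (\<lambda>x. f (d' (Suc j) x)) ?v1" by (rule A[symmetric])
    also have "contract M (\<lambda>x. f (d' (Suc j) x)) ?v2 \<oplus>\<^bsub>M\<^esub> \<zero>\<^bsub>M\<^esub> = contract M (\<lambda>x. f (d' (Suc j) x)) ?v2"
      by (rule M.M.r_zero[OF contract_closed[OF M fd v2]])
    also note contract_append[OF M fd v1 v2, symmetric]
    finally show "contract M (\<lambda>x. f (d' (Suc j) x)) (?v1 @ ?v2) = contract M f u" by (rule sym)
  qed
qed

text \<open>Vanishing passes to retracts: fill the image of \<open>u\<close> under \<open>k\<close>
  and return along \<open>g\<close>. \<open>F\<close> and \<open>M\<close> may have different types,
  which carries results from \<open>'m\<close> to the quotients of \<open>R\<close>.\<close>

lemma tor_vanish_iso: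
  assumes "tor_vanish R P d F j" "\<And>i. module R (P i)" "\<And>i. d i \<in> module_hom R (P (Suc i)) (P i)"
    and "module R F" "module R M"
    and g: "g \<in> module_hom R F M" and k: "k \<in> module_hom R M F"
    and gk: "\<And>y. y \<in> carrier M \<Longrightarrow> g (k y) = y"
  shows "tor_vanish R P d M j"
proof (rule tor_vanishI)
  fix u assume u: "set u \<subseteq> carrier (P (Suc j)) \<times> carrier M"
    and cycle: "\<And>f. f \<in> dual R (P j) \<Longrightarrow> contract M (\<lambda>x. f (d j x)) u = \<zero>\<^bsub>M\<^esub>"
  let ?u = "map (map_prod id k) u"
  have u': "set ?u \<subseteq> carrier (P (Suc j)) \<times> carrier F" by (rule map_right_set[OF u k])
  have "contract F (\<lambda>x. f (d j x)) ?u = \<zero>\<^bsub>F\<^esub>" if f: "f \<in> dual R (P j)" for f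
    using contract_map_right[OF k assms(5,4) mh_comp[OF f assms(3)] u] cycle[OF f]
      mh_zero[OF k assms(5,4)] by simp
  then obtain v where v: "set v \<subseteq> carrier (P (Suc (Suc j))) \<times> carrier F"
    "\<And>f. f \<in> dual R (P (Suc j)) \<Longrightarrow> contract F (\<lambda>x. f (d (Suc j) x)) v = contract F f ?u"
    using tor_vanishD[OF assms(1) u'] by blast
  show "\<exists>v. set v \<subseteq> carrier (P (Suc (Suc j))) \<times> carrier M \<and>
      (\<forall>f \<in> dual R (P (Suc j)). contract M (\<lambda>x. f (d (Suc j) x)) v = contract M f u)"
  proof (intro exI[of _ "map (map_prod id g) v"] conjI ballI)
    show "set (map (map_prod id g) v) \<subseteq> carrier (P (Suc (Suc j))) \<times> carrier M"
      by (rule map_right_set[OF v(1) g])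
    fix f assume f: "f \<in> dual R (P (Suc j))"
    have "contract M (\<lambda>x. f (d (Suc j) x)) (map (map_prod id g) v) = g (contract F f ?u)"
      using contract_map_right[OF g assms(4,5) mh_comp[OF f assms(3)] v(1)] v(2)[OF f] by simp
    also have "\<dots> = g (k (contract M f u))" by (simp add: contract_map_right[OF k assms(5,4) f u])
    also have "\<dots> = contract M f u" by (rule gk[OF contract_closed[OF assms(5) f u]])
    finally show "contract M (\<lambda>x. f (d (Suc j) x)) (map (map_prod id g) v) = contract M f u" .
  qed
qed

section \<open>Dimension shifting along \<open>0 -> K -> F -> M -> 0\<close>\<close>

context
  fixes R :: "('a, 'r) ring_scheme" and P :: "nat \<Rightarrow> ('a, 'p) module" and d
    and F :: "('a, 'f) module" and M :: "('a, 'n) module" and g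
  assumes P: "\<And>i. ldb R (P i)" "\<And>i. d i \<in> module_hom R (P (Suc i)) (P i)"
    "\<And>i x. x \<in> carrier (P (Suc (Suc i))) \<Longrightarrow> d i (d (Suc i) x) = \<zero>\<^bsub>P i\<^esub>"
    and F: "module R F" and M: "module R M"
    and g: "g \<in> module_hom R F M" "g ` carrier F = carrier M"
begin

private abbreviation "K \<equiv> F\<lparr>carrier := a_kernel F M g\<rparr>"

lemma lift_tensor:
  assumes "set u \<subseteq> S \<times> carrier M"
  shows "\<exists>w. set w \<subseteq> S \<times> carrier F \<and> map (map_prod id g) w = u"
proof -
  have "\<forall>y \<in> carrier M. \<exists>x \<in> carrier F. g x = y" using g(2) by force
  then obtain k where k: "\<And>y. y \<in> carrier M \<Longrightarrow> k y \<in> carrier F \<and> g (k y) = y" by metis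
  have "set (map (map_prod id k) u) \<subseteq> S \<times> carrier F" using assms k by auto
  moreover have "map (map_prod id g) (map (map_prod id k) u) = u"
    unfolding map_map by (rule map_idI) (use assms k in auto)
  ultimately show ?thesis by blast
qed

lemma contract_dd:
  assumes "module R L" "f \<in> dual R (P i)" "set w \<subseteq> carrier (P (Suc (Suc i))) \<times> carrier L"
  shows "contract L (\<lambda>x. f (d i (d (Suc i) x))) w = \<zero>\<^bsub>L\<^esub>"
proof -
  interpret L: module R L by fact
  have "f \<zero>\<^bsub>P i\<^esub> = \<zero>\<^bsub>R\<^esub>"
    using mh_zero[OF assms(2) ldb_module[OF P(1)] module_regular[OF L.is_cring]] by simp
  then show ?thesis
    unfolding contract_def
    by (intro msum_zero[OF assms(1)]) (use assms(3) P(3) in auto)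
qed

text \<open>The part \<open>Tor(F) -> Tor(M) -> Tor(K)\<close> of the long exact sequence, in
  degrees \<open>j + 2\<close>, \<open>j + 2\<close> and \<open>j + 1\<close>, by chasing the
  connecting map.\<close>

lemma tor_vanish_down:
  assumes "tor_vanish R P d K j" "tor_vanish R P d F (Suc j)"
  shows "tor_vanish R P d M (Suc j)"
proof (rule tor_vanishI)
  fix u assume u: "set u \<subseteq> carrier (P (Suc (Suc j))) \<times> carrier M"
    and cycle: "\<And>f. f \<in> dual R (P (Suc j)) \<Longrightarrow> contract M (\<lambda>x. f (d (Suc j) x)) u = \<zero>\<^bsub>M\<^esub>"
  interpret F: module R F by (rule F)
  interpret M: module R M by (rule M)
  note mK = module_a_kernel[OF g(1) F M]
  have KF: "a_kernel F M g \<subseteq> carrier F" by (simp add: a_kernel_def')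
  note mP = ldb_module[OF P(1)]
  obtain w where w: "set w \<subseteq> carrier (P (Suc (Suc j))) \<times> carrier F" "map (map_prod id g) w = u"
    using lift_tensor[OF u] by blast
  let ?dw = "map (map_prod (d (Suc j)) id) w"
  have dw: "set ?dw \<subseteq> carrier (P (Suc j)) \<times> carrier F" by (rule map_left_set[OF w(1) P(2)])
  have ker: "contract F f ?dw \<in> a_kernel F M g" if f: "f \<in> dual R (P (Suc j))" for f
    using contract_map_right[OF g(1) F M mh_comp[OF f P(2)] w(1)] cycle[OF f]
      contract_closed[OF F f dw] w(2)
    by (simp add: a_kernel_def' contract_map_left)
  \<comment> \<open>The boundary of the lift \<open>w\<close> contracts into the kernel, hence can
    be rewritten with second entries in \<open>K\<close>. This is the value of the connecting
    map.\<close>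
  obtain v where v: "set v \<subseteq> carrier (P (Suc j)) \<times> a_kernel F M g" "teq R (P (Suc j)) F v ?dw"
    using teq_lift_submodule[OF P(1) F dw ker] by blast
  have vK: "set v \<subseteq> carrier (P (Suc j)) \<times> carrier K" using v(1) by simp
  have "contract K (\<lambda>x. f (d j x)) v = \<zero>\<^bsub>K\<^esub>" if f: "f \<in> dual R (P j)" for f
    using v(2) mh_comp[OF f P(2)[of j]] contract_dd[OF F f w(1)]
    by (simp add: teq_def contract_map_left)
  then obtain v' where v': "set v' \<subseteq> carrier (P (Suc (Suc j))) \<times> carrier K"
    "\<And>f. f \<in> dual R (P (Suc j)) \<Longrightarrow> contract K (\<lambda>x. f (d (Suc j) x)) v' = contract K f v"
    using tor_vanishD[OF assms(1) vK] by blast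
  have v'F: "set v' \<subseteq> carrier (P (Suc (Suc j))) \<times> carrier F" using v'(1) KF by auto
  \<comment> \<open>Subtracting a filling from \<open>K\<close> makes the lift a cycle and does not
    change its image in \<open>M\<close>.\<close>
  let ?w = "w @ negt F v'"
  note nv = set_negt[OF F v'F]
  have w2: "set ?w \<subseteq> carrier (P (Suc (Suc j))) \<times> carrier F" using w(1) nv by auto
  have "contract F (\<lambda>x. f (d (Suc j) x)) ?w = \<zero>\<^bsub>F\<^esub>" if f: "f \<in> dual R (P (Suc j))" for f
  proof -
    have fd: "(\<lambda>x. f (d (Suc j) x)) \<in> dual R (P (Suc (Suc j)))" by (rule mh_comp[OF f P(2)])
    have "contract F (\<lambda>x. f (d (Suc j) x)) v' = contract F (\<lambda>x. f (d (Suc j) x)) w"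
      using v'(2)[OF f] v(2) f by (simp add: teq_def contract_map_left)
    then show ?thesis
      using contract_append[OF F fd w(1) nv] contract_negt[OF F fd v'F] contract_closed[OF F fd w(1)]
      by (simp add: F.M.r_neg)
  qed
  then obtain w' where w': "set w' \<subseteq> carrier (P (Suc (Suc (Suc j)))) \<times> carrier F"
    "\<And>f. f \<in> dual R (P (Suc (Suc j))) \<Longrightarrow> contract F (\<lambda>x. f (d (Suc (Suc j)) x)) w' = contract F f ?w"
    using tor_vanishD[OF assms(2) w2] by blast
  show "\<exists>v. set v \<subseteq> carrier (P (Suc (Suc (Suc j)))) \<times> carrier M \<and>
      (\<forall>f \<in> dual R (P (Suc (Suc j))). contract M (\<lambda>x. f (d (Suc (Suc j)) x)) v = contract M f u)"
  proof (intro exI[of _ "map (map_prod id g) w'"] conjI ballI)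
    show "set (map (map_prod id g) w') \<subseteq> carrier (P (Suc (Suc (Suc j)))) \<times> carrier M"
      by (rule map_right_set[OF w'(1) g(1)])
    fix f assume f: "f \<in> dual R (P (Suc (Suc j)))"
    have "contract F f v' \<in> a_kernel F M g"
      using contract_closed[OF mK f v'(1)] by simp
    then have gv: "g (contract F f v') = \<zero>\<^bsub>M\<^esub>" by (simp add: a_kernel_def')
    have "contract M (\<lambda>x. f (d (Suc (Suc j)) x)) (map (map_prod id g) w') = g (contract F f ?w)"
      using contract_map_right[OF g(1) F M mh_comp[OF f P(2)] w'(1)] w'(2)[OF f] by simp
    also have "\<dots> = g (contract F f w) \<oplus>\<^bsub>M\<^esub> g (\<ominus>\<^bsub>F\<^esub> contract F f v')"
      using contract_append[OF F f w(1) nv] contract_negt[OF F f v'F]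
        contract_closed[OF F f w(1)] contract_closed[OF F f v'F] by (simp add: mh_add[OF g(1)])
    also have "\<dots> = g (contract F f w)"
      using mh_neg[OF g(1) F M contract_closed[OF F f v'F]] gv neg_zero[OF M]
        mh_closed[OF g(1) contract_closed[OF F f w(1)]] by simp
    also have "\<dots> = contract M f u"
      using contract_map_right[OF g(1) F M f w(1)] w(2) by simp
    finally show "contract M (\<lambda>x. f (d (Suc (Suc j)) x)) (map (map_prod id g) w') = contract M f u" .
  qed
qed

text \<open>The part \<open>Tor(M) -> Tor(K) -> Tor(F)\<close>, in degrees \<open>j + 2\<close>,
  \<open>j + 1\<close> and \<open>j + 1\<close>.\<close>

lemma tor_vanish_up:
  assumes "tor_vanish R P d M (Suc j)" "tor_vanish R P d F j"
  shows "tor_vanish R P d K j"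
proof (rule tor_vanishI)
  fix v assume vK: "set v \<subseteq> carrier (P (Suc j)) \<times> carrier K"
    and cycle: "\<And>f. f \<in> dual R (P j) \<Longrightarrow> contract K (\<lambda>x. f (d j x)) v = \<zero>\<^bsub>K\<^esub>"
  interpret F: module R F by (rule F)
  interpret M: module R M by (rule M)
  note mK = module_a_kernel[OF g(1) F M]
  have KF: "a_kernel F M g \<subseteq> carrier F" by (simp add: a_kernel_def')
  note mP = ldb_module[OF P(1)]
  have vF: "set v \<subseteq> carrier (P (Suc j)) \<times> carrier F" using vK KF by auto
  obtain w where w: "set w \<subseteq> carrier (P (Suc (Suc j))) \<times> carrier F"
    "\<And>f. f \<in> dual R (P (Suc j)) \<Longrightarrow> contract F (\<lambda>x. f (d (Suc j) x)) w = contract F f v"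
    using tor_vanishD[OF assms(2) vF] cycle by auto
  \<comment> \<open>The filling \<open>w\<close> exists over \<open>F\<close> only. Its image in
    \<open>M\<close> is a cycle and measures the failure of \<open>w\<close> to come from
    \<open>K\<close>.\<close>
  let ?u = "map (map_prod id g) w"
  have u: "set ?u \<subseteq> carrier (P (Suc (Suc j))) \<times> carrier M" by (rule map_right_set[OF w(1) g(1)])
  have "contract M (\<lambda>x. f (d (Suc j) x)) ?u = \<zero>\<^bsub>M\<^esub>" if f: "f \<in> dual R (P (Suc j))" for f
  proof -
    have "contract F f v \<in> a_kernel F M g" using contract_closed[OF mK f vK] by simp
    then show ?thesis
      using contract_map_right[OF g(1) F M mh_comp[OF f P(2)] w(1)] w(2)[OF f]
      by (simp add: a_kernel_def')
  qed
  then obtain u' where u': "set u' \<subseteq> carrier (P (Suc (Suc (Suc j)))) \<times> carrier M"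
    "\<And>f. f \<in> dual R (P (Suc (Suc j))) \<Longrightarrow> contract M (\<lambda>x. f (d (Suc (Suc j)) x)) u' = contract M f ?u"
    using tor_vanishD[OF assms(1) u] by blast
  obtain w' where w': "set w' \<subseteq> carrier (P (Suc (Suc (Suc j)))) \<times> carrier F" "map (map_prod id g) w' = u'"
    using lift_tensor[OF u'(1)] by blast
  let ?dw = "map (map_prod (d (Suc (Suc j))) id) w'"
  have dw: "set ?dw \<subseteq> carrier (P (Suc (Suc j))) \<times> carrier F" by (rule map_left_set[OF w'(1) P(2)])
  note nw = set_negt[OF F dw]
  \<comment> \<open>Correcting \<open>w\<close> by the boundary of a lifted filling of
    \<open>?u\<close> kills its image in \<open>M\<close> and keeps its own boundary, since the
    differential squares to zero.\<close>
  let ?w = "w @ negt F ?dw"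
  have w2: "set ?w \<subseteq> carrier (P (Suc (Suc j))) \<times> carrier F" using w(1) nw by auto
  have val: "contract F f ?w = contract F f w \<oplus>\<^bsub>F\<^esub> \<ominus>\<^bsub>F\<^esub> contract F (\<lambda>x. f (d (Suc (Suc j)) x)) w'"
    if f: "f \<in> dual R (P (Suc (Suc j)))" for f
    using contract_append[OF F f w(1) nw] contract_negt[OF F f dw] by (simp add: contract_map_left)
  have ker: "contract F f ?w \<in> a_kernel F M g" if f: "f \<in> dual R (P (Suc (Suc j)))" for f
  proof -
    note fd = mh_comp[OF f P(2)]
    have "g (contract F (\<lambda>x. f (d (Suc (Suc j)) x)) w') = g (contract F f w)"
      using contract_map_right[OF g(1) F M fd w'(1)] contract_map_right[OF g(1) F M f w(1)]
        u'(2)[OF f] w'(2) by simp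
    then have "g (contract F f ?w) = \<zero>\<^bsub>M\<^esub>"
      unfolding val[OF f]
      using contract_closed[OF F f w(1)] contract_closed[OF F fd w'(1)] mh_closed[OF g(1)]
      by (simp add: mh_add[OF g(1)] mh_neg[OF g(1) F M] M.M.r_neg)
    then show ?thesis using contract_closed[OF F f w2] by (simp add: a_kernel_def')
  qed
  obtain z where z: "set z \<subseteq> carrier (P (Suc (Suc j))) \<times> a_kernel F M g"
    "teq R (P (Suc (Suc j))) F z ?w"
    using teq_lift_submodule[OF P(1) F w2 ker] by blast
  show "\<exists>v'. set v' \<subseteq> carrier (P (Suc (Suc j))) \<times> carrier K \<and>
      (\<forall>f \<in> dual R (P (Suc j)). contract K (\<lambda>x. f (d (Suc j) x)) v' = contract K f v)"
  proof (intro exI[of _ z] conjI ballI)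
    show "set z \<subseteq> carrier (P (Suc (Suc j))) \<times> carrier K" using z(1) by simp
    fix f assume f: "f \<in> dual R (P (Suc j))"
    have fd: "(\<lambda>x. f (d (Suc j) x)) \<in> dual R (P (Suc (Suc j)))" by (rule mh_comp[OF f P(2)])
    have "contract F (\<lambda>x. f (d (Suc j) x)) z = contract F (\<lambda>x. f (d (Suc j) x)) ?w"
      using z(2) fd by (simp add: teq_def)
    also have "\<dots> = contract F f v"
      using val[OF fd] w(2)[OF f] contract_dd[OF F f w'(1)] contract_closed[OF F f vF]
      by (simp add: neg_zero[OF F])
    finally show "contract K (\<lambda>x. f (d (Suc j) x)) z = contract K f v" by simp
  qed
qed

end

text \<open>Modules with local dual bases are flat: contracting the second tensor factor with the
  functionals of a dual basis reduces exactness of \<open>P \<otimes> M\<close> to exactness of \<open>P\<close>.\<close>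

lemma ldb_tor_vanish:
  assumes P: "ldb R (P j)" "module R (P (Suc j))" "module R (P (Suc (Suc j)))"
    "d j \<in> module_hom R (P (Suc j)) (P j)"
    "d (Suc j) \<in> module_hom R (P (Suc (Suc j))) (P (Suc j))"
    "a_kernel (P (Suc j)) (P j) (d j) \<subseteq> d (Suc j) ` carrier (P (Suc (Suc j)))"
    and M: "ldb R M"
  shows "tor_vanish R P d M j"
proof (rule tor_vanishI)
  fix u assume u: "set u \<subseteq> carrier (P (Suc j)) \<times> carrier M"
    and cycle: "\<And>f. f \<in> dual R (P j) \<Longrightarrow> contract M (\<lambda>x. f (d j x)) u = \<zero>\<^bsub>M\<^esub>"
  note mM = ldb_module[OF M]
  interpret M: module R M by (rule mM)
  interpret P1: module R "P (Suc j)" by (rule P)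
  interpret P0: module R "P j" by (rule ldb_module[OF P(1)])
  note mR = module_regular[OF M.is_cring]
  obtain L where L: "set L \<subseteq> dual R M \<times> carrier M"
    "\<And>y. y \<in> snd ` set u \<Longrightarrow> y = msum M (\<lambda>(f, e). f y \<odot>\<^bsub>M\<^esub> e) L"
    by (rule ldbE[OF M, of "snd ` set u"]) (use u in auto)
  have uc: "x \<in> carrier (P (Suc j))" "y \<in> carrier M" if "(x, y) \<in> set u" for x y using that u by auto
  \<comment> \<open>Contraction of the other factor: \<open>k\<close> is evaluated on the second
    entries, which leaves an element of \<open>P (Suc j)\<close>.\<close>
  define z where "z k = msum (P (Suc j)) (\<lambda>(x, y). k y \<odot>\<^bsub>P (Suc j)\<^esub> x) u" for k :: "'d \<Rightarrow> 'a"
  have kc: "k y \<in> carrier R" if "k \<in> dual R M" "(x, y) \<in> set u" for k x y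
    using mh_closed[OF that(1) uc(2)[OF that(2)]] by simp
  have zc: "z k \<in> carrier (P (Suc j))" if k: "k \<in> dual R M" for k
    unfolding z_def by (rule msum_closed[OF P(2)]) (use uc kc[OF k] in auto)
  have fz: "f (z k) = k (contract M f u)" if k: "k \<in> dual R M" and f: "f \<in> dual R (P (Suc j))" for k f
  proof -
    have fc: "f x \<in> carrier R" if "(x, y) \<in> set u" for x y using mh_closed[OF f uc(1)[OF that]] by simp
    have "f (z k) = msum (regular_module R) (\<lambda>xy. f ((\<lambda>(x, y). k y \<odot>\<^bsub>P (Suc j)\<^esub> x) xy)) u"
      unfolding z_def by (rule msum_hom[OF f P(2) mR]) (use uc kc[OF k] in auto)
    also have "\<dots> = msum (regular_module R) (\<lambda>xy. k ((\<lambda>(x, y). f x \<odot>\<^bsub>M\<^esub> y) xy)) u"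
      by (rule msum_cong)
        (use uc kc[OF k] fc in \<open>auto simp: mh_smult[OF k] mh_smult[OF f] M.R.m_comm\<close>)
    also have "\<dots> = k (contract M f u)"
      unfolding contract_def by (rule msum_hom[symmetric, OF k mM mR]) (use uc fc in auto)
    finally show ?thesis .
  qed
  have "\<exists>w \<in> carrier (P (Suc (Suc j))). d (Suc j) w = z k" if k: "k \<in> dual R M" for k
  proof -
    have "d j (z k) = \<zero>\<^bsub>P j\<^esub>"
    proof (rule ldb_zero_iff[OF P(1) mh_closed[OF P(4) zc[OF k]]])
      fix f assume f: "f \<in> dual R (P j)"
      show "f (d j (z k)) = \<zero>\<^bsub>R\<^esub>"
        using fz[OF k mh_comp[OF f P(4)]] cycle[OF f] mh_zero[OF k mM mR] by simp
    qed
    then have "z k \<in> a_kernel (P (Suc j)) (P j) (d j)" using zc[OF k] by (simp add: a_kernel_def')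
    then have "z k \<in> d (Suc j) ` carrier (P (Suc (Suc j)))" by (rule subsetD[OF P(6)])
    then show ?thesis by (elim imageE) (rule bexI, rule sym)
  qed
  then obtain w where w: "\<And>k. k \<in> dual R M \<Longrightarrow> w k \<in> carrier (P (Suc (Suc j)))"
    "\<And>k. k \<in> dual R M \<Longrightarrow> d (Suc j) (w k) = z k" by metis
  have Lc: "k \<in> dual R M" "e \<in> carrier M" if "(k, e) \<in> set L" for k e using that L(1) by auto
  show "\<exists>v. set v \<subseteq> carrier (P (Suc (Suc j))) \<times> carrier M \<and>
      (\<forall>f \<in> dual R (P (Suc j)). contract M (\<lambda>x. f (d (Suc j) x)) v = contract M f u)"
  \<comment> \<open>The preimages \<open>w k\<close>, paired with the dual basis vectors of
    \<open>M\<close>, reassemble to a filling of \<open>u\<close>.\<close>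
  proof (intro exI[of _ "map (\<lambda>(k, e). (w k, e)) L"] conjI ballI)
    show "set (map (\<lambda>(k, e). (w k, e)) L) \<subseteq> carrier (P (Suc (Suc j))) \<times> carrier M"
      using Lc w(1) by auto
    fix f assume f: "f \<in> dual R (P (Suc j))"
    have fc: "f x \<in> carrier R" if "(x, y) \<in> set u" for x y using mh_closed[OF f uc(1)[OF that]] by simp
    have "contract M (\<lambda>x. f (d (Suc j) x)) (map (\<lambda>(k, e). (w k, e)) L) =
       msum M (\<lambda>ke. msum M (\<lambda>xy. (f (fst xy) \<otimes>\<^bsub>R\<^esub> fst ke (snd xy)) \<odot>\<^bsub>M\<^esub> snd ke) u) L"
      unfolding contract_def msum_map
    proof (rule msum_cong, clarsimp)
      fix k e assume ke: "(k, e) \<in> set L"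
      note k = Lc(1)[OF ke] and e = Lc(2)[OF ke]
      have "k (contract M f u) = msum (regular_module R) (\<lambda>xy. k ((\<lambda>(x, y). f x \<odot>\<^bsub>M\<^esub> y) xy)) u"
        unfolding contract_def by (rule msum_hom[OF k mM mR]) (use uc fc in auto)
      also have "\<dots> = msum (regular_module R) (\<lambda>xy. f (fst xy) \<otimes>\<^bsub>R\<^esub> k (snd xy)) u"
        by (rule msum_cong) (use uc fc in \<open>auto simp: mh_smult[OF k]\<close>)
      finally have "f (d (Suc j) (w k)) = msum (regular_module R) (\<lambda>xy. f (fst xy) \<otimes>\<^bsub>R\<^esub> k (snd xy)) u"
        using w(2)[OF k] fz[OF k f] by simp
      then show "f (d (Suc j) (w k)) \<odot>\<^bsub>M\<^esub> e =
          msum M (\<lambda>xy. (f (fst xy) \<otimes>\<^bsub>R\<^esub> k (snd xy)) \<odot>\<^bsub>M\<^esub> e) u"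
        by (simp, intro msum_smult_left[OF mM e]) (use fc kc[OF k] in auto)
    qed
    also have "\<dots> = msum M (\<lambda>xy. msum M (\<lambda>ke. (f (fst xy) \<otimes>\<^bsub>R\<^esub> fst ke (snd xy)) \<odot>\<^bsub>M\<^esub> snd ke) L) u"
      by (rule msum_swap[OF mM]) (use fc kc Lc in auto)
    also have "\<dots> = contract M f u"
      unfolding contract_def
    proof (rule msum_cong, clarsimp)
      fix x y assume xy: "(x, y) \<in> set u"
      have "f x \<odot>\<^bsub>M\<^esub> y = f x \<odot>\<^bsub>M\<^esub> msum M (\<lambda>(k, e). k y \<odot>\<^bsub>M\<^esub> e) L"
        using L(2)[of y] xy by force
      also have "\<dots> = msum M (\<lambda>ke. f x \<odot>\<^bsub>M\<^esub> (\<lambda>(k, e). k y \<odot>\<^bsub>M\<^esub> e) ke) L"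
        by (rule msum_smult[OF mM fc[OF xy]]) (use kc[OF _ xy] Lc in auto)
      also have "\<dots> = msum M (\<lambda>ke. (f x \<otimes>\<^bsub>R\<^esub> fst ke y) \<odot>\<^bsub>M\<^esub> snd ke) L"
        by (rule msum_cong) (use kc[OF _ xy] fc[OF xy] Lc in \<open>auto simp: M.smult_assoc1\<close>)
      finally show "msum M (\<lambda>ke. (f x \<otimes>\<^bsub>R\<^esub> fst ke y) \<odot>\<^bsub>M\<^esub> snd ke) L = f x \<odot>\<^bsub>M\<^esub> y" by simp
    qed
    finally show "contract M (\<lambda>x. f (d (Suc j) x)) (map (\<lambda>(k, e). (w k, e)) L) = contract M f u" .
  qed
qed

section \<open>The groups Ext and Tor\<close>

lemma trivial_Mod_iff:
  assumes "comm_group G" "subgroup Z G" "subgroup B G" "B \<subseteq> Z"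
  shows "trivial_group (G\<lparr>carrier := Z\<rparr> Mod B) \<longleftrightarrow> Z \<subseteq> B"
proof -
  interpret G: comm_group G by fact
  let ?Z = "G\<lparr>carrier := Z\<rparr>"
  have Z: "comm_group ?Z"
    using comm_group.intro[OF comm_monoid.submonoid_is_comm_monoid] G.subgroup_imp_group[OF assms(2)]
      subgroup.subgroup_is_submonoid[OF assms(2)] G.comm_monoid_axioms by blast
  interpret Z: comm_group ?Z by (rule Z)
  have B: "subgroup B ?Z" using G.subgroup_incl[OF assms(3,2,4)] .
  then have grp: "group (?Z Mod B)" by (intro normal.factorgroup_is_group Z.subgroup_imp_normal)
  have "trivial_group (?Z Mod B) \<longleftrightarrow> (\<forall>z \<in> Z. B #>\<^bsub>?Z\<^esub> z = B)"
    using grp subgroup.one_closed[OF assms(2)]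
    by (auto simp: trivial_group_def carrier_FactGroup)
  also have "\<dots> \<longleftrightarrow> (\<forall>z \<in> Z. z \<in> B)"
    using Z.coset_join1[OF _ _ B] Z.coset_join2[OF _ B] by auto
  finally show ?thesis by auto
qed

section \<open>The cochain groups and Ext\<close>

lemma Hom_group_comm_group:
  assumes M: "module R M" and N: "module R N"
  shows "comm_group (Hom_group R M N)"
proof -
  interpret M: module R M by fact
  interpret N: module R N by fact
  let ?H = "Hom_group R M N"
  have car: "f \<in> carrier ?H \<longleftrightarrow> f \<in> module_hom R M N \<and> f \<in> extensional (carrier M)" for f
    by (simp add: Hom_group_def)
  have res: "restrict h (carrier M) \<in> carrier ?H" if "h \<in> module_hom R M N" for h
    unfolding car using mh_cong[OF that M, of "restrict h (carrier M)"] by simp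
  have mult: "f \<otimes>\<^bsub>?H\<^esub> g = (\<lambda>x\<in>carrier M. f x \<oplus>\<^bsub>N\<^esub> g x)" for f g by (simp add: Hom_group_def)
  have one: "\<one>\<^bsub>?H\<^esub> = (\<lambda>x\<in>carrier M. \<zero>\<^bsub>N\<^esub>)" by (simp add: Hom_group_def)
  have val: "f x \<in> carrier N" if "f \<in> carrier ?H" "x \<in> carrier M" for f x
    using that mh_closed[of f R M N x] by (simp add: car)
  show ?thesis
  proof (rule comm_groupI)
    fix f g assume f: "f \<in> carrier ?H" and g: "g \<in> carrier ?H"
    show "f \<otimes>\<^bsub>?H\<^esub> g \<in> carrier ?H"
      unfolding mult by (rule res[OF mh_add_fun[OF _ _ M N]]) (use f g car in auto)
    show "f \<otimes>\<^bsub>?H\<^esub> g = g \<otimes>\<^bsub>?H\<^esub> f"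
      unfolding mult by (rule restrict_ext) (use val[OF f] val[OF g] N.M.a_comm in auto)
    fix h assume h: "h \<in> carrier ?H"
    show "f \<otimes>\<^bsub>?H\<^esub> g \<otimes>\<^bsub>?H\<^esub> h = f \<otimes>\<^bsub>?H\<^esub> (g \<otimes>\<^bsub>?H\<^esub> h)"
      unfolding mult by (rule restrict_ext) (use val[OF f] val[OF g] val[OF h] N.M.a_assoc in auto)
  next
    show "\<one>\<^bsub>?H\<^esub> \<in> carrier ?H" unfolding one by (rule res[OF mh_zero_fun[OF M N]])
  next
    fix f assume f: "f \<in> carrier ?H"
    show "\<one>\<^bsub>?H\<^esub> \<otimes>\<^bsub>?H\<^esub> f = f"
      unfolding mult one
      by (rule extensionalityI[of _ "carrier M"]) (use val[OF f] f car in auto)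
    have fm: "f \<in> module_hom R M N" using f car by simp
    have "(\<lambda>x\<in>carrier M. \<ominus>\<^bsub>N\<^esub> f x) \<otimes>\<^bsub>?H\<^esub> f = \<one>\<^bsub>?H\<^esub>"
      unfolding mult one by (rule restrict_ext) (use val[OF f] N.M.l_neg in auto)
    then show "\<exists>g\<in>carrier ?H. g \<otimes>\<^bsub>?H\<^esub> f = \<one>\<^bsub>?H\<^esub>"
      using res[OF mh_neg_fun[OF fm M N]] by blast
  qed
qed

lemma Hom_group_precomp_hom:
  assumes L: "module R L" and M: "module R M" and N: "module R N" and d: "d \<in> module_hom R L M"
  shows "group_hom (Hom_group R M N) (Hom_group R L N) (\<lambda>f. \<lambda>x\<in>carrier L. f (d x))"
proof -
  interpret A: comm_group "Hom_group R M N" by (rule Hom_group_comm_group[OF M N])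
  interpret B: comm_group "Hom_group R L N" by (rule Hom_group_comm_group[OF L N])
  have "(\<lambda>f. \<lambda>x\<in>carrier L. f (d x)) \<in> hom (Hom_group R M N) (Hom_group R L N)"
  proof (rule homI)
    fix f assume "f \<in> carrier (Hom_group R M N)"
    then have f: "f \<in> module_hom R M N" by (simp add: Hom_group_def)
    show "(\<lambda>x\<in>carrier L. f (d x)) \<in> carrier (Hom_group R L N)"
      using mh_cong[OF mh_comp[OF f d] L, of "\<lambda>x\<in>carrier L. f (d x)"] by (simp add: Hom_group_def)
  next
    fix f g
    show "(\<lambda>x\<in>carrier L. (f \<otimes>\<^bsub>Hom_group R M N\<^esub> g) (d x)) =
      (\<lambda>x\<in>carrier L. f (d x)) \<otimes>\<^bsub>Hom_group R L N\<^esub> (\<lambda>x\<in>carrier L. g (d x))"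
      by (auto simp: Hom_group_def mh_closed[OF d] fun_eq_iff)
  qed
  then show ?thesis by unfold_locales
qed

text \<open>The choice in \<open>proj_resolution\<close> has the intended properties as soon as some
  projective resolution exists in the same universe; for members of \<open>FPR\<close> a finite one
  does.\<close>

lemma proj_resolution:
  fixes M :: "('a, 'm) module" and P :: "nat \<Rightarrow> ('a, 'm) module"
  assumes "resolution R P d e M" "\<And>i. projective R (P i)"
  obtains Q d' e' where "proj_resolution R M = (Q, d')" "resolution R Q d' e' M" "\<And>i. projective R (Q i)"
proof -
  let ?p = "\<lambda>(P :: nat \<Rightarrow> ('a, 'm) module, d). (\<exists>e. resolution R P d e M) \<and> (\<forall>i. projective R (P i))"
  have "?p (proj_resolution R M)"
    unfolding proj_resolution_def by (rule someI[of ?p "(P, d)"]) (use assms in auto)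
  then show thesis using that by (cases "proj_resolution R M") auto
qed

text \<open>Triviality is computed for the chosen resolution \<open>Q\<close>, about which nothing
  else is known, and then transferred to \<open>P\<close> by
  \<open>ext_vanish_change\<close>.\<close>

lemma trivial_Ext_iff:
  fixes M :: "('a, 'm) module" and P :: "nat \<Rightarrow> ('a, 'm) module" and N :: "('a, 'b) module"
  assumes P: "resolution R P d e M" "\<And>i. projective R (P i)" and N: "module R N"
  shows "trivial_group (Ext R (Suc j) M N) \<longleftrightarrow> ext_vanish R P d N j"
proof -
  obtain Q d' e' where Q: "proj_resolution R M = (Q, d')" "resolution R Q d' e' M"
    "\<And>i. projective R (Q i)" using proj_resolution[OF P] by blast
  note QD = resolutionD[OF Q(2)]
  interpret N: module R N by (rule N)
  define C where "C i = Hom_group R (Q i) N" for i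
  define \<delta> where "\<delta> i f = (\<lambda>x \<in> carrier (Q (Suc i)). f (d' i x))" for i and f :: "'m \<Rightarrow> 'b"
  let ?Z = "kernel (C (Suc j)) (C (Suc (Suc j))) (\<delta> (Suc j))"
  let ?B = "\<delta> j ` carrier (C j)"
  have E: "Ext R (Suc j) M N = (C (Suc j))\<lparr>carrier := ?Z\<rparr> Mod ?B"
    by (simp add: Ext_def Q(1) C_def[abs_def] \<delta>_def[abs_def])
  have hom: "group_hom (C i) (C (Suc i)) (\<delta> i)" for i
    unfolding C_def \<delta>_def by (rule Hom_group_precomp_hom[OF QD(2) QD(2) N QD(3)])
  have car: "f \<in> carrier (C i) \<longleftrightarrow> f \<in> module_hom R (Q i) N \<and> f \<in> extensional (carrier (Q i))" for f i
    by (simp add: C_def Hom_group_def)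
  have kerC: "f \<in> ?Z \<longleftrightarrow> f \<in> carrier (C (Suc j)) \<and>
      (\<forall>x \<in> carrier (Q (Suc (Suc j))). f (d' (Suc j) x) = \<zero>\<^bsub>N\<^esub>)" for f
    by (auto simp: kernel_def \<delta>_def C_def Hom_group_def restrict_def fun_eq_iff)
  have BZ: "?B \<subseteq> ?Z"
  proof
    fix f assume "f \<in> ?B"
    then obtain g where g: "g \<in> carrier (C j)" "f = \<delta> j g" by blast
    have gm: "g \<in> module_hom R (Q j) N" using g(1) car by simp
    have "\<delta> j g \<in> carrier (C (Suc j))" using group_hom.hom_closed[OF hom g(1)] .
    moreover have "\<delta> j g (d' (Suc j) x) = \<zero>\<^bsub>N\<^esub>" if "x \<in> carrier (Q (Suc (Suc j)))" for x
      using mh_closed[OF QD(3) that] resolution_dd(2)[OF Q(2) that] mh_zero[OF gm QD(2) N]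
      by (simp add: \<delta>_def)
    ultimately show "f \<in> ?Z" unfolding kerC g(2) by blast
  qed
  have "trivial_group (Ext R (Suc j) M N) \<longleftrightarrow> ?Z \<subseteq> ?B"
    unfolding E
  proof (rule trivial_Mod_iff)
    show "comm_group (C (Suc j))" unfolding C_def by (rule Hom_group_comm_group[OF QD(2) N])
    show "subgroup ?Z (C (Suc j))" by (rule group_hom.subgroup_kernel[OF hom])
    show "subgroup ?B (C (Suc j))" by (rule group_hom.img_is_subgroup[OF hom])
  qed (rule BZ)
  also have "\<dots> \<longleftrightarrow> ext_vanish R Q d' N j"
  proof
    assume ZB: "?Z \<subseteq> ?B"
    show "ext_vanish R Q d' N j"
      unfolding ext_vanish_def
    proof (intro ballI impI)
      fix f assume f: "f \<in> module_hom R (Q (Suc j)) N"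
        and cocycle: "\<forall>x\<in>carrier (Q (Suc (Suc j))). f (d' (Suc j) x) = \<zero>\<^bsub>N\<^esub>"
      \<comment> \<open>Members of \<open>Hom_group\<close> are extensional, the maps quantified in
        \<open>ext_vanish\<close> are not; restriction mediates.\<close>
      let ?f = "restrict f (carrier (Q (Suc j)))"
      have "?f \<in> ?Z"
        unfolding kerC car using mh_cong[OF f QD(2), of ?f] cocycle mh_closed[OF QD(3)] by simp
      then obtain g where g: "g \<in> carrier (C j)" "?f = \<delta> j g" using ZB by blast
      have "f x = g (d' j x)" if "x \<in> carrier (Q (Suc j))" for x
        using fun_cong[OF g(2), of x] that by (simp add: \<delta>_def)
      then show "\<exists>g\<in>module_hom R (Q j) N. \<forall>x\<in>carrier (Q (Suc j)). f x = g (d' j x)"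
        using g(1) car by blast
    qed
  next
    assume van: "ext_vanish R Q d' N j"
    show "?Z \<subseteq> ?B"
    proof
      fix f assume f: "f \<in> ?Z"
      then obtain g where g: "g \<in> module_hom R (Q j) N" "\<And>x. x \<in> carrier (Q (Suc j)) \<Longrightarrow> f x = g (d' j x)"
        using bspec[OF van[unfolded ext_vanish_def], of f] unfolding kerC car by auto
      let ?g = "restrict g (carrier (Q j))"
      have "?g \<in> carrier (C j)" unfolding car using mh_cong[OF g(1) QD(2), of ?g] by simp
      moreover have "f = \<delta> j ?g"
        using f mh_closed[OF QD(3)[of j]] unfolding kerC car
        by (intro extensionalityI[of _ "carrier (Q (Suc j))"]) (auto simp: \<delta>_def g(2))
      ultimately show "f \<in> ?B" by blast
    qed
  qed
  also have "\<dots> \<longleftrightarrow> ext_vanish R P d N j"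
    using ext_vanish_change[OF P Q(2,3) N] ext_vanish_change[OF Q(2,3) P N] by blast
  finally show ?thesis .
qed

section \<open>The tensor product group as classes of lists\<close>

definition tensor_gens ::
  "('a, 'r) ring_scheme \<Rightarrow> ('a, 'b) module \<Rightarrow> ('a, 'c) module \<Rightarrow> ('b \<times> 'c \<Rightarrow>\<^sub>0 int) set" where
  "tensor_gens R N M =
    {frag_of (x \<oplus>\<^bsub>N\<^esub> x', y) - frag_of (x, y) - frag_of (x', y) | x x' y.
        x \<in> carrier N \<and> x' \<in> carrier N \<and> y \<in> carrier M} \<union>
     {frag_of (x, y \<oplus>\<^bsub>M\<^esub> y') - frag_of (x, y) - frag_of (x, y') | x y y'.
        x \<in> carrier N \<and> y \<in> carrier M \<and> y' \<in> carrier M} \<union>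
     {frag_of (r \<odot>\<^bsub>N\<^esub> x, y) - frag_of (x, r \<odot>\<^bsub>M\<^esub> y) | r x y.
        r \<in> carrier R \<and> x \<in> carrier N \<and> y \<in> carrier M}"

text \<open>The passage from lists to formal sums; only nonnegative coefficients arise this
  way.\<close>

definition frag_list :: "'z list \<Rightarrow> 'z \<Rightarrow>\<^sub>0 int" where
  "frag_list u = sum_list (map frag_of u)"

lemma frag_list_simps [simp]: "frag_list [] = 0" "frag_list (z # u) = frag_of z + frag_list u"
  "frag_list (u @ v) = frag_list u + frag_list v"
  by (simp_all add: frag_list_def)

lemma frag_extend_frag_list: "frag_extend (\<lambda>z. frag_of (f z)) (frag_list u) = frag_list (map f u)"
  by (induction u) (auto simp: frag_extend_add)

lemma tensor_free_simps:
  "monoid.mult (tensor_free N M) = (+)" "\<one>\<^bsub>tensor_free N M\<^esub> = 0"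
  "c \<in> carrier (tensor_free N M) \<longleftrightarrow> Poly_Mapping.keys c \<subseteq> carrier N \<times> carrier M"
  by (auto simp: tensor_free_def fun_eq_iff)

lemma tensor_free_comm_group: "comm_group (tensor_free N M)"
  unfolding tensor_free_def by (rule abelian_free_Abelian_group)

lemma tensor_free_inv: "c \<in> carrier (tensor_free N M) \<Longrightarrow> inv\<^bsub>tensor_free N M\<^esub> c = - c"
  unfolding tensor_free_def by simp

lemma tensor_free_closed:
  "frag_of (x, y) \<in> carrier (tensor_free N M) \<longleftrightarrow> x \<in> carrier N \<and> y \<in> carrier M"
  "a \<in> carrier (tensor_free N M) \<Longrightarrow> b \<in> carrier (tensor_free N M) \<Longrightarrow> a + b \<in> carrier (tensor_free N M)"
  "a \<in> carrier (tensor_free N M) \<Longrightarrow> b \<in> carrier (tensor_free N M) \<Longrightarrow> a - b \<in> carrier (tensor_free N M)"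
  using keys_add[of a b] keys_diff[of a b] by (auto simp: tensor_free_simps)

lemma frag_list_closed: "set u \<subseteq> carrier N \<times> carrier M \<Longrightarrow> frag_list u \<in> carrier (tensor_free N M)"
proof (induction u)
  case Nil then show ?case by (simp add: tensor_free_simps)
next
  case (Cons a u) then show ?case by (cases a) (auto intro!: tensor_free_closed simp: tensor_free_closed(1))
qed

lemma tensor_rel_gens: "tensor_rel R N M = generate (tensor_free N M) (tensor_gens R N M)"
  by (simp add: tensor_rel_def tensor_gens_def)

lemma tensor_gens_closed:
  assumes "module R N" "module R M"
  shows "tensor_gens R N M \<subseteq> carrier (tensor_free N M)"
proof -
  interpret N: module R N by fact
  interpret M: module R M by fact
  show ?thesis
    unfolding tensor_gens_def by (auto intro!: tensor_free_closed simp: tensor_free_closed(1))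
qed

lemma tensor_rel_subgroup:
  assumes "module R N" "module R M"
  shows "subgroup (tensor_rel R N M) (tensor_free N M)"
  unfolding tensor_rel_gens
  by (rule group.generate_is_subgroup[OF _ tensor_gens_closed[OF assms]])
    (rule comm_group.axioms(2)[OF tensor_free_comm_group])

lemma tensor_rel_0: "0 \<in> tensor_rel R N M"
  using generate.one[of "tensor_free N M"] by (simp add: tensor_rel_gens tensor_free_simps)

lemma tensor_rel_add: "a \<in> tensor_rel R N M \<Longrightarrow> b \<in> tensor_rel R N M \<Longrightarrow> a + b \<in> tensor_rel R N M"
  using generate.eng[of a "tensor_free N M"] by (simp add: tensor_rel_gens tensor_free_simps)

lemma tensor_rel_minus:
  assumes "module R N" "module R M" "a \<in> tensor_rel R N M"
  shows "- a \<in> tensor_rel R N M"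
  using subgroup.m_inv_closed[OF tensor_rel_subgroup[OF assms(1,2)] assms(3)]
    tensor_free_inv[OF subgroup.mem_carrier[OF tensor_rel_subgroup[OF assms(1,2)] assms(3)]] by simp

lemma tensor_rel_diff:
  assumes "module R N" "module R M" "a \<in> tensor_rel R N M" "b \<in> tensor_rel R N M"
  shows "a - b \<in> tensor_rel R N M"
  using tensor_rel_add[OF assms(3) tensor_rel_minus[OF assms(1,2,4)]] by simp

lemma tensor_rel_bilinear:
  shows "x \<in> carrier N \<Longrightarrow> x' \<in> carrier N \<Longrightarrow> y \<in> carrier M \<Longrightarrow>
     frag_of (x \<oplus>\<^bsub>N\<^esub> x', y) - frag_of (x, y) - frag_of (x', y) \<in> tensor_rel R N M"
    and "x \<in> carrier N \<Longrightarrow> y \<in> carrier M \<Longrightarrow> y' \<in> carrier M \<Longrightarrow>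
     frag_of (x, y \<oplus>\<^bsub>M\<^esub> y') - frag_of (x, y) - frag_of (x, y') \<in> tensor_rel R N M"
    and "r \<in> carrier R \<Longrightarrow> x \<in> carrier N \<Longrightarrow> y \<in> carrier M \<Longrightarrow>
     frag_of (r \<odot>\<^bsub>N\<^esub> x, y) - frag_of (x, r \<odot>\<^bsub>M\<^esub> y) \<in> tensor_rel R N M"
  unfolding tensor_rel_gens tensor_gens_def by (rule generate.incl, blast)+

lemma tensor_rel_zero_left:
  assumes "module R N" "module R M" "y \<in> carrier M"
  shows "frag_of (\<zero>\<^bsub>N\<^esub>, y) \<in> tensor_rel R N M"
proof -
  interpret N: module R N by fact
  have "frag_of (\<zero>\<^bsub>N\<^esub> \<oplus>\<^bsub>N\<^esub> \<zero>\<^bsub>N\<^esub>, y) - frag_of (\<zero>\<^bsub>N\<^esub>, y) - frag_of (\<zero>\<^bsub>N\<^esub>, y) \<in> tensor_rel R N M"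
    by (rule tensor_rel_bilinear) (use assms in auto)
  from tensor_rel_minus[OF assms(1,2) this] show ?thesis by simp
qed

lemma tensor_rel_zero_right:
  assumes "module R N" "module R M" "x \<in> carrier N"
  shows "frag_of (x, \<zero>\<^bsub>M\<^esub>) \<in> tensor_rel R N M"
proof -
  interpret M: module R M by fact
  have "frag_of (x, \<zero>\<^bsub>M\<^esub> \<oplus>\<^bsub>M\<^esub> \<zero>\<^bsub>M\<^esub>) - frag_of (x, \<zero>\<^bsub>M\<^esub>) - frag_of (x, \<zero>\<^bsub>M\<^esub>) \<in> tensor_rel R N M"
    by (rule tensor_rel_bilinear) (use assms in auto)
  from tensor_rel_minus[OF assms(1,2) this] show ?thesis by simp
qed

lemma tensor_rel_msum_left:
  assumes "module R N" "module R M" "y \<in> carrier M" "\<And>i. i \<in> set xs \<Longrightarrow> h i \<in> carrier N"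
  shows "frag_of (msum N h xs, y) - (\<Sum>i\<leftarrow>xs. frag_of (h i, y)) \<in> tensor_rel R N M"
  using assms(4)
proof (induction xs)
  case Nil then show ?case using tensor_rel_zero_left[OF assms(1-3)] by simp
next
  case (Cons a xs)
  have "msum N h xs \<in> carrier N" by (rule msum_closed[OF assms(1)]) (use Cons.prems in auto)
  then have "frag_of (h a \<oplus>\<^bsub>N\<^esub> msum N h xs, y) - frag_of (h a, y) - frag_of (msum N h xs, y) \<in> tensor_rel R N M"
    by (intro tensor_rel_bilinear) (use Cons.prems assms(3) in auto)
  from tensor_rel_add[OF this Cons.IH] Cons.prems show ?case by (simp add: algebra_simps)
qed

lemma tensor_rel_msum_right:
  assumes "module R N" "module R M" "x \<in> carrier N" "\<And>i. i \<in> set xs \<Longrightarrow> h i \<in> carrier M"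
  shows "frag_of (x, msum M h xs) - (\<Sum>i\<leftarrow>xs. frag_of (x, h i)) \<in> tensor_rel R N M"
  using assms(4)
proof (induction xs)
  case Nil then show ?case using tensor_rel_zero_right[OF assms(1-3)] by simp
next
  case (Cons a xs)
  have "msum M h xs \<in> carrier M" by (rule msum_closed[OF assms(2)]) (use Cons.prems in auto)
  then have "frag_of (x, h a \<oplus>\<^bsub>M\<^esub> msum M h xs) - frag_of (x, h a) - frag_of (x, msum M h xs) \<in> tensor_rel R N M"
    by (intro tensor_rel_bilinear) (use Cons.prems assms(3) in auto)
  from tensor_rel_add[OF this Cons.IH] Cons.prems show ?case by (simp add: algebra_simps)
qed

lemma tensor_rel_sum_list:
  assumes "\<And>i. i \<in> set xs \<Longrightarrow> a i - b i \<in> tensor_rel R N M"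
  shows "(\<Sum>i\<leftarrow>xs. a i) - (\<Sum>i\<leftarrow>xs. b i) \<in> tensor_rel R N M"
  using assms
proof (induction xs)
  case (Cons x xs)
  then have "(a x - b x) + ((\<Sum>i\<leftarrow>xs. a i) - (\<Sum>i\<leftarrow>xs. b i)) \<in> tensor_rel R N M"
    by (intro tensor_rel_add) auto
  then show ?case by (simp add: algebra_simps)
qed (simp add: tensor_rel_0)

lemma sum_list_swap:
  fixes a :: "'x \<Rightarrow> 'y \<Rightarrow> 'z :: comm_monoid_add"
  shows "(\<Sum>i\<leftarrow>xs. \<Sum>j\<leftarrow>ys. a i j) = (\<Sum>j\<leftarrow>ys. \<Sum>i\<leftarrow>xs. a i j)"
  by (induction xs) (auto simp: sum_list_addf)

text \<open>Modulo the relations, expand the first entries in a dual basis, move the coefficients to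
  the right and collect terms: \<open>u\<close> becomes the sum of \<open>e\<close> tensor
  \<open>contract M f u\<close>, and each summand is zero.\<close>

lemma frag_list_rel_if_contract:
  assumes N: "ldb R N" and M: "module R M" and u: "set u \<subseteq> carrier N \<times> carrier M"
    and con: "\<And>f. f \<in> dual R N \<Longrightarrow> contract M f u = \<zero>\<^bsub>M\<^esub>"
  shows "frag_list u \<in> tensor_rel R N M"
proof -
  let ?I = "tensor_rel R N M"
  note mN = ldb_module[OF N]
  interpret N: module R N by (rule mN)
  interpret M: module R M by (rule M)
  obtain L where L: "set L \<subseteq> dual R N \<times> carrier N"
    "\<And>x. x \<in> fst ` set u \<Longrightarrow> x = msum N (\<lambda>(f, e). f x \<odot>\<^bsub>N\<^esub> e) L"
    by (rule ldbE[OF N, of "fst ` set u"]) (use u in auto)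
  have uc: "x \<in> carrier N" "y \<in> carrier M" if "(x, y) \<in> set u" for x y using that u by auto
  have Lc: "f \<in> dual R N" "e \<in> carrier N" if "(f, e) \<in> set L" for f e using that L(1) by auto
  have fc: "f x \<in> carrier R" if "(f, e) \<in> set L" "(x, y) \<in> set u" for f e x y
    using mh_closed[OF Lc(1)[OF that(1)] uc(1)[OF that(2)]] by simp
  have 1: "frag_list u - (\<Sum>(x, y)\<leftarrow>u. \<Sum>(f, e)\<leftarrow>L. frag_of (f x \<odot>\<^bsub>N\<^esub> e, y)) \<in> ?I"
    unfolding frag_list_def
  proof (rule tensor_rel_sum_list, clarsimp)
    fix x y assume xy: "(x, y) \<in> set u"
    have "x = msum N (\<lambda>(f, e). f x \<odot>\<^bsub>N\<^esub> e) L" by (rule L(2)) (use xy in force)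
    then have x: "x = msum N (\<lambda>fe. fst fe x \<odot>\<^bsub>N\<^esub> snd fe) L" by (simp add: case_prod_unfold)
    have "frag_of (msum N (\<lambda>fe. fst fe x \<odot>\<^bsub>N\<^esub> snd fe) L, y)
       - (\<Sum>fe\<leftarrow>L. frag_of (fst fe x \<odot>\<^bsub>N\<^esub> snd fe, y)) \<in> ?I"
      by (rule tensor_rel_msum_left[OF mN M uc(2)[OF xy]]) (use fc[OF _ xy] Lc in auto)
    then show "frag_of (x, y) - (\<Sum>(f, e)\<leftarrow>L. frag_of (f x \<odot>\<^bsub>N\<^esub> e, y)) \<in> ?I"
      using x by (simp add: case_prod_unfold)
  qed
  have 2: "(\<Sum>(x, y)\<leftarrow>u. \<Sum>(f, e)\<leftarrow>L. frag_of (f x \<odot>\<^bsub>N\<^esub> e, y)) -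
     (\<Sum>(x, y)\<leftarrow>u. \<Sum>(f, e)\<leftarrow>L. frag_of (e, f x \<odot>\<^bsub>M\<^esub> y)) \<in> ?I"
    by (rule tensor_rel_sum_list, clarsimp, rule tensor_rel_sum_list, clarsimp)
      (use fc uc Lc in \<open>auto intro!: tensor_rel_bilinear\<close>)
  have 3: "(\<Sum>(x, y)\<leftarrow>u. \<Sum>(f, e)\<leftarrow>L. frag_of (e, f x \<odot>\<^bsub>M\<^esub> y)) =
     (\<Sum>(f, e)\<leftarrow>L. \<Sum>(x, y)\<leftarrow>u. frag_of (e, f x \<odot>\<^bsub>M\<^esub> y))"
    unfolding case_prod_unfold by (rule sum_list_swap)
  have 4: "(\<Sum>(f, e)\<leftarrow>L. frag_of (e, contract M f u)) -
      (\<Sum>(f, e)\<leftarrow>L. \<Sum>(x, y)\<leftarrow>u. frag_of (e, f x \<odot>\<^bsub>M\<^esub> y)) \<in> ?I"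
  proof (rule tensor_rel_sum_list, clarsimp)
    fix f e assume fe: "(f, e) \<in> set L"
    have "frag_of (e, msum M (\<lambda>xy. f (fst xy) \<odot>\<^bsub>M\<^esub> snd xy) u)
       - (\<Sum>xy\<leftarrow>u. frag_of (e, f (fst xy) \<odot>\<^bsub>M\<^esub> snd xy)) \<in> ?I"
      by (rule tensor_rel_msum_right[OF mN M Lc(2)[OF fe]]) (use fc[OF fe] uc in auto)
    then show "frag_of (e, contract M f u) - (\<Sum>(x, y)\<leftarrow>u. frag_of (e, f x \<odot>\<^bsub>M\<^esub> y)) \<in> ?I"
      by (simp add: case_prod_unfold contract_def)
  qed
  have 5: "(\<Sum>(f, e)\<leftarrow>L. frag_of (e, contract M f u)) - (\<Sum>z\<leftarrow>L. 0) \<in> ?I"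
    by (rule tensor_rel_sum_list) (use con Lc tensor_rel_zero_right[OF mN M] in auto)
  show ?thesis
    \<comment> \<open>Telescoping as 1 + 2 - 4 + 5, where 3 identifies the two orders of
      summation.\<close>
    using tensor_rel_add[OF tensor_rel_diff[OF mN M tensor_rel_add[OF 1 2] 4] 5] 3 by simp
qed

text \<open>Sending \<open>(x, y)\<close> to \<open>f x \<odot> y\<close> extends to the free
  abelian group and kills the three kinds of relations, so contraction is well defined on the tensor
  product.\<close>

lemma contract_if_frag_list_rel:
  assumes N: "module R N" and M: "module R M" and u: "set u \<subseteq> carrier N \<times> carrier M"
    and rel: "frag_list u \<in> tensor_rel R N M" and f: "f \<in> dual R N"
  shows "contract M f u = \<zero>\<^bsub>M\<^esub>"
proof -
  interpret N: module R N by (rule N)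
  interpret M: module R M by (rule M)
  let ?A = "add_monoid M"
  have fc: "f x \<in> carrier R" if "x \<in> carrier N" for x using mh_closed[OF f that] by simp
  obtain h where h: "h \<in> hom (tensor_free N M) ?A"
    "\<And>x y. x \<in> carrier N \<Longrightarrow> y \<in> carrier M \<Longrightarrow> h (frag_of (x, y)) = f x \<odot>\<^bsub>M\<^esub> y"
  proof (rule comm_group.free_Abelian_group_universal[OF M.M.a_comm_group, of "\<lambda>(x, y). f x \<odot>\<^bsub>M\<^esub> y" "carrier N \<times> carrier M"])
    show "(\<lambda>(x, y). f x \<odot>\<^bsub>M\<^esub> y) ` (carrier N \<times> carrier M) \<subseteq> carrier ?A" using fc by auto
  next
    fix h assume "h \<in> hom (free_Abelian_group (carrier N \<times> carrier M)) ?A"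
      "\<And>z. z \<in> carrier N \<times> carrier M \<Longrightarrow> h (frag_of z) = (case z of (x, y) \<Rightarrow> f x \<odot>\<^bsub>M\<^esub> y)"
    then show thesis by (intro that[of h]) (auto simp: tensor_free_def)
  qed
  interpret h: group_hom "tensor_free N M" ?A h
    using h(1) tensor_free_comm_group[of N M] M.M.a_comm_group
    by (auto simp: group_hom_def group_hom_axioms_def comm_group_def)
  have hadd: "h (a + b) = h a \<oplus>\<^bsub>M\<^esub> h b"
    if "a \<in> carrier (tensor_free N M)" "b \<in> carrier (tensor_free N M)" for a b
    using h.hom_mult[OF that] by (simp add: tensor_free_simps)
  have hdiff: "h (a - b) = h a \<ominus>\<^bsub>M\<^esub> h b"
    if "a \<in> carrier (tensor_free N M)" "b \<in> carrier (tensor_free N M)" for a b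
    using hadd[OF that(1) h.G.inv_closed[OF that(2)]] h.hom_inv[OF that(2)] that
    by (simp add: tensor_free_inv a_minus_def a_inv_def)
  have "tensor_gens R N M \<subseteq> kernel (tensor_free N M) ?A h"
  proof
    fix c assume c: "c \<in> tensor_gens R N M"
    then have "c \<in> carrier (tensor_free N M)" using tensor_gens_closed[OF N M] by auto
    moreover have "h c = \<zero>\<^bsub>M\<^esub>"
      using c unfolding tensor_gens_def
    proof (elim UnE CollectE exE conjE)
      fix x x' y assume [simp]: "c = frag_of (x \<oplus>\<^bsub>N\<^esub> x', y) - frag_of (x, y) - frag_of (x', y)"
        "x \<in> carrier N" "x' \<in> carrier N" "y \<in> carrier M"
      have "h c = (f x \<oplus>\<^bsub>R\<^esub> f x') \<odot>\<^bsub>M\<^esub> y \<ominus>\<^bsub>M\<^esub> f x \<odot>\<^bsub>M\<^esub> y \<ominus>\<^bsub>M\<^esub> f x' \<odot>\<^bsub>M\<^esub> y"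
        by (simp add: hdiff tensor_free_closed h(2) mh_add[OF f])
      then show "h c = \<zero>\<^bsub>M\<^esub>"
        using fc by (simp add: M.smult_l_distr a_minus_def M.M.a_ac M.M.r_neg M.M.r_neg1)
    next
      fix x y y' assume [simp]: "c = frag_of (x, y \<oplus>\<^bsub>M\<^esub> y') - frag_of (x, y) - frag_of (x, y')"
        "x \<in> carrier N" "y \<in> carrier M" "y' \<in> carrier M"
      have "h c = f x \<odot>\<^bsub>M\<^esub> (y \<oplus>\<^bsub>M\<^esub> y') \<ominus>\<^bsub>M\<^esub> f x \<odot>\<^bsub>M\<^esub> y \<ominus>\<^bsub>M\<^esub> f x \<odot>\<^bsub>M\<^esub> y'"
        by (simp add: hdiff tensor_free_closed h(2))
      then show "h c = \<zero>\<^bsub>M\<^esub>"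
        using fc by (simp add: M.smult_r_distr a_minus_def M.M.a_ac M.M.r_neg M.M.r_neg1)
    next
      fix r x y assume [simp]: "c = frag_of (r \<odot>\<^bsub>N\<^esub> x, y) - frag_of (x, r \<odot>\<^bsub>M\<^esub> y)"
        "r \<in> carrier R" "x \<in> carrier N" "y \<in> carrier M"
      have "h c = (r \<otimes>\<^bsub>R\<^esub> f x) \<odot>\<^bsub>M\<^esub> y \<ominus>\<^bsub>M\<^esub> f x \<odot>\<^bsub>M\<^esub> (r \<odot>\<^bsub>M\<^esub> y)"
        by (simp add: hdiff tensor_free_closed h(2) mh_smult[OF f])
      then show "h c = \<zero>\<^bsub>M\<^esub>"
        using fc by (simp add: M.smult_assoc1[symmetric] N.R.m_comm a_minus_def M.M.r_neg)
    qed
    ultimately show "c \<in> kernel (tensor_free N M) ?A h" by (simp add: kernel_def)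
  qed
  then have "tensor_rel R N M \<subseteq> kernel (tensor_free N M) ?A h"
    unfolding tensor_rel_gens by (rule h.G.generate_subgroup_incl[OF _ h.subgroup_kernel])
  then have "h (frag_list u) = \<zero>\<^bsub>M\<^esub>" using rel by (auto simp: kernel_def)
  moreover have "h (frag_list u) = contract M f u"
    using u
  proof (induction u)
    case Nil then show ?case using h.hom_one by (simp add: tensor_free_simps)
  next
    case (Cons z u)
    have "h (frag_of z + frag_list u) = h (frag_of z) \<oplus>\<^bsub>M\<^esub> h (frag_list u)"
      by (rule hadd) (use Cons.prems frag_list_closed in \<open>auto simp: tensor_free_closed\<close>)
    then show ?case using Cons by (auto simp: contract_def h(2))
  qed
  ultimately show ?thesis by simp
qed

definition tcls where "tcls R N M u = tensor_rel R N M #>\<^bsub>tensor_free N M\<^esub> frag_list u"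

lemma frag_list_negt:
  assumes "module R N" "module R M" "set u \<subseteq> carrier N \<times> carrier M"
  shows "frag_list u + frag_list (negt M u) \<in> tensor_rel R N M"
  using assms(3)
proof (induction u)
  case Nil then show ?case by (simp add: negt_def tensor_rel_0)
next
  case (Cons z u)
  interpret M: module R M by fact
  obtain x y where z: "z = (x, y)" by force
  have xy: "x \<in> carrier N" "y \<in> carrier M" using Cons.prems z by auto
  have "frag_of (x, y \<oplus>\<^bsub>M\<^esub> \<ominus>\<^bsub>M\<^esub> y) - frag_of (x, y) - frag_of (x, \<ominus>\<^bsub>M\<^esub> y) \<in> tensor_rel R N M"
    by (rule tensor_rel_bilinear) (use xy in auto)
  then have "frag_of (x, \<zero>\<^bsub>M\<^esub>) - (frag_of (x, y \<oplus>\<^bsub>M\<^esub> \<ominus>\<^bsub>M\<^esub> y) - frag_of (x, y) - frag_of (x, \<ominus>\<^bsub>M\<^esub> y)) \<in> tensor_rel R N M"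
    by (rule tensor_rel_diff[OF assms(1,2) tensor_rel_zero_right[OF assms(1,2) xy(1)]])
  then have "frag_of (x, y) + frag_of (x, \<ominus>\<^bsub>M\<^esub> y) \<in> tensor_rel R N M"
    unfolding M.M.r_neg[OF xy(2)] by (simp add: algebra_simps)
  from tensor_rel_add[OF this Cons.IH] Cons.prems show ?case by (simp add: z negt_def algebra_simps)
qed

text \<open>Negative coefficients of a formal sum are absorbed by \<open>negt\<close>, so lists
  represent all cosets.\<close>

lemma tensor_carrier:
  assumes "module R N" "module R M"
  shows "carrier (tensor R N M) = tcls R N M ` {u. set u \<subseteq> carrier N \<times> carrier M}"
proof -
  interpret F: comm_group "tensor_free N M" by (rule tensor_free_comm_group)
  note sub = tensor_rel_subgroup[OF assms]
  have ex: "\<exists>u. set u \<subseteq> carrier N \<times> carrier M \<and> c - frag_list u \<in> tensor_rel R N M"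
    if "c \<in> carrier (tensor_free N M)" for c
  proof -
    have "Poly_Mapping.keys c \<subseteq> carrier N \<times> carrier M" using that by (simp add: tensor_free_simps)
    then show ?thesis
    proof (induction c rule: frag_induction)
      case zero then show ?case using tensor_rel_0 by (intro exI[of _ "[]"]) auto
    next
      case (one z) then show ?case using tensor_rel_0 by (intro exI[of _ "[z]"]) auto
    next
      case (diff a b)
      obtain u v where uv: "set u \<subseteq> carrier N \<times> carrier M" "a - frag_list u \<in> tensor_rel R N M"
        "set v \<subseteq> carrier N \<times> carrier M" "b - frag_list v \<in> tensor_rel R N M" using diff by blast
      have "(a - frag_list u) - (b - frag_list v) - (frag_list v + frag_list (negt M v)) \<in> tensor_rel R N M"
        by (intro tensor_rel_diff[OF assms] uv frag_list_negt[OF assms])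
      then show ?case
        using uv set_negt[OF assms(2) uv(3)] by (intro exI[of _ "u @ negt M v"]) (auto simp: algebra_simps)
    qed
  qed
  have cos: "tensor_rel R N M #>\<^bsub>tensor_free N M\<^esub> c = tcls R N M u"
    if "c \<in> carrier (tensor_free N M)" "c - frag_list u \<in> tensor_rel R N M"
      "set u \<subseteq> carrier N \<times> carrier M" for c u
  proof -
    have "c \<in> tensor_rel R N M #>\<^bsub>tensor_free N M\<^esub> frag_list u"
      unfolding r_coset_def using that(2) by (force simp: tensor_free_simps)
    then show ?thesis
      unfolding tcls_def using F.repr_independence[OF _ frag_list_closed[OF that(3)] sub] by blast
  qed
  show ?thesis
    unfolding tensor_def carrier_FactGroup
  proof (intro equalityI subsetI)
    fix C assume "C \<in> (#>\<^bsub>tensor_free N M\<^esub>) (tensor_rel R N M) ` carrier (tensor_free N M)"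
    then obtain c where c: "c \<in> carrier (tensor_free N M)"
      "C = tensor_rel R N M #>\<^bsub>tensor_free N M\<^esub> c" by blast
    obtain u where u: "set u \<subseteq> carrier N \<times> carrier M" "c - frag_list u \<in> tensor_rel R N M"
      using ex[OF c(1)] by blast
    show "C \<in> tcls R N M ` {u. set u \<subseteq> carrier N \<times> carrier M}"
      unfolding c(2) cos[OF c(1) u(2,1)] using u(1) by blast
  next
    fix C assume "C \<in> tcls R N M ` {u. set u \<subseteq> carrier N \<times> carrier M}"
    then obtain u where u: "set u \<subseteq> carrier N \<times> carrier M" "C = tcls R N M u" by blast
    show "C \<in> (#>\<^bsub>tensor_free N M\<^esub>) (tensor_rel R N M) ` carrier (tensor_free N M)"
      unfolding u(2) tcls_def by (rule imageI[OF frag_list_closed[OF u(1)]])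
  qed
qed

text \<open>Both criteria for vanishing are applied to the difference \<open>u @ negt M v\<close>.
  This turns equations between cosets into equations between contractions.\<close>

lemma tcls_eq_iff:
  assumes N: "ldb R N" and M: "module R M"
    and u: "set u \<subseteq> carrier N \<times> carrier M" and v: "set v \<subseteq> carrier N \<times> carrier M"
  shows "tcls R N M u = tcls R N M v \<longleftrightarrow> teq R N M u v"
proof -
  note mN = ldb_module[OF N]
  interpret M: module R M by (rule M)
  interpret F: comm_group "tensor_free N M" by (rule tensor_free_comm_group)
  note sub = tensor_rel_subgroup[OF mN M]
  note cu = frag_list_closed[OF u] and cv = frag_list_closed[OF v]
  note nv = set_negt[OF M v]
  have unv: "set (u @ negt M v) \<subseteq> carrier N \<times> carrier M" using u nv by auto
  have "tcls R N M u = tcls R N M v \<longleftrightarrow> frag_list u \<in> tensor_rel R N M #>\<^bsub>tensor_free N M\<^esub> frag_list v"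
    unfolding tcls_def
    using F.repr_independence[OF _ cv sub] F.repr_independenceD[OF sub cu] by metis
  also have "\<dots> \<longleftrightarrow> frag_list u - frag_list v \<in> tensor_rel R N M"
    unfolding r_coset_def by (auto simp: tensor_free_simps intro!: bexI[of _ "frag_list u - frag_list v"])
  also have "\<dots> \<longleftrightarrow> frag_list (u @ negt M v) \<in> tensor_rel R N M"
    using tensor_rel_add[OF _ frag_list_negt[OF mN M v], of "frag_list u - frag_list v"]
      tensor_rel_diff[OF mN M _ frag_list_negt[OF mN M v], of "frag_list (u @ negt M v)"]
    by (auto simp: algebra_simps)
  also have "\<dots> \<longleftrightarrow> (\<forall>f \<in> dual R N. contract M f (u @ negt M v) = \<zero>\<^bsub>M\<^esub>)"
    using frag_list_rel_if_contract[OF N M unv] contract_if_frag_list_rel[OF mN M unv] by blast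
  also have "\<dots> \<longleftrightarrow> teq R N M u v"
    unfolding teq_def
  proof (rule ball_cong[OF refl])
    fix f assume f: "f \<in> dual R N"
    show "contract M f (u @ negt M v) = \<zero>\<^bsub>M\<^esub> \<longleftrightarrow> contract M f u = contract M f v"
      unfolding contract_append[OF M f u nv] contract_negt[OF M f v]
      using contract_closed[OF M f u] contract_closed[OF M f v]
      by (metis M.M.a_inv_closed M.M.minus_equality M.M.minus_minus M.M.r_neg)
  qed
  finally show ?thesis .
qed

text \<open>\<open>tensor_map\<close> unites the image cosets of all representatives. Relations are
  mapped to relations, so these cosets coincide.\<close>

lemma tensor_map_tcls:
  fixes N :: "('a, 'b) module" and N' :: "('a, 'c) module" and M :: "('a, 'd) module"
  assumes N: "module R N" and N': "module R N'" and M: "module R M" and f: "f \<in> module_hom R N N'"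
    and u: "set u \<subseteq> carrier N \<times> carrier M"
  shows "tensor_map R N' M f (tcls R N M u) = tcls R N' M (map (map_prod f id) u)"
proof -
  interpret F': comm_group "tensor_free N' M" by (rule tensor_free_comm_group)
  interpret M: module R M by (rule M)
  interpret N: module R N by (rule N)
  note sub = tensor_rel_subgroup[OF N' M]
  let ?e = "frag_extend (\<lambda>(x, y). frag_of (f x, y)) :: ('b \<times> 'd \<Rightarrow>\<^sub>0 int) \<Rightarrow> ('c \<times> 'd \<Rightarrow>\<^sub>0 int)"
  note u' = map_left_set[OF u f]
  have eu: "?e (frag_list u) = frag_list (map (map_prod f id) u)"
    using frag_extend_frag_list[of "map_prod f id" u]
    by (simp add: case_prod_unfold map_prod_def)
  have gen: "?e c \<in> tensor_rel R N' M" if "c \<in> tensor_gens R N M" for c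
    using that unfolding tensor_gens_def
    by (auto simp: frag_extend_diff mh_add[OF f] mh_smult[OF f] mh_closed[OF f]
        intro!: tensor_rel_bilinear)
  have rel: "?e c \<in> tensor_rel R N' M" if "c \<in> tensor_rel R N M" for c
    using that unfolding tensor_rel_gens[of R N M]
  proof (induction rule: generate.induct)
    case (inv c)
    then have "c \<in> carrier (tensor_free N M)" using tensor_gens_closed[OF N M] by auto
    then show ?case
      using tensor_rel_minus[OF N' M gen[OF inv]] by (simp add: tensor_free_inv frag_extend_minus)
  qed (auto simp: tensor_free_simps tensor_rel_0 gen frag_extend_add tensor_rel_add)
  have coset: "tensor_rel R N' M #>\<^bsub>tensor_free N' M\<^esub> ?e c = tcls R N' M (map (map_prod f id) u)"
    if c: "c \<in> tcls R N M u" for c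
  proof -
    obtain i where i: "i \<in> tensor_rel R N M" "c = i + frag_list u"
      using c by (auto simp: tcls_def r_coset_def tensor_free_simps)
    have "?e c \<in> tensor_rel R N' M #>\<^bsub>tensor_free N' M\<^esub> frag_list (map (map_prod f id) u)"
      using rel[OF i(1)] by (auto simp: i(2) frag_extend_add eu r_coset_def tensor_free_simps)
    then show ?thesis
      unfolding tcls_def using F'.repr_independence[OF _ frag_list_closed[OF u'] sub] by blast
  qed
  have "frag_list u \<in> tcls R N M u"
    using tensor_rel_0[of R N M] by (force simp: tcls_def r_coset_def tensor_free_simps)
  then show ?thesis
    unfolding tensor_map_def using coset by blast
qed

lemma tensor_comm_group:
  assumes "module R N" "module R M" shows "comm_group (tensor R N M)"
  unfolding tensor_def
  by (rule comm_group.abelian_FactGroup[OF tensor_free_comm_group tensor_rel_subgroup[OF assms]])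

lemma tcls_append:
  assumes "module R N" "module R M" "set u \<subseteq> carrier N \<times> carrier M" "set v \<subseteq> carrier N \<times> carrier M"
  shows "tcls R N M (u @ v) = tcls R N M u \<otimes>\<^bsub>tensor R N M\<^esub> tcls R N M v"
proof -
  interpret F: comm_group "tensor_free N M" by (rule tensor_free_comm_group)
  note sub = tensor_rel_subgroup[OF assms(1,2)]
  interpret I: normal "tensor_rel R N M" "tensor_free N M" by (rule F.subgroup_imp_normal[OF sub])
  show ?thesis
    using I.rcos_sum[OF frag_list_closed[OF assms(3)] frag_list_closed[OF assms(4)]]
    by (simp add: tcls_def tensor_def tensor_free_simps)
qed

lemma tensor_map_group_hom:
  assumes "module R N" "module R N'" "module R M" "f \<in> module_hom R N N'"
  shows "group_hom (tensor R N M) (tensor R N' M) (tensor_map R N' M f)"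
proof -
  interpret A: comm_group "tensor R N M" by (rule tensor_comm_group[OF assms(1,3)])
  interpret B: comm_group "tensor R N' M" by (rule tensor_comm_group[OF assms(2,3)])
  have "tensor_map R N' M f \<in> hom (tensor R N M) (tensor R N' M)"
  proof (rule homI)
    fix C assume "C \<in> carrier (tensor R N M)"
    then obtain u where u: "set u \<subseteq> carrier N \<times> carrier M" "C = tcls R N M u"
      by (auto simp: tensor_carrier[OF assms(1,3)])
    show "tensor_map R N' M f C \<in> carrier (tensor R N' M)"
      using map_left_set[OF u(1) assms(4)]
      by (simp add: u(2) tensor_map_tcls[OF assms u(1)] tensor_carrier[OF assms(2,3)])
    fix D assume "D \<in> carrier (tensor R N M)"
    then obtain v where v: "set v \<subseteq> carrier N \<times> carrier M" "D = tcls R N M v"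
      by (auto simp: tensor_carrier[OF assms(1,3)])
    have uv: "set (u @ v) \<subseteq> carrier N \<times> carrier M" using u v by auto
    show "tensor_map R N' M f (C \<otimes>\<^bsub>tensor R N M\<^esub> D) =
        tensor_map R N' M f C \<otimes>\<^bsub>tensor R N' M\<^esub> tensor_map R N' M f D"
      unfolding u(2) v(2) tcls_append[OF assms(1,3) u(1) v(1), symmetric]
        tensor_map_tcls[OF assms u(1)] tensor_map_tcls[OF assms v(1)] tensor_map_tcls[OF assms uv] map_append
      by (rule tcls_append[OF assms(2,3) map_left_set[OF u(1) assms(4)] map_left_set[OF v(1) assms(4)]])
  qed
  then show ?thesis by unfold_locales
qed

text \<open>Kernel and image are described by lists through \<open>tcls_eq_iff\<close>, which
  applies because projective modules have local dual bases; the result is then moved from the chosen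
  resolution to \<open>P\<close>.\<close>

lemma trivial_Tor_iff:
  fixes N :: "('a, 'm) module" and P :: "nat \<Rightarrow> ('a, 'm) module" and M :: "('a, 'b) module"
  assumes P: "resolution R P d e N" "\<And>i. projective R (P i)" and M: "module R M"
  shows "trivial_group (Tor R (Suc j) N M) \<longleftrightarrow> tor_vanish R P d M j"
proof -
  obtain Q d' e' where Q: "proj_resolution R N = (Q, d')" "resolution R Q d' e' N"
    "\<And>i. projective R (Q i)" using proj_resolution[OF P] by blast
  note QD = resolutionD[OF Q(2)] and ldbQ = projective_ldb[OF Q(3)]
  interpret M: module R M by (rule M)
  define T where "T i = tensor R (Q i) M" for i
  define D where "D i = tensor_map R (Q i) M (d' i)" for i
  let ?Z = "kernel (T (Suc j)) (T j) (D j)"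
  let ?B = "D (Suc j) ` carrier (T (Suc (Suc j)))"
  have E: "Tor R (Suc j) N M = (T (Suc j))\<lparr>carrier := ?Z\<rparr> Mod ?B"
    by (simp add: Tor_def Q(1) T_def[abs_def] D_def[abs_def])
  have hom: "group_hom (T (Suc i)) (T i) (D i)" for i
    unfolding T_def D_def by (rule tensor_map_group_hom[OF QD(2) QD(2) M QD(3)])
  have one: "\<one>\<^bsub>T i\<^esub> = tcls R (Q i) M []" for i
  proof -
    interpret F: comm_group "tensor_free (Q i) M" by (rule tensor_free_comm_group)
    show ?thesis
      using F.coset_join2[OF F.one_closed tensor_rel_subgroup[OF QD(2) M]] tensor_rel_0[of R "Q i" M]
      by (simp add: T_def tensor_def tcls_def tensor_free_simps)
  qed
  have D: "D i (tcls R (Q (Suc i)) M u) = tcls R (Q i) M (map (map_prod (d' i) id) u)"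
    if "set u \<subseteq> carrier (Q (Suc i)) \<times> carrier M" for i u
    unfolding D_def by (rule tensor_map_tcls[OF QD(2) QD(2) M QD(3) that])
  have car: "carrier (T i) = tcls R (Q i) M ` {u. set u \<subseteq> carrier (Q i) \<times> carrier M}" for i
    unfolding T_def by (rule tensor_carrier[OF QD(2) M])
  have Z: "?Z = tcls R (Q (Suc j)) M ` {u. set u \<subseteq> carrier (Q (Suc j)) \<times> carrier M \<and>
      teq R (Q j) M (map (map_prod (d' j) id) u) []}"
  proof -
    have "D j (tcls R (Q (Suc j)) M u) = \<one>\<^bsub>T j\<^esub> \<longleftrightarrow> teq R (Q j) M (map (map_prod (d' j) id) u) []"
      if "set u \<subseteq> carrier (Q (Suc j)) \<times> carrier M" for u
      unfolding D[OF that] one by (rule tcls_eq_iff[OF ldbQ M map_left_set[OF that QD(3)]]) simp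
    then show ?thesis unfolding kernel_def car by auto
  qed
  have B: "?B = (\<lambda>v. tcls R (Q (Suc j)) M (map (map_prod (d' (Suc j)) id) v)) `
      {v. set v \<subseteq> carrier (Q (Suc (Suc j))) \<times> carrier M}"
    unfolding car image_image by (rule image_cong[OF refl]) (use D in simp)
  have BZ: "?B \<subseteq> ?Z"
    unfolding B Z
  proof (rule image_subsetI, rule imageI, clarify, rule conjI)
    fix v assume v: "set v \<subseteq> carrier (Q (Suc (Suc j))) \<times> carrier M"
    show "set (map (map_prod (d' (Suc j)) id) v) \<subseteq> carrier (Q (Suc j)) \<times> carrier M"
      by (rule map_left_set[OF v QD(3)])
    show "teq R (Q j) M (map (map_prod (d' j) id) (map (map_prod (d' (Suc j)) id) v)) []"
      unfolding teq_def contract_map_left contract_Nil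
    proof
      fix f assume f: "f \<in> dual R (Q j)"
      have "f \<zero>\<^bsub>Q j\<^esub> = \<zero>\<^bsub>R\<^esub>" using mh_zero[OF f QD(2) module_regular[OF M.is_cring]] by simp
      then show "contract M (\<lambda>x. f (d' j (d' (Suc j) x))) v = \<zero>\<^bsub>M\<^esub>"
        unfolding contract_def
        by (intro msum_zero[OF M]) (use v resolution_dd(2)[OF Q(2)] in auto)
    qed
  qed
  have "trivial_group (Tor R (Suc j) N M) \<longleftrightarrow> ?Z \<subseteq> ?B"
    unfolding E
  proof (rule trivial_Mod_iff)
    show "comm_group (T (Suc j))" unfolding T_def by (rule tensor_comm_group[OF QD(2) M])
    show "subgroup ?Z (T (Suc j))" by (rule group_hom.subgroup_kernel[OF hom])
    show "subgroup ?B (T (Suc j))" by (rule group_hom.img_is_subgroup[OF hom])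
  qed (rule BZ)
  also have "\<dots> \<longleftrightarrow> tor_vanish R Q d' M j"
  proof -
    have "tcls R (Q (Suc j)) M u \<in> ?B \<longleftrightarrow> (\<exists>v. set v \<subseteq> carrier (Q (Suc (Suc j))) \<times> carrier M \<and>
        teq R (Q (Suc j)) M (map (map_prod (d' (Suc j)) id) v) u)"
      if u: "set u \<subseteq> carrier (Q (Suc j)) \<times> carrier M" for u
      unfolding B image_iff using tcls_eq_iff[OF ldbQ M map_left_set[OF _ QD(3)] u]
      by (metis (no_types, lifting) mem_Collect_eq)
    then show ?thesis unfolding Z tor_vanish_def image_subset_iff by auto
  qed
  also have "\<dots> \<longleftrightarrow> tor_vanish R P d M j"
    using tor_vanish_change[OF P Q(2,3) M] tor_vanish_change[OF Q(2,3) P M] by blast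
  finally show ?thesis .
qed

section \<open>Splitting modulo maximal ideals\<close>

text \<open>Zorn's lemma on the ideals that avoid \<open>\<one>\<close>, a condition preserved by
  unions of chains.\<close>

lemma (in cring) exists_maximalideal:
  assumes "ideal I R" "\<one> \<notin> I"
  shows "\<exists>m. maximalideal m R \<and> I \<subseteq> m"
proof -
  let ?A = "{J. ideal J R \<and> I \<subseteq> J \<and> \<one> \<notin> J}"
  have "\<exists>m\<in>?A. \<forall>J\<in>?A. m \<subseteq> J \<longrightarrow> J = m"
  proof (rule subset_Zorn_nonempty)
    show "?A \<noteq> {}" using assms by blast
  next
    fix C assume C: "C \<noteq> {}" "subset.chain ?A C"
    have CA: "C \<subseteq> ?A" using C(2) by (simp add: pred_on.chain_def)
    then have "subset.chain {J. ideal J R} C" using C(2) unfolding pred_on.chain_def by blast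
    then have "ideal (\<Union>C) R" using chain_Union_is_ideal[of C] C(1) by simp
    moreover have "I \<subseteq> \<Union>C" using CA C(1) by auto
    moreover have "\<one> \<notin> \<Union>C" using CA by auto
    ultimately show "\<Union>C \<in> ?A" by simp
  qed
  then obtain m where m: "m \<in> ?A" "\<forall>J \<in> ?A. m \<subseteq> J \<longrightarrow> J = m" by (rule bexE)
  have "maximalideal m R"
  proof (rule maximalidealI)
    show "ideal m R" "carrier R \<noteq> m" using m(1) one_closed by blast+
    fix J assume J: "ideal J R" "m \<subseteq> J" "J \<subseteq> carrier R"
    show "J = m \<or> J = carrier R"
    proof (cases "\<one> \<in> J")
      case True then show ?thesis using ideal.one_imp_carrier[OF J(1)] by simp
    next
      case False
      then have "J \<in> ?A" using J m(1) by blast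
      then have "J = m" using bspec[OF m(2)] J(2) by blast
      then show ?thesis ..
    qed
  qed
  then show ?thesis using m(1) by blast
qed

lemma (in cring) maximalideal_inverse:
  assumes "maximalideal m R" "a \<in> carrier R" "a \<notin> m"
  shows "\<exists>b \<in> carrier R. \<one> \<ominus> b \<otimes> a \<in> m"
proof -
  interpret m: maximalideal m R by fact
  have id: "ideal (m <+> PIdl a) R"
    by (rule add_ideals[OF m.is_ideal cgenideal_ideal[OF assms(2)]])
  have aP: "a \<in> PIdl a" by (rule cgenideal_self[OF assms(2)])
  have zP: "\<zero> \<in> PIdl a"
    using additive_subgroup.zero_closed[OF ideal.axioms(1)[OF cgenideal_ideal[OF assms(2)]]] .
  have sub: "m \<subseteq> m <+> PIdl a"
  proof
    fix x assume "x \<in> m"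
    then show "x \<in> m <+> PIdl a"
      using zP m.a_Hcarr by (force simp: set_add_def')
  qed
  have "\<zero> \<oplus> a \<in> m <+> PIdl a"
    using aP m.zero_closed by (auto simp: set_add_def')
  then have "a \<in> m <+> PIdl a" using assms(2) by simp
  then have "m <+> PIdl a = carrier R"
    using m.I_maximal[OF id sub] ideal.Icarr[OF id] assms(3) by blast
  then have "\<one> \<in> m <+> PIdl a" by simp
  then obtain i b where i: "i \<in> m" "b \<in> carrier R" "\<one> = i \<oplus> b \<otimes> a"
    by (auto simp: set_add_def' cgenideal_def)
  have "\<one> \<ominus> b \<otimes> a = i"
    using i(2) m.a_Hcarr[OF i(1)] assms(2)
    unfolding i(3) by (simp add: a_minus_def a_assoc r_neg)
  then show ?thesis using i by blast
qed

text \<open>With \<open>p, q, s, u, v\<close> the values \<open>f x\<close>, \<open>g x\<close>,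
  \<open>\<delta> x\<close>, \<open>f w1\<close>, \<open>g w1\<close>, the right side is
  \<open>f z - g z\<close> for the projection \<open>z\<close> of \<open>x\<close> along
  \<open>w1\<close> in the elimination below.\<close>

lemma (in cring) elimination_identity:
  assumes "p \<in> carrier R" "q \<in> carrier R" "s \<in> carrier R" "u \<in> carrier R" "v \<in> carrier R"
  shows "p \<ominus> (q \<oplus> (u \<ominus> v) \<otimes> s) = (p \<ominus> s \<otimes> u) \<ominus> (q \<ominus> s \<otimes> v)"
  using assms by algebra

text \<open>\<open>N\<close> is any submodule of the dual of \<open>K\<close>, closed under
  agreement on the carrier. The application takes the functionals that extend along a map from
  \<open>K\<close>.\<close>

context
  fixes R :: "('a, 'r) ring_scheme" (structure) and K :: "('a, 'k) module" and N :: "('k \<Rightarrow> 'a) set" and m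
  assumes K: "module R K"
    and N_dual: "N \<subseteq> dual R K"
    and N_cong: "\<And>g h. g \<in> N \<Longrightarrow> (\<And>x. x \<in> carrier K \<Longrightarrow> h x = g x) \<Longrightarrow> h \<in> N"
    and N_zero: "(\<lambda>x. \<zero>) \<in> N"
    and N_add: "\<And>g h. g \<in> N \<Longrightarrow> h \<in> N \<Longrightarrow> (\<lambda>x. g x \<oplus> h x) \<in> N"
    and N_smult: "\<And>r g. r \<in> carrier R \<Longrightarrow> g \<in> N \<Longrightarrow> (\<lambda>x. r \<otimes> g x) \<in> N"
    and m: "maximalideal m R"
begin

text \<open>Gaussian elimination over the residue field \<open>R/m\<close>, on the list \<open>D\<close> of functionals.\<close>

lemma extend_mod_maximalideal:
  assumes "f \<in> dual R K" "set D \<subseteq> N" "submodule W R K"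
    "\<And>x. x \<in> W \<Longrightarrow> (\<And>\<delta>. \<delta> \<in> set D \<Longrightarrow> \<delta> x \<in> m) \<Longrightarrow> f x \<in> m"
  shows "\<exists>g \<in> N. \<forall>x \<in> W. f x \<ominus> g x \<in> m"
  using assms(2-4)
proof (induction D arbitrary: W)
  case Nil
  interpret K: module R K by (rule K)
  have "f x \<ominus> \<zero> \<in> m" if "x \<in> W" for x
  proof -
    have "f x \<in> carrier R"
      using mh_closed[OF assms(1) subsetD[OF submodule_subset[OF Nil.prems(2)] that]] by simp
    then show ?thesis using Nil.prems(3)[OF that] by (simp add: a_minus_def)
  qed
  then show ?case by (intro bexI[OF _ N_zero] ballI)
next
  case (Cons \<delta> D)
  interpret K: module R K by (rule K)
  interpret m: maximalideal m R by (rule m)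
  note mR = module_regular[OF K.is_cring]
  note WK = submodule_subset[OF Cons.prems(2)]
  have \<delta>: "\<delta> \<in> dual R K" "\<delta> \<in> N" using Cons.prems(1) N_dual by auto
  have cl: "h x \<in> carrier R" if "h \<in> dual R K" "x \<in> W" for h x
    using mh_closed[OF that(1), of x] that(2) WK by auto
  \<comment> \<open>The functional \<open>\<delta>\<close> cuts \<open>W\<close> down to its kernel
    modulo \<open>m\<close>; the induction hypothesis approximates \<open>f\<close> there.\<close>
  let ?W = "{x \<in> W. \<delta> x \<in> m}"
  have W': "submodule ?W R K"
  proof (rule K.submoduleI)
    show "?W \<subseteq> carrier K" using WK by blast
    show "\<zero>\<^bsub>K\<^esub> \<in> ?W"
      using mh_zero[OF \<delta>(1) K mR] subgroup.one_closed[OF submodule.axioms(1)[OF Cons.prems(2)]]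
        m.zero_closed by simp
    fix x assume x: "x \<in> ?W"
    then have xK: "x \<in> carrier K" using WK by auto
    show "\<ominus>\<^bsub>K\<^esub> x \<in> ?W"
      using K.submoduleE(3)[OF Cons.prems(2)] x mh_neg[OF \<delta>(1) K mR xK] m.a_inv_closed by simp
    fix y assume y: "y \<in> ?W"
    then have yK: "y \<in> carrier K" using WK by auto
    show "x \<oplus>\<^bsub>K\<^esub> y \<in> ?W"
      using K.submoduleE(5)[OF Cons.prems(2)] x y mh_add[OF \<delta>(1) xK yK] m.a_closed by simp
  next
    fix r x assume r: "r \<in> carrier R" and x: "x \<in> ?W"
    then have xK: "x \<in> carrier K" using WK by auto
    show "r \<odot>\<^bsub>K\<^esub> x \<in> ?W"
      using K.submoduleE(4)[OF Cons.prems(2) r] x mh_smult[OF \<delta>(1) r xK] m.I_l_closed[OF _ r] by simp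
  qed
  have "\<exists>g\<in>N. \<forall>x\<in>?W. f x \<ominus> g x \<in> m"
    by (rule Cons.IH[OF _ W']) (use Cons.prems in auto)
  then obtain g where g: "g \<in> N" "\<And>x. x \<in> W \<Longrightarrow> \<delta> x \<in> m \<Longrightarrow> f x \<ominus> g x \<in> m" by blast
  have gd: "g \<in> dual R K" using g(1) N_dual by blast
  show ?case
  proof (cases "\<forall>x \<in> W. \<delta> x \<in> m")
    case True
    then show ?thesis using g(2) by (intro bexI[OF _ g(1)]) simp
  next
    case False
    then obtain w where w: "w \<in> W" "\<delta> w \<notin> m" by blast
    obtain b where b: "b \<in> carrier R" "\<one> \<ominus> b \<otimes> \<delta> w \<in> m"
      using K.maximalideal_inverse[OF m cl[OF \<delta>(1) w(1)] w(2)] by blast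
    \<comment> \<open>Scaling by an inverse modulo \<open>m\<close> normalizes
      \<open>\<delta> w1\<close> to 1 modulo \<open>m\<close>; the \<open>c\<close> below is the
      multiple of \<open>\<delta>\<close> needed to correct \<open>g\<close> at
      \<open>w1\<close>.\<close>
    define w1 where "w1 = b \<odot>\<^bsub>K\<^esub> w"
    have wK: "w \<in> carrier K" using w(1) WK by auto
    have w1: "w1 \<in> W" unfolding w1_def using K.submoduleE(4)[OF Cons.prems(2) b(1) w(1)] .
    then have w1K: "w1 \<in> carrier K" using WK by auto
    have \<delta>w1: "\<delta> w1 = b \<otimes> \<delta> w" unfolding w1_def using mh_smult[OF \<delta>(1) b(1) wK] by simp
    define c where "c = f w1 \<ominus> g w1"
    have c: "c \<in> carrier R"
      unfolding c_def using cl[OF assms(1) w1] cl[OF gd w1] by (rule K.R.minus_closed)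
    show ?thesis
    proof (intro bexI ballI)
      show "(\<lambda>x. g x \<oplus> c \<otimes> \<delta> x) \<in> N" by (rule N_add[OF g(1) N_smult[OF c \<delta>(2)]])
      fix x assume x: "x \<in> W"
      then have xK: "x \<in> carrier K" using WK by auto
      \<comment> \<open>Modulo \<open>m\<close>, the projection of \<open>x\<close> along
        \<open>w1\<close> onto the kernel of \<open>\<delta>\<close>, where \<open>g\<close> already
        approximates \<open>f\<close>.\<close>
      define z where "z = x \<ominus>\<^bsub>K\<^esub> \<delta> x \<odot>\<^bsub>K\<^esub> w1"
      note \<delta>x = cl[OF \<delta>(1) x]
      have zW: "z \<in> W"
        unfolding z_def a_minus_def
        by (intro K.submoduleE(5)[OF Cons.prems(2)] K.submoduleE(3)[OF Cons.prems(2)]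
            K.submoduleE(4)[OF Cons.prems(2)] x w1 \<delta>x)
      have hz: "h z = h x \<ominus> \<delta> x \<otimes> h w1" if h: "h \<in> dual R K" for h
      proof -
        have "h z = h x \<ominus>\<^bsub>regular_module R\<^esub> h (\<delta> x \<odot>\<^bsub>K\<^esub> w1)"
          unfolding z_def by (rule mh_diff[OF h K mR xK K.smult_closed[OF \<delta>x w1K]])
        then show ?thesis using mh_smult[OF h \<delta>x w1K] by (simp add: a_minus_def)
      qed
      have "\<delta> z = \<delta> x \<otimes> (\<one> \<ominus> b \<otimes> \<delta> w)"
        unfolding hz[OF \<delta>(1)] \<delta>w1 using \<delta>x b(1) cl[OF \<delta>(1) w(1)]
        by (simp add: a_minus_def K.R.r_distr K.R.r_minus)
      then have "\<delta> z \<in> m" using m.I_l_closed[OF b(2) \<delta>x] by simp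
      then have "f z \<ominus> g z \<in> m" using g(2)[OF zW] by simp
      then show "f x \<ominus> (g x \<oplus> c \<otimes> \<delta> x) \<in> m"
        unfolding hz[OF assms(1)] hz[OF gd] c_def
        using K.elimination_identity[OF cl[OF assms(1) x] cl[OF gd x] \<delta>x cl[OF assms(1) w1] cl[OF gd w1]]
        by simp
    qed
  qed
qed

lemma msum_in_N:
  assumes "\<And>i. i \<in> set xs \<Longrightarrow> c i \<in> carrier R" "\<And>i. i \<in> set xs \<Longrightarrow> h i \<in> N"
  shows "(\<lambda>x. msum (regular_module R) (\<lambda>i. c i \<otimes> h i x) xs) \<in> N"
  using assms by (induction xs) (auto simp: N_zero intro!: N_add N_smult)

text \<open>The units \<open>u\<close> modulo \<open>m\<close> make the induction on the list of generators work without
  divisions.\<close>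

lemma nakayama:
  assumes "\<And>i. i \<in> set xs \<Longrightarrow> f i \<in> dual R K"
    and "\<And>i. i \<in> set xs \<Longrightarrow> \<exists>g \<in> N. \<exists>c u. (\<forall>j. c j \<in> m) \<and> u \<in> carrier R \<and> u \<notin> m \<and>
      (\<forall>x \<in> carrier K. u \<otimes> f i x = g x \<oplus> msum (regular_module R) (\<lambda>j. c j \<otimes> f j x) xs)"
  shows "\<exists>a \<in> carrier R. a \<notin> m \<and> (\<forall>i \<in> set xs. (\<lambda>x. a \<otimes> f i x) \<in> N)"
  using assms
proof (induction xs)
  case Nil
  interpret K: module R K by (rule K)
  interpret m: maximalideal m R by (rule m)
  have "\<one> \<notin> m" using m.one_imp_carrier m.I_notcarr by blast
  then show ?case by (intro bexI[of _ "\<one>"]) auto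
next
  case (Cons k xs)
  interpret K: module R K by (rule K)
  interpret m: maximalideal m R by (rule m)
  interpret p: primeideal m R by (rule K.maximalideal_prime[OF m])
  note mR = module_regular[OF K.is_cring]
  have mult_notin: "a \<otimes> b \<notin> m" if "a \<in> carrier R" "b \<in> carrier R" "a \<notin> m" "b \<notin> m" for a b
    using p.I_prime[OF that(1,2)] that(3,4) by blast
  let ?S = "\<lambda>c x. msum (regular_module R) (\<lambda>j. c j \<otimes> f j x) xs"
  have fc: "f i x \<in> carrier R" if "i = k \<or> i \<in> set xs" "x \<in> carrier K" for i x
    using mh_closed[OF Cons.prems(1) that(2), of i] that(1) by auto
  have Nc: "g x \<in> carrier R" if "g \<in> N" "x \<in> carrier K" for g x
    using mh_closed[of g R K "regular_module R" x] that N_dual by auto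
  have Sc: "?S c x \<in> carrier R" if "\<And>j. c j \<in> carrier R" "x \<in> carrier K" for c x
    using msum_closed[OF mR, of xs "\<lambda>j. c j \<otimes> f j x"] fc that by auto
  have S_smult: "r \<otimes> ?S c x = ?S (\<lambda>j. r \<otimes> c j) x"
    if "r \<in> carrier R" "\<And>j. c j \<in> carrier R" "x \<in> carrier K" for r c x
  proof -
    have "r \<otimes> ?S c x = msum (regular_module R) (\<lambda>j. r \<otimes> (c j \<otimes> f j x)) xs"
      using msum_smult[OF mR, of r xs "\<lambda>j. c j \<otimes> f j x"] that fc by auto
    also have "\<dots> = ?S (\<lambda>j. r \<otimes> c j) x"
      by (rule msum_cong) (use that fc in \<open>auto simp: K.R.m_assoc\<close>)
    finally show ?thesis .
  qed
  have S_add: "?S c x \<oplus> ?S c' x = ?S (\<lambda>j. c j \<oplus> c' j) x"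
    if "\<And>j. c j \<in> carrier R" "\<And>j. c' j \<in> carrier R" "x \<in> carrier K" for c c' x
  proof -
    have "?S (\<lambda>j. c j \<oplus> c' j) x =
      msum (regular_module R) (\<lambda>j. c j \<otimes> f j x \<oplus>\<^bsub>regular_module R\<^esub> c' j \<otimes> f j x) xs"
      by (rule msum_cong) (use that fc in \<open>auto simp: K.R.l_distr\<close>)
    also have "\<dots> = ?S c x \<oplus>\<^bsub>regular_module R\<^esub> ?S c' x"
      by (rule msum_add[OF mR]) (use that fc in auto)
    finally show ?thesis by simp
  qed
  obtain g0 c0 u0 where ex0: "g0 \<in> N" "\<forall>j. c0 j \<in> m" "u0 \<in> carrier R" "u0 \<notin> m"
    "\<forall>x \<in> carrier K. u0 \<otimes> f k x = g0 x \<oplus> (c0 k \<otimes> f k x \<oplus> ?S c0 x)"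
    using Cons.prems(2)[of k] by auto
  note 0 = ex0(1) spec[OF ex0(2)] ex0(3,4) bspec[OF ex0(5)]
  have c0R: "c0 j \<in> carrier R" for j using 0(2) m.a_Hcarr by blast
  \<comment> \<open>The diagonal term \<open>c0 k\<close> is moved to the left. As it lies in
    \<open>m\<close>, the factor \<open>u\<close> stays a unit modulo \<open>m\<close>, and
    \<open>u\<close> times \<open>f k\<close> is expressed by the remaining generators.\<close>
  define u where "u = u0 \<ominus> c0 k"
  have uR: "u \<in> carrier R" unfolding u_def using 0(3) c0R by (rule K.R.minus_closed)
  have um: "u \<notin> m"
  proof
    assume "u \<in> m"
    then have "u \<oplus> c0 k \<in> m" using 0(2) m.a_closed by blast
    then show False using 0(3,4) c0R by (simp add: u_def a_minus_def K.R.a_assoc K.R.l_neg)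
  qed
  have k_eq: "u \<otimes> f k x = g0 x \<oplus> ?S c0 x" if x: "x \<in> carrier K" for x
  proof -
    have cl: "f k x \<in> carrier R" "g0 x \<in> carrier R" "?S c0 x \<in> carrier R" "c0 k \<in> carrier R"
      using fc x Nc[OF 0(1)] Sc c0R by auto
    have "u \<otimes> f k x = u0 \<otimes> f k x \<ominus> c0 k \<otimes> f k x"
      unfolding u_def using cl 0(3) by (simp add: a_minus_def K.R.l_distr K.R.l_minus)
    also have "\<dots> = g0 x \<oplus> ?S c0 x"
      unfolding 0(5)[OF x] using cl
      by (simp add: a_minus_def K.R.a_ac K.R.r_neg K.R.r_neg1 K.R.r_neg2)
    finally show ?thesis .
  qed
  have "\<exists>a\<in>carrier R. a \<notin> m \<and> (\<forall>i\<in>set xs. (\<lambda>x. a \<otimes> f i x) \<in> N)"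
  proof (rule Cons.IH)
    fix i assume i: "i \<in> set xs"
    show "f i \<in> dual R K" using Cons.prems(1) i by simp
    obtain g c v where exg: "g \<in> N" "\<forall>j. c j \<in> m" "v \<in> carrier R" "v \<notin> m"
      "\<forall>x \<in> carrier K. v \<otimes> f i x = g x \<oplus> (c k \<otimes> f k x \<oplus> ?S c x)"
      using Cons.prems(2)[of i] i by auto
    note g = exg(1) spec[OF exg(2)] exg(3,4) bspec[OF exg(5)]
    have cR: "c j \<in> carrier R" for j using g(2) m.a_Hcarr by blast
    \<comment> \<open>Multiply the relation for \<open>i\<close> by \<open>u\<close> and substitute
      the one for \<open>f k\<close>; the new coefficients stay in \<open>m\<close>.\<close>
    let ?g = "\<lambda>x. u \<otimes> g x \<oplus> c k \<otimes> g0 x"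
    let ?c = "\<lambda>j. c k \<otimes> c0 j \<oplus> u \<otimes> c j"
    have gN: "?g \<in> N" by (intro N_add N_smult uR cR g(1) 0(1))
    have cm: "?c j \<in> m" for j
      using m.I_l_closed[OF 0(2) cR] m.I_l_closed[OF g(2) uR] m.a_closed by blast
    have uv: "u \<otimes> v \<in> carrier R" "u \<otimes> v \<notin> m"
      using uR g(3) mult_notin[OF uR g(3) um g(4)] by auto
    have "(u \<otimes> v) \<otimes> f i x = ?g x \<oplus> ?S ?c x" if x: "x \<in> carrier K" for x
    proof -
      have cl: "f k x \<in> carrier R" "g0 x \<in> carrier R" "?S c0 x \<in> carrier R" "g x \<in> carrier R"
        "?S c x \<in> carrier R" "f i x \<in> carrier R" "c k \<in> carrier R"
        using fc x i Nc[OF 0(1)] Nc[OF g(1)] Sc c0R cR by auto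
      have "(u \<otimes> v) \<otimes> f i x = u \<otimes> (v \<otimes> f i x)" using uR g(3) cl by (simp add: K.R.m_assoc)
      also have "\<dots> = u \<otimes> g x \<oplus> (c k \<otimes> (u \<otimes> f k x) \<oplus> u \<otimes> ?S c x)"
        unfolding g(5)[OF x] using uR cl by (simp add: K.R.r_distr K.R.m_lcomm)
      also have "\<dots> = ?g x \<oplus> (c k \<otimes> ?S c0 x \<oplus> u \<otimes> ?S c x)"
        unfolding k_eq[OF x] using uR cl by (simp add: K.R.r_distr K.R.a_assoc)
      also have "\<dots> = ?g x \<oplus> ?S ?c x"
        using S_smult[OF cl(7), of c0 x] S_smult[OF uR, of c x]
          S_add[of "\<lambda>j. c k \<otimes> c0 j" "\<lambda>j. u \<otimes> c j" x] c0R cR uR x by simp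
      finally show ?thesis .
    qed
    then show "\<exists>g\<in>N. \<exists>c u. (\<forall>j. c j \<in> m) \<and> u \<in> carrier R \<and> u \<notin> m \<and>
      (\<forall>x\<in>carrier K. u \<otimes> f i x = g x \<oplus> ?S c x)"
      using gN cm uv by (intro bexI[OF _ gN] exI[of _ ?c] exI[of _ "u \<otimes> v"]) auto
  qed
  then obtain a where a: "a \<in> carrier R" "a \<notin> m" "\<And>i. i \<in> set xs \<Longrightarrow> (\<lambda>x. a \<otimes> f i x) \<in> N" by blast
  \<comment> \<open>The extra factor \<open>u\<close> makes the relation for \<open>f k\<close>
    applicable, so that \<open>a u\<close> moves \<open>f k\<close> into \<open>N\<close> as
    well.\<close>
  have au: "a \<otimes> u \<in> carrier R" "a \<otimes> u \<notin> m" using a(1) uR mult_notin[OF a(1) uR a(2) um] by auto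
  have "(\<lambda>x. a \<otimes> u \<otimes> f i x) \<in> N" if i: "i \<in> set xs" for i
    by (rule N_cong[OF N_smult[OF uR a(3)[OF i]]])
      (use a(1) uR fc i in \<open>auto simp: K.R.m_ac\<close>)
  moreover have "(\<lambda>x. a \<otimes> u \<otimes> f k x) \<in> N"
  proof (rule N_cong)
    show "(\<lambda>x. a \<otimes> g0 x \<oplus> msum (regular_module R) (\<lambda>j. c0 j \<otimes> (a \<otimes> f j x)) xs) \<in> N"
      by (intro N_add N_smult a(1) 0(1) msum_in_N c0R a(3))
    fix x assume x: "x \<in> carrier K"
    have cl: "f k x \<in> carrier R" "g0 x \<in> carrier R" "?S c0 x \<in> carrier R"
      using fc x Nc[OF 0(1)] Sc c0R by auto
    have "a \<otimes> u \<otimes> f k x = a \<otimes> (g0 x \<oplus> ?S c0 x)"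
      using k_eq[OF x] a(1) uR cl by (simp add: K.R.m_assoc)
    also have "\<dots> = a \<otimes> g0 x \<oplus> ?S (\<lambda>j. a \<otimes> c0 j) x"
      using S_smult[OF a(1) c0R x] a(1) cl by (simp add: K.R.r_distr)
    also have "?S (\<lambda>j. a \<otimes> c0 j) x = msum (regular_module R) (\<lambda>j. c0 j \<otimes> (a \<otimes> f j x)) xs"
      by (rule msum_cong) (use a(1) c0R fc x in \<open>auto simp: K.R.m_ac\<close>)
    finally show "a \<otimes> u \<otimes> f k x =
      a \<otimes> g0 x \<oplus> msum (regular_module R) (\<lambda>j. c0 j \<otimes> (a \<otimes> f j x)) xs" .
  qed
  ultimately show ?case using au by (intro bexI[of _ "a \<otimes> u"]) auto
qed

end

text \<open>Hypothesis \<open>inj\<close> is injectivity of \<open>K/mK -> Q/mQ\<close>, phrased by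
  functionals. As \<open>K\<close> has a finite dual basis, a retraction exists once its finitely
  many coordinate functionals extend along \<open>\<iota>\<close>.\<close>

lemma split_mod_maximalideals:
  fixes R (structure)
  assumes K: "fdb R K" and Q: "fdb R Q" and \<iota>: "\<iota> \<in> module_hom R K Q"
    and inj: "\<And>m y h. maximalideal m R \<Longrightarrow> y \<in> carrier K \<Longrightarrow>
      (\<And>f. f \<in> dual R Q \<Longrightarrow> f (\<iota> y) \<in> m) \<Longrightarrow> h \<in> dual R K \<Longrightarrow> h y \<in> m"
  shows "\<exists>r \<in> module_hom R Q K. \<forall>y \<in> carrier K. r (\<iota> y) = y"
proof -
  have mK: "module R K" and mQ: "module R Q" using K Q by (auto simp: fdb_def)
  interpret K: module R K by (rule mK)
  interpret Q: module R Q by (rule mQ)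
  note mR = module_regular[OF K.is_cring]
  obtain L where L: "set L \<subseteq> dual R K \<times> carrier K"
    "\<And>x. x \<in> carrier K \<Longrightarrow> x = msum K (\<lambda>(f, y). f x \<odot>\<^bsub>K\<^esub> y) L"
    using K by (auto simp: fdb_def)
  obtain E where E: "set E \<subseteq> dual R Q \<times> carrier Q"
    "\<And>x. x \<in> carrier Q \<Longrightarrow> x = msum Q (\<lambda>(f, y). f x \<odot>\<^bsub>Q\<^esub> y) E"
    using Q by (auto simp: fdb_def)
  have Lc: "f \<in> dual R K" "y \<in> carrier K" if "(f, y) \<in> set L" for f y using that L(1) by auto
  define N where "N = {\<phi> \<in> dual R K. \<exists>g \<in> dual R Q. \<forall>y \<in> carrier K. \<phi> y = g (\<iota> y)}"
  have N_dual: "N \<subseteq> dual R K" by (auto simp: N_def)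
  have N_cong: "h \<in> N" if "g \<in> N" "\<And>x. x \<in> carrier K \<Longrightarrow> h x = g x" for g h
    using that mh_cong[of g R K "regular_module R" h] mK by (auto simp: N_def)
  have N_zero: "(\<lambda>x. \<zero>) \<in> N"
    using mh_zero_fun[OF mK mR] mh_zero_fun[OF mQ mR] by (auto simp: N_def)
  have N_add: "(\<lambda>x. g x \<oplus> h x) \<in> N" if gh: "g \<in> N" "h \<in> N" for g h
  proof -
    obtain g' h' where g': "g' \<in> dual R Q" "\<forall>y \<in> carrier K. g y = g' (\<iota> y)"
      and h': "h' \<in> dual R Q" "\<forall>y \<in> carrier K. h y = h' (\<iota> y)" using gh by (auto simp: N_def)
    have "(\<lambda>x. g' x \<oplus> h' x) \<in> dual R Q" using mh_add_fun[OF g'(1) h'(1) mQ mR] by simp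
    moreover have "(\<lambda>x. g x \<oplus> h x) \<in> dual R K" using mh_add_fun[OF _ _ mK mR] gh N_dual by fastforce
    ultimately show ?thesis using g'(2) h'(2) by (auto simp: N_def)
  qed
  have N_smult: "(\<lambda>x. r \<otimes> g x) \<in> N" if r: "r \<in> carrier R" and g: "g \<in> N" for r g
  proof -
    obtain g' where g': "g' \<in> dual R Q" "\<forall>y \<in> carrier K. g y = g' (\<iota> y)" using g by (auto simp: N_def)
    have "(\<lambda>x. r \<otimes> g' x) \<in> dual R Q" using mh_smult_fun[OF g'(1) mQ mR r] by simp
    moreover have "(\<lambda>x. r \<otimes> g x) \<in> dual R K" using mh_smult_fun[OF _ mK mR r] g N_dual by fastforce
    ultimately show ?thesis using g'(2) by (auto simp: N_def)
  qed
  note N = mK N_dual N_cong N_zero N_add N_smult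
  \<comment> \<open>The scalars that make every coordinate functional extend. Nakayama at
    \<open>m\<close> yields an element of \<open>J\<close> outside \<open>m\<close>, for each
    \<open>m\<close>; hence \<open>\<one> \<in> J\<close>.\<close>
  define J where "J = {a \<in> carrier R. \<forall>i \<in> set L. (\<lambda>x. a \<otimes> fst i x) \<in> N}"
  have Lx: "fst i x \<in> carrier R" if "i \<in> set L" "x \<in> carrier K" for i x
    using mh_closed[OF Lc(1)[of "fst i" "snd i"] that(2)] that(1) by simp
  have "ideal J R"
  proof (rule idealI)
    show "ring R" by (rule K.ring_axioms)
    show "subgroup J (add_monoid R)"
    proof (rule group.subgroupI[OF K.R.a_group])
      show "J \<subseteq> carrier (add_monoid R)" by (auto simp: J_def)
      have "\<zero> \<in> J" using N_cong[OF N_zero] Lx by (auto simp: J_def)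
      then show "J \<noteq> {}" by blast
      fix a assume a: "a \<in> J"
      have "(\<lambda>x. (\<ominus> a) \<otimes> fst i x) \<in> N" if i: "i \<in> set L" for i
      proof (rule N_cong)
        show "(\<lambda>x. (\<ominus> \<one>) \<otimes> (a \<otimes> fst i x)) \<in> N"
          by (rule N_smult) (use a i in \<open>auto simp: J_def\<close>)
      qed (use a Lx[OF i] in \<open>auto simp: J_def K.R.l_minus\<close>)
      then show "inv\<^bsub>add_monoid R\<^esub> a \<in> J" using a by (auto simp: J_def a_inv_def[symmetric])
      fix b assume b: "b \<in> J"
      have "(\<lambda>x. (a \<oplus> b) \<otimes> fst i x) \<in> N" if i: "i \<in> set L" for i
      proof (rule N_cong)
        show "(\<lambda>x. a \<otimes> fst i x \<oplus> b \<otimes> fst i x) \<in> N"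
          by (rule N_add) (use a b i in \<open>auto simp: J_def\<close>)
      qed (use a b Lx[OF i] in \<open>auto simp: J_def K.R.l_distr\<close>)
      then show "a \<otimes>\<^bsub>add_monoid R\<^esub> b \<in> J" using a b by (auto simp: J_def)
    qed
  next
    fix a r assume a: "a \<in> J" and r: "r \<in> carrier R"
    have "(\<lambda>x. (r \<otimes> a) \<otimes> fst i x) \<in> N" if i: "i \<in> set L" for i
    proof (rule N_cong)
      show "(\<lambda>x. r \<otimes> (a \<otimes> fst i x)) \<in> N"
        by (rule N_smult[OF r]) (use a i in \<open>auto simp: J_def\<close>)
    qed (use a r Lx[OF i] in \<open>auto simp: J_def K.R.m_assoc\<close>)
    then show "r \<otimes> a \<in> J" using a r by (auto simp: J_def)
    then show "a \<otimes> r \<in> J" using a r by (auto simp: J_def K.R.m_comm)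
  qed
  moreover have "\<not> J \<subseteq> m" if m: "maximalideal m R" for m
  proof -
    interpret m: maximalideal m R by (rule m)
    \<comment> \<open>The coordinates of \<open>Q\<close>, restricted to \<open>K\<close>: finitely
      many members of \<open>N\<close> that, when all take values in \<open>m\<close> at a point,
      force every functional of \<open>Q\<close> to do so.\<close>
    let ?D = "map (\<lambda>(f, y). \<lambda>x. f (\<iota> x)) E"
    have DN: "set ?D \<subseteq> N" using E(1) mh_comp[OF _ \<iota>] by (auto simp: N_def subset_iff)
    have "\<exists>a \<in> carrier R. a \<notin> m \<and> (\<forall>i \<in> set L. (\<lambda>x. a \<otimes> fst i x) \<in> N)"
    proof (rule nakayama[OF N m])
      fix i assume i: "i \<in> set L"
      then have fi: "fst i \<in> dual R K" using Lc(1)[of "fst i" "snd i"] by simp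
      then show "fst i \<in> dual R K" .
      have "\<exists>g\<in>N. \<forall>x\<in>carrier K. fst i x \<ominus> g x \<in> m"
      proof (rule extend_mod_maximalideal[OF N m fi DN K.carrier_is_submodule])
        fix y assume y: "y \<in> carrier K" and \<delta>: "\<And>\<delta>. \<delta> \<in> set ?D \<Longrightarrow> \<delta> y \<in> m"
        have \<iota>y: "\<iota> y \<in> carrier Q" by (rule mh_closed[OF \<iota> y])
        have "f (\<iota> y) \<in> m" if f: "f \<in> dual R Q" for f
        proof -
          have Ec: "k (\<iota> y) \<in> m" "k (\<iota> y) \<in> carrier R" "f z \<in> carrier R" "z \<in> carrier Q"
            if kz: "(k, z) \<in> set E" for k z
          proof -
            show *: "k (\<iota> y) \<in> m" using \<delta>[of "\<lambda>x. k (\<iota> x)"] kz by force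
            show "k (\<iota> y) \<in> carrier R" using m.a_Hcarr[OF *] .
            show z: "z \<in> carrier Q" using kz E(1) by auto
            show "f z \<in> carrier R" using mh_closed[OF f z] by simp
          qed
          have "f (\<iota> y) = f (msum Q (\<lambda>(k, z). k (\<iota> y) \<odot>\<^bsub>Q\<^esub> z) E)" using E(2)[OF \<iota>y] by simp
          also have "\<dots> = msum (regular_module R) (\<lambda>kz. f ((\<lambda>(k, z). k (\<iota> y) \<odot>\<^bsub>Q\<^esub> z) kz)) E"
            by (rule msum_hom[OF f mQ mR]) (use Ec in auto)
          also have "\<dots> = msum (regular_module R) (\<lambda>kz. fst kz (\<iota> y) \<otimes> f (snd kz)) E"
            by (rule msum_cong) (use Ec in \<open>auto simp: mh_smult[OF f]\<close>)
          also have "\<dots> \<in> m"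
          proof -
            have "msum (regular_module R) (\<lambda>kz. fst kz (\<iota> y) \<otimes> f (snd kz)) zs \<in> m"
              if "set zs \<subseteq> set E" for zs
              using that
            proof (induction zs)
              case Nil then show ?case using m.zero_closed by simp
            next
              case (Cons kz zs)
              obtain k z where kz: "kz = (k, z)" by force
              then have "(k, z) \<in> set E" using Cons.prems by simp
              then have "k (\<iota> y) \<otimes> f z \<in> m" using Ec m.I_r_closed by blast
              then show ?case using Cons m.a_closed by (simp add: kz)
            qed
            then show ?thesis by simp
          qed
          finally show ?thesis .
        qed
        then show "fst i y \<in> m" using inj[OF m y _ fi] by blast
      qed
      then obtain g where g: "g \<in> N" "\<And>x. x \<in> carrier K \<Longrightarrow> fst i x \<ominus> g x \<in> m" by blast
      define h where "h x = fst i x \<ominus> g x" for x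
      have gd: "g \<in> dual R K" using g(1) N_dual by blast
      have h: "h \<in> dual R K"
        using mh_diff_fun[OF fi gd mK mR] by (simp add: h_def[abs_def] a_minus_def)
      have hm: "h x \<in> m" if "x \<in> carrier K" for x using g(2)[OF that] by (simp add: h_def)
      \<comment> \<open>The remainder \<open>h\<close> takes values in \<open>m\<close> and is the
        combination of the coordinate functionals with coefficients \<open>h (snd j)\<close>. The
        default \<open>\<zero>\<close> outside \<open>L\<close> keeps every \<open>c j\<close> in
        \<open>m\<close>, as \<open>nakayama\<close> demands.\<close>
      define c where "c j = (if j \<in> set L then h (snd j) else \<zero>)" for j
      have cm: "c j \<in> m" for j
        unfolding c_def using hm Lc(2)[of "fst j" "snd j"] m.zero_closed by auto
      have hx: "h x = msum (regular_module R) (\<lambda>j. c j \<otimes> fst j x) L" if x: "x \<in> carrier K" for x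
      proof -
        have "h x = h (msum K (\<lambda>(f, y). f x \<odot>\<^bsub>K\<^esub> y) L)" using L(2)[OF x] by simp
        also have "\<dots> = msum (regular_module R) (\<lambda>j. h ((\<lambda>(f, y). f x \<odot>\<^bsub>K\<^esub> y) j)) L"
          by (rule msum_hom[OF h mK mR]) (use Lc Lx[OF _ x] in force)
        also have "\<dots> = msum (regular_module R) (\<lambda>j. c j \<otimes> fst j x) L"
        proof (rule msum_cong)
          fix j assume j: "j \<in> set L"
          have "h (fst j x \<odot>\<^bsub>K\<^esub> snd j) = fst j x \<otimes> h (snd j)"
            using mh_smult[OF h Lx[OF j x]] Lc(2)[of "fst j" "snd j"] j by simp
          then show "h ((\<lambda>(f, y). f x \<odot>\<^bsub>K\<^esub> y) j) = c j \<otimes> fst j x"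
            using K.R.m_comm[OF Lx[OF j x] m.a_Hcarr[OF cm[of j]]] j
            by (simp add: case_prod_unfold c_def)
        qed
        finally show ?thesis .
      qed
      have one: "\<one> \<notin> m" using m.one_imp_carrier m.I_notcarr by blast
      have "\<one> \<otimes> fst i x = g x \<oplus> msum (regular_module R) (\<lambda>j. c j \<otimes> fst j x) L"
        if x: "x \<in> carrier K" for x
        unfolding hx[OF x, symmetric] h_def using Lx[OF i x] mh_closed[OF gd x]
        by (simp add: a_minus_def K.R.a_lcomm[of "g x" "fst i x"] K.R.r_neg)
      then show "\<exists>g\<in>N. \<exists>c u. (\<forall>j. c j \<in> m) \<and> u \<in> carrier R \<and> u \<notin> m \<and>
         (\<forall>x\<in>carrier K. u \<otimes> fst i x = g x \<oplus> msum (regular_module R) (\<lambda>j. c j \<otimes> fst j x) L)"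
        using cm one by (intro bexI[OF _ g(1)] exI[of _ c] exI[of _ "\<one>"]) auto
    qed
    then show ?thesis by (auto simp: J_def)
  qed
  ultimately have "\<one> \<in> J" using K.exists_maximalideal by blast
  then have "\<exists>g \<in> dual R Q. \<forall>y \<in> carrier K. fst i y = g (\<iota> y)" if i: "i \<in> set L" for i
  proof -
    have "(\<lambda>x. \<one> \<otimes> fst i x) \<in> N" using \<open>\<one> \<in> J\<close> i by (simp add: J_def)
    then obtain g where g: "g \<in> dual R Q" "\<forall>y \<in> carrier K. \<one> \<otimes> fst i y = g (\<iota> y)"
      by (auto simp: N_def)
    then show ?thesis using Lx[OF i] by (intro bexI[OF _ g(1)]) simp
  qed
  then obtain g where g: "\<And>i. i \<in> set L \<Longrightarrow> g i \<in> dual R Q"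
    "\<And>i y. i \<in> set L \<Longrightarrow> y \<in> carrier K \<Longrightarrow> fst i y = g i (\<iota> y)" by metis
  have gc: "g i x \<in> carrier R" if "i \<in> set L" "x \<in> carrier Q" for i x
    using mh_closed[OF g(1)[OF that(1)] that(2)] by simp
  have Lc2: "snd i \<in> carrier K" if "i \<in> set L" for i using Lc(2)[of "fst i" "snd i"] that by simp
  \<comment> \<open>The dual basis expansion in \<open>K\<close>, with coordinates replaced by their
    extensions \<open>g i\<close>, makes sense on \<open>Q\<close> and is the identity on
    \<open>K\<close>.\<close>
  have "(\<lambda>x. msum K (\<lambda>i. g i x \<odot>\<^bsub>K\<^esub> snd i) L) \<in> module_hom R Q K"
  proof (rule module_homI)
    fix x assume x: "x \<in> carrier Q"
    show "msum K (\<lambda>i. g i x \<odot>\<^bsub>K\<^esub> snd i) L \<in> carrier K"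
      by (rule msum_closed[OF mK]) (use gc Lc2 x in auto)
    fix y assume y: "y \<in> carrier Q"
    have "msum K (\<lambda>i. g i (x \<oplus>\<^bsub>Q\<^esub> y) \<odot>\<^bsub>K\<^esub> snd i) L =
       msum K (\<lambda>i. g i x \<odot>\<^bsub>K\<^esub> snd i \<oplus>\<^bsub>K\<^esub> g i y \<odot>\<^bsub>K\<^esub> snd i) L"
      by (rule msum_cong) (use gc Lc2 x y in \<open>simp add: mh_add[OF g(1)] K.smult_l_distr\<close>)
    also have "\<dots> = msum K (\<lambda>i. g i x \<odot>\<^bsub>K\<^esub> snd i) L \<oplus>\<^bsub>K\<^esub> msum K (\<lambda>i. g i y \<odot>\<^bsub>K\<^esub> snd i) L"
      by (rule msum_add[OF mK]) (use gc Lc2 x y in auto)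
    finally show "msum K (\<lambda>i. g i (x \<oplus>\<^bsub>Q\<^esub> y) \<odot>\<^bsub>K\<^esub> snd i) L =
      msum K (\<lambda>i. g i x \<odot>\<^bsub>K\<^esub> snd i) L \<oplus>\<^bsub>K\<^esub> msum K (\<lambda>i. g i y \<odot>\<^bsub>K\<^esub> snd i) L" .
  next
    fix r x assume r: "r \<in> carrier R" and x: "x \<in> carrier Q"
    have "msum K (\<lambda>i. g i (r \<odot>\<^bsub>Q\<^esub> x) \<odot>\<^bsub>K\<^esub> snd i) L = msum K (\<lambda>i. r \<odot>\<^bsub>K\<^esub> (g i x \<odot>\<^bsub>K\<^esub> snd i)) L"
      by (rule msum_cong) (use gc Lc2 r x in \<open>simp add: mh_smult[OF g(1)] K.smult_assoc1\<close>)
    also have "\<dots> = r \<odot>\<^bsub>K\<^esub> msum K (\<lambda>i. g i x \<odot>\<^bsub>K\<^esub> snd i) L"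
      by (rule msum_smult[symmetric, OF mK r]) (use gc Lc2 x in auto)
    finally show "msum K (\<lambda>i. g i (r \<odot>\<^bsub>Q\<^esub> x) \<odot>\<^bsub>K\<^esub> snd i) L = r \<odot>\<^bsub>K\<^esub> msum K (\<lambda>i. g i x \<odot>\<^bsub>K\<^esub> snd i) L" .
  qed
  moreover have "msum K (\<lambda>i. g i (\<iota> y) \<odot>\<^bsub>K\<^esub> snd i) L = y" if y: "y \<in> carrier K" for y
  proof -
    have "msum K (\<lambda>i. g i (\<iota> y) \<odot>\<^bsub>K\<^esub> snd i) L = msum K (\<lambda>(f, z). f y \<odot>\<^bsub>K\<^esub> z) L"
      by (rule msum_cong) (use g(2)[OF _ y] in \<open>auto simp: case_prod_unfold\<close>)
    also have "\<dots> = y" by (rule L(2)[OF y, symmetric])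
    finally show ?thesis .
  qed
  ultimately show ?thesis by (intro bexI ballI)
qed

section \<open>Finitely generated projective modules\<close>

lemma fin_gen_image:
  assumes "module R A" "module R B" "h \<in> module_hom R A B" "h ` carrier A = carrier B" "fin_gen R A"
  shows "fin_gen R B"
proof -
  interpret A: module R A by fact
  interpret B: module R B by fact
  obtain S where S: "finite S" "S \<subseteq> carrier A" "\<Inter>{H. submodule H R A \<and> S \<subseteq> H} = carrier A"
    using assms(5) by (auto simp: fin_gen_def)
  have "carrier B \<subseteq> H" if H: "submodule H R B" "h ` S \<subseteq> H" for H
  proof -
    let ?H = "{x \<in> carrier A. h x \<in> H}"
    have "submodule ?H R A"
      by (rule A.submoduleI)
        (use B.submoduleE[OF H(1)] subgroup.one_closed[OF submodule.axioms(1)[OF H(1)]]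
          mh_zero[OF assms(3,1,2)] mh_neg[OF assms(3,1,2)] mh_add[OF assms(3)] mh_smult[OF assms(3)]
          in \<open>auto\<close>)
    moreover have "S \<subseteq> ?H" using S(2) H(2) by auto
    ultimately have "carrier A \<subseteq> ?H" unfolding S(3)[symmetric] by blast
    then show ?thesis unfolding assms(4)[symmetric] by blast
  qed
  moreover have "submodule (carrier B) R B" by (rule B.carrier_is_submodule)
  moreover have "h ` S \<subseteq> carrier B" using S(2) assms(4) by blast
  ultimately have "\<Inter>{H. submodule H R B \<and> h ` S \<subseteq> H} = carrier B" by blast
  then show ?thesis unfolding fin_gen_def
    using S(1) \<open>h ` S \<subseteq> carrier B\<close> by (intro exI[of _ "h ` S"]) simp
qed

lemma fin_gen_zero_module:
  assumes "module R P" "carrier P = {\<zero>\<^bsub>P\<^esub>}" shows "fin_gen R P"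
proof -
  interpret P: module R P by fact
  have "\<Inter>{H. submodule H R P \<and> {} \<subseteq> H} = carrier P"
  proof
    show "\<Inter>{H. submodule H R P \<and> {} \<subseteq> H} \<subseteq> carrier P" using P.carrier_is_submodule by blast
    have "\<zero>\<^bsub>P\<^esub> \<in> H" if "submodule H R P" for H
      using subgroup.one_closed[OF submodule.axioms(1)[OF that]] by simp
    then show "carrier P \<subseteq> \<Inter>{H. submodule H R P \<and> {} \<subseteq> H}" unfolding assms(2) by blast
  qed
  then show ?thesis unfolding fin_gen_def by (intro exI[of _ "{}"]) simp
qed

text \<open>The images of finitely many generators in the free module have a finite joint support.
  The elements supported there form a submodule containing the generators, hence are all of
  \<open>P\<close>.\<close>

lemma fin_gen_projective_fdb:
  fixes P :: "('a, 'm) module"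
  assumes "fin_gen R P" "projective R P" shows "fdb R P"
proof -
  obtain B :: "'m set" and s p where sp: "s \<in> module_hom R P (free_module R B)"
    "p \<in> module_hom R (free_module R B) P" "\<And>x. x \<in> carrier P \<Longrightarrow> p (s x) = x"
    using assms(2) unfolding projective_def by blast
  obtain S where S: "finite S" "S \<subseteq> carrier P" "\<Inter>{H. submodule H R P \<and> S \<subseteq> H} = carrier P"
    using assms(1) by (auto simp: fin_gen_def)
  note mP = projective_module[OF assms(2)]
  interpret P: module R P by (rule mP)
  note cr = P.is_cring
  let ?F = "free_module R B"
  note mF = module_free_module[OF cr, of B]
  interpret F: module R ?F by (rule mF)
  have sF: "s x \<in> carrier ?F" if "x \<in> carrier P" for x by (rule mh_closed[OF sp(1) that])
  note sR = free_module_value[OF cr sF]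
  let ?T = "\<Union>x\<in>S. {b. s x b \<noteq> \<zero>\<^bsub>R\<^esub>}"
  have supp: "finite {b. s x b \<noteq> \<zero>\<^bsub>R\<^esub>}" "{b. s x b \<noteq> \<zero>\<^bsub>R\<^esub>} \<subseteq> B" if "x \<in> S" for x
    using sF[OF subsetD[OF S(2) that]] unfolding carrier_free_module by blast+
  have T1: "finite ?T" by (rule finite_UN_I[OF S(1) supp(1)])
  have T2: "?T \<subseteq> B" by (rule UN_least[OF supp(2)])
  obtain xs where xs: "set xs = ?T" "distinct xs" using finite_distinct_list[OF T1] by blast
  let ?H = "{x \<in> carrier P. \<forall>b. b \<notin> ?T \<longrightarrow> s x b = \<zero>\<^bsub>R\<^esub>}"
  have "submodule ?H R P"
  proof (rule P.submoduleI)
    show "?H \<subseteq> carrier P" by blast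
    show "\<zero>\<^bsub>P\<^esub> \<in> ?H" using mh_zero[OF sp(1) mP mF] by simp
    fix x assume x: "x \<in> ?H"
    have xP: "x \<in> carrier P" using x by blast
    have "s (\<ominus>\<^bsub>P\<^esub> x) = s ((\<ominus>\<^bsub>R\<^esub> \<one>\<^bsub>R\<^esub>) \<odot>\<^bsub>P\<^esub> x)"
      using xP by (simp add: P.smult_l_minus)
    also have "\<dots> = (\<lambda>b. (\<ominus>\<^bsub>R\<^esub> \<one>\<^bsub>R\<^esub>) \<otimes>\<^bsub>R\<^esub> s x b)"
      using mh_smult[OF sp(1) _ xP, of "\<ominus>\<^bsub>R\<^esub> \<one>\<^bsub>R\<^esub>"] by simp
    finally show "\<ominus>\<^bsub>P\<^esub> x \<in> ?H" using x by simp
    fix y assume y: "y \<in> ?H"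
    then show "x \<oplus>\<^bsub>P\<^esub> y \<in> ?H" using x by (simp add: mh_add[OF sp(1)])
  next
    fix r x assume "r \<in> carrier R" "x \<in> ?H"
    then show "r \<odot>\<^bsub>P\<^esub> x \<in> ?H" by (simp add: mh_smult[OF sp(1)])
  qed
  moreover have "S \<subseteq> ?H" using S(2) by blast
  ultimately have H: "carrier P \<subseteq> ?H" unfolding S(3)[symmetric] by blast
  have e: "unit_vec R b \<in> carrier ?F" if "b \<in> set xs" for b
    by (rule unit_vec_closed[OF cr subsetD[OF T2]]) (use that xs(1) in simp)
  have coord: "(\<lambda>x. s x b) \<in> dual R P" for b
    by (rule module_homI) (use sR in \<open>auto simp: mh_add[OF sp(1)] mh_smult[OF sp(1)]\<close>)
  let ?L = "map (\<lambda>b. (\<lambda>x. s x b, p (unit_vec R b))) xs"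
  have "x = msum P (\<lambda>(f, y). f x \<odot>\<^bsub>P\<^esub> y) ?L" if x: "x \<in> carrier P" for x
  proof -
    have "{b. s x b \<noteq> \<zero>\<^bsub>R\<^esub>} \<subseteq> set xs" using subsetD[OF H x] unfolding xs(1) by blast
    then have "s x = msum ?F (\<lambda>b. s x b \<odot>\<^bsub>?F\<^esub> unit_vec R b) xs"
      by (rule free_module_expand[OF cr sF[OF x] xs(2)])
    then have "x = p (msum ?F (\<lambda>b. s x b \<odot>\<^bsub>?F\<^esub> unit_vec R b) xs)" using sp(3)[OF x] by simp
    also have "\<dots> = msum P (\<lambda>b. p (s x b \<odot>\<^bsub>?F\<^esub> unit_vec R b)) xs"
      by (rule msum_hom[OF sp(2) mF mP]) (rule F.smult_closed[OF sR[OF x] e])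
    also have "\<dots> = msum P (\<lambda>b. s x b \<odot>\<^bsub>P\<^esub> p (unit_vec R b)) xs"
      by (rule msum_cong) (rule mh_smult[OF sp(2) sR[OF x] e])
    finally show ?thesis by simp
  qed
  moreover have "set ?L \<subseteq> dual R P \<times> carrier P" using coord mh_closed[OF sp(2) e] by auto
  ultimately show ?thesis unfolding fdb_def using mP by blast
qed

text \<open>The map \<open>1 - r\<close> vanishes on the kernel of \<open>e\<close>, hence factors
  through \<open>M\<close> and gives a section of \<open>e\<close>.\<close>

lemma projective_quotient:
  fixes P M :: "('a, 'm) module"
  assumes P: "projective R P" and M: "module R M"
    and e: "e \<in> module_hom R P M" "e ` carrier P = carrier M"
    and r: "r \<in> module_hom R P (P\<lparr>carrier := a_kernel P M e\<rparr>)" "\<And>y. y \<in> a_kernel P M e \<Longrightarrow> r y = y"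
  shows "projective R M"
proof -
  note mP = projective_module[OF P]
  interpret P: module R P by (rule mP)
  interpret M: module R M by (rule M)
  have rP: "r \<in> module_hom R P P" by (rule mh_from_sub[OF r(1)]) (auto simp: a_kernel_def')
  have er: "e (r x) = \<zero>\<^bsub>M\<^esub>" if "x \<in> carrier P" for x
    using mh_closed[OF r(1) that] by (simp add: a_kernel_def')
  have q: "(\<lambda>x. x \<ominus>\<^bsub>P\<^esub> r x) \<in> module_hom R P P" by (rule mh_diff_fun[OF mh_id rP mP mP])
  have "\<exists>x \<in> carrier P. e x = y" if "y \<in> carrier M" for y using that unfolding e(2)[symmetric] by blast
  then obtain \<sigma> where \<sigma>: "\<And>y. y \<in> carrier M \<Longrightarrow> \<sigma> y \<in> carrier P" "\<And>y. y \<in> carrier M \<Longrightarrow> e (\<sigma> y) = y"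
    by metis
  \<comment> \<open>Defined with arbitrary preimages; \<open>se\<close> shows independence of the
    choice, which makes \<open>s\<close> linear.\<close>
  define s where "s y = \<sigma> y \<ominus>\<^bsub>P\<^esub> r (\<sigma> y)" for y
  have se: "s (e x) = x \<ominus>\<^bsub>P\<^esub> r x" if x: "x \<in> carrier P" for x
  proof -
    have ex: "e x \<in> carrier M" by (rule mh_closed[OF e(1) x])
    let ?t = "x \<ominus>\<^bsub>P\<^esub> \<sigma> (e x)"
    have t: "?t \<in> carrier P" using x \<sigma>(1)[OF ex] by (rule P.M.minus_closed)
    have "e ?t = \<zero>\<^bsub>M\<^esub>"
      using mh_diff[OF e(1) mP M x \<sigma>(1)[OF ex]] \<sigma>(2)[OF ex] ex by (simp add: a_minus_def M.M.r_neg)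
    then have "r ?t = ?t" using t by (intro r(2)) (simp add: a_kernel_def')
    then have 0: "?t \<ominus>\<^bsub>P\<^esub> r ?t = \<zero>\<^bsub>P\<^esub>" using t by (simp add: a_minus_def P.M.r_neg)
    have "x = \<sigma> (e x) \<oplus>\<^bsub>P\<^esub> ?t"
      using x \<sigma>(1)[OF ex] by (simp add: a_minus_def P.M.a_lcomm[of "\<sigma> (e x)" x] P.M.r_neg)
    then have "x \<ominus>\<^bsub>P\<^esub> r x = (\<sigma> (e x) \<ominus>\<^bsub>P\<^esub> r (\<sigma> (e x))) \<oplus>\<^bsub>P\<^esub> (?t \<ominus>\<^bsub>P\<^esub> r ?t)"
      using mh_add[OF q \<sigma>(1)[OF ex] t] by simp
    also have "\<dots> = s (e x)"
      unfolding 0 s_def using mh_closed[OF q \<sigma>(1)[OF ex]] by (rule P.M.r_zero)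
    finally show ?thesis by simp
  qed
  have surj: "\<exists>x \<in> carrier P. y = e x" if "y \<in> carrier M" for y using that unfolding e(2)[symmetric] by blast
  have s: "s \<in> module_hom R M P"
  proof (rule module_homI)
    fix y assume "y \<in> carrier M"
    then obtain x where x: "x \<in> carrier P" "y = e x" by (rule bexE[OF surj])
    show "s y \<in> carrier P" unfolding x(2) se[OF x(1)] by (rule mh_closed[OF q x(1)])
    fix y' assume "y' \<in> carrier M"
    then obtain x' where x': "x' \<in> carrier P" "y' = e x'" by (rule bexE[OF surj])
    show "s (y \<oplus>\<^bsub>M\<^esub> y') = s y \<oplus>\<^bsub>P\<^esub> s y'"
      unfolding x(2) x'(2) mh_add[OF e(1) x(1) x'(1), symmetric] se[OF x(1)] se[OF x'(1)]
        se[OF P.M.a_closed[OF x(1) x'(1)]] by (rule mh_add[OF q x(1) x'(1)])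
  next
    fix a y assume a: "a \<in> carrier R" and y: "y \<in> carrier M"
    obtain x where x: "x \<in> carrier P" "y = e x" by (rule bexE[OF surj[OF y]])
    show "s (a \<odot>\<^bsub>M\<^esub> y) = a \<odot>\<^bsub>P\<^esub> s y"
      unfolding x(2) mh_smult[OF e(1) a x(1), symmetric] se[OF x(1)] se[OF P.smult_closed[OF a x(1)]]
      by (rule mh_smult[OF q a x(1)])
  qed
  have "e (s y) = y" if y: "y \<in> carrier M" for y
  proof -
    obtain x where x: "x \<in> carrier P" "y = e x" by (rule bexE[OF surj[OF y]])
    show ?thesis
      unfolding x(2) se[OF x(1)]
      using mh_diff[OF e(1) mP M x(1) mh_closed[OF rP x(1)]] er[OF x(1)] mh_closed[OF e(1) x(1)]
      by (simp add: a_minus_def neg_zero[OF M])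
  qed
  then show ?thesis by (rule projective_retract[OF P M s e(1)])
qed

lemma module_hom_inverse:
  assumes "module R A" "module R B" "h \<in> module_hom R A B" "bij_betw h (carrier A) (carrier B)"
  shows "the_inv_into (carrier A) h \<in> module_hom R B A"
proof -
  interpret A: module R A by fact
  interpret B: module R B by fact
  have inj: "inj_on h (carrier A)" and im: "h ` carrier A = carrier B"
    using assms(4) by (auto simp: bij_betw_def)
  let ?k = "the_inv_into (carrier A) h"
  have kh: "?k (h x) = x" if "x \<in> carrier A" for x by (rule the_inv_into_f_f[OF inj that])
  show ?thesis
  proof (rule module_homI)
    fix y assume "y \<in> carrier B"
    then obtain x where x: "x \<in> carrier A" "y = h x" using im by blast
    show "?k y \<in> carrier A" using x kh by simp
    fix y' assume "y' \<in> carrier B"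
    then obtain x' where x': "x' \<in> carrier A" "y' = h x'" using im by blast
    show "?k (y \<oplus>\<^bsub>B\<^esub> y') = ?k y \<oplus>\<^bsub>A\<^esub> ?k y'"
      using x x' kh by (simp add: mh_add[OF assms(3), symmetric])
  next
    fix r y assume r: "r \<in> carrier R" and "y \<in> carrier B"
    then obtain x where x: "x \<in> carrier A" "y = h x" using im by blast
    show "?k (r \<odot>\<^bsub>B\<^esub> y) = r \<odot>\<^bsub>A\<^esub> ?k y"
      using x r kh by (simp add: mh_smult[OF assms(3), symmetric])
  qed
qed

section \<open>Syzygies\<close>

text \<open>The syzygy is kept as a kernel with the operations of \<open>P 0\<close>, so passing to
  syzygies never leaves the type \<open>'m\<close>.\<close>

lemma resolution_shift:
  assumes "resolution R P d e M"
  shows "resolution R (\<lambda>i. P (Suc i)) (\<lambda>i. d (Suc i)) (d 0) (P 0\<lparr>carrier := a_kernel (P 0) M e\<rparr>)"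
proof -
  note D = resolutionD[OF assms]
  have "d 0 \<in> module_hom R (P (Suc 0)) (P 0\<lparr>carrier := a_kernel (P 0) M e\<rparr>)"
    by (rule mh_into[OF D(3)]) (use D(6) in blast)
  moreover have "a_kernel (P (Suc 0)) (P 0\<lparr>carrier := a_kernel (P 0) M e\<rparr>) (d 0) =
      a_kernel (P (Suc 0)) (P 0) (d 0)" by (simp add: a_kernel_def')
  ultimately show ?thesis
    unfolding resolution_def using module_a_kernel[OF D(4) D(2) D(1)] D by simp
qed

lemma resolution_splice:
  assumes P: "resolution R P d e (F\<lparr>carrier := a_kernel F M g\<rparr>)"
    and F: "module R F" and M: "module R M"
    and g: "g \<in> module_hom R F M" "g ` carrier F = carrier M"
  shows "resolution R (case_nat F P) (case_nat e d) g M"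
proof -
  note D = resolutionD[OF P]
  have e: "e \<in> module_hom R (P 0) F"
    by (rule mh_from_sub[OF D(4)]) (auto simp: a_kernel_def')
  have k: "a_kernel (P 0) (F\<lparr>carrier := a_kernel F M g\<rparr>) e = a_kernel (P 0) F e"
    by (simp add: a_kernel_def')
  show ?thesis
    unfolding resolution_def
  proof (intro conjI allI)
    show "module R M" "g \<in> module_hom R (case_nat F P 0) M" "g ` carrier (case_nat F P 0) = carrier M"
      using M g by auto
    show "case_nat e d 0 ` carrier (case_nat F P 1) = a_kernel (case_nat F P 0) M g"
      using D(5) by simp
    fix i
    show "module R (case_nat F P i)" using F D(2) by (cases i) auto
    show "case_nat e d i \<in> module_hom R (case_nat F P (Suc i)) (case_nat F P i)"
      using e D(3) by (cases i) auto
    show "case_nat e d (Suc i) ` carrier (case_nat F P (Suc (Suc i))) =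
      a_kernel (case_nat F P (Suc i)) (case_nat F P i) (case_nat e d i)"
      using D(6,7) k by (cases i) auto
  qed
qed

text \<open>For \<open>k = 0\<close> the truncated \<open>k - 1\<close> is again 0, which is correct
  because the syzygy is then zero.\<close>

lemma resolution_of_length_shift:
  assumes "resolution_of_length R k P d e M"
  shows "resolution_of_length R (k - 1) (\<lambda>i. P (Suc i)) (\<lambda>i. d (Suc i)) (d 0)
    (P 0\<lparr>carrier := a_kernel (P 0) M e\<rparr>)"
  using assms resolution_shift unfolding resolution_of_length_def by auto

lemma resolution_of_length_splice:
  assumes "resolution_of_length R k P d e (F\<lparr>carrier := a_kernel F M g\<rparr>)"
    and "module R F" "module R M" "g \<in> module_hom R F M" "g ` carrier F = carrier M"
  shows "resolution_of_length R (Suc k) (case_nat F P) (case_nat e d) g M"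
  using assms resolution_splice[OF _ assms(2-5)] unfolding resolution_of_length_def
  by (auto split: nat.split)

text \<open>Resolutions are infinite sequences, so \<open>M\<close> is continued by its zero
  submodule; this gives the resolution of length 0 of \<open>M\<close> by itself.\<close>

definition zero_extend :: "('a, 'm) module \<Rightarrow> nat \<Rightarrow> ('a, 'm) module" where
  "zero_extend M i = (if i = 0 then M else M\<lparr>carrier := {\<zero>\<^bsub>M\<^esub>}\<rparr>)"

lemma resolution_zero_extend:
  assumes "module R M"
  shows "resolution_of_length R 0 (zero_extend M) (\<lambda>i x. \<zero>\<^bsub>M\<^esub>) (\<lambda>x. x) M"
proof -
  interpret M: module R M by fact
  have sub: "submodule {\<zero>\<^bsub>M\<^esub>} R M"
    by (rule M.submoduleI) (auto simp: neg_zero[OF assms])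
  have m: "module R (zero_extend M i)" for i
    using submodule_module[OF assms sub] assms by (simp add: zero_extend_def)
  have z: "\<zero>\<^bsub>zero_extend M i\<^esub> = \<zero>\<^bsub>M\<^esub>" for i by (simp add: zero_extend_def)
  have d: "(\<lambda>x. \<zero>\<^bsub>M\<^esub>) \<in> module_hom R (zero_extend M (Suc i)) (zero_extend M i)" for i
    using mh_zero_fun[OF m[of "Suc i"] m[of i]] unfolding z .
  show ?thesis
    unfolding resolution_of_length_def resolution_def
    using assms m d mh_id by (auto simp: zero_extend_def a_kernel_def' )
qed

text \<open>All indices are constrained, not just \<open>i \<le> k\<close>, which makes the notion
  stable under shifting. Zero modules are finitely generated projective, so \<open>FPR\<close> is
  unaffected.\<close>

definition fg_resolution :: "('a, 'r) ring_scheme \<Rightarrow> nat \<Rightarrow> (nat \<Rightarrow> ('a, 'm) module) \<Rightarrow>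
    (nat \<Rightarrow> 'm \<Rightarrow> 'm) \<Rightarrow> ('m \<Rightarrow> 'm) \<Rightarrow> ('a, 'm) module \<Rightarrow> bool" where
  "fg_resolution R k P d e M \<longleftrightarrow> resolution_of_length R k P d e M \<and>
     (\<forall>i. fin_gen R (P i) \<and> projective R (P i))"

lemma resolution_of_length_module: "resolution_of_length R k P d e M \<Longrightarrow> module R (P i)"
  by (simp add: resolution_of_length_def resolution_def)

lemma projective_everywhere:
  assumes "resolution_of_length R k P d e M" "\<And>i. i \<le> k \<Longrightarrow> projective R (P i)"
  shows "projective R (P i)"
  using assms zero_module_projective[OF resolution_of_length_module[OF assms(1), of i]]
  by (cases "i \<le> k") (auto simp: resolution_of_length_def)

lemma FPR_iff:
  fixes M :: "('a, 'm) module"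
  shows "M \<in> FPR R \<longleftrightarrow> (\<exists>k (P :: nat \<Rightarrow> ('a, 'm) module) d e. fg_resolution R k P d e M)"
proof -
  have "fin_gen R (P i)" if "resolution_of_length R k P d e M" "\<And>i. i \<le> k \<Longrightarrow> fin_gen R (P i)"
    for k d e and P :: "nat \<Rightarrow> ('a, 'm) module" and i
    using that fin_gen_zero_module[OF resolution_of_length_module[OF that(1), of i]]
    by (cases "i \<le> k") (auto simp: resolution_of_length_def)
  then show ?thesis
    unfolding FPR_def fg_resolution_def using projective_everywhere by (auto, blast+)
qed

lemma fg_resolutionD:
  assumes "fg_resolution R k P d e M"
  shows "resolution R P d e M" "projective R (P i)" "fin_gen R (P i)" "module R (P i)" "module R M"
    "i > k \<Longrightarrow> carrier (P i) = {\<zero>\<^bsub>P i\<^esub>}"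
  using assms by (auto simp: fg_resolution_def resolution_of_length_def resolution_def)

lemma fg_resolution_shift:
  assumes "fg_resolution R k P d e M"
  shows "fg_resolution R (k - 1) (\<lambda>i. P (Suc i)) (\<lambda>i. d (Suc i)) (d 0)
    (P 0\<lparr>carrier := a_kernel (P 0) M e\<rparr>)"
  using assms resolution_of_length_shift unfolding fg_resolution_def by blast

lemma tor_vanish_shift:
  "tor_vanish R (\<lambda>i. P (Suc i)) (\<lambda>i. d (Suc i)) M j \<longleftrightarrow> tor_vanish R P d M (Suc j)"
  by (simp add: tor_vanish_def)

lemma ext_vanish_shift:
  "ext_vanish R (\<lambda>i. P (Suc i)) (\<lambda>i. d (Suc i)) M j \<longleftrightarrow> ext_vanish R P d M (Suc j)"
  by (simp add: ext_vanish_def)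

lemma ext_vanish_short:
  assumes "resolution_of_length R k P d e M" "k \<le> j" "module R N"
  shows "ext_vanish R P d N j"
  unfolding ext_vanish_def
proof (intro ballI impI)
  fix f assume f: "f \<in> module_hom R (P (Suc j)) N"
  have res: "resolution R P d e M" and z: "carrier (P (Suc j)) = {\<zero>\<^bsub>P (Suc j)\<^esub>}"
    using assms by (auto simp: resolution_of_length_def)
  note D = resolutionD[OF res]
  have "f x = \<zero>\<^bsub>N\<^esub>" if "x \<in> carrier (P (Suc j))" for x
    using that z mh_zero[OF f D(2) assms(3)] by simp
  then show "\<exists>g\<in>module_hom R (P j) N. \<forall>x\<in>carrier (P (Suc j)). f x = g (d j x)"
    by (intro bexI[OF _ mh_zero_fun[OF D(2) assms(3)]]) auto
qed

lemma tor_vanish_short: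
  assumes "resolution_of_length R k P d e N" "k \<le> j" "module R M"
  shows "tor_vanish R P d M j"
proof (rule tor_vanishI)
  fix u assume u: "set u \<subseteq> carrier (P (Suc j)) \<times> carrier M"
  interpret M: module R M by fact
  have res: "resolution R P d e N" and z: "carrier (P (Suc j)) = {\<zero>\<^bsub>P (Suc j)\<^esub>}"
    using assms by (auto simp: resolution_of_length_def)
  note D = resolutionD[OF res]
  have "contract M f u = \<zero>\<^bsub>M\<^esub>" if f: "f \<in> dual R (P (Suc j))" for f
    unfolding contract_def
    by (rule msum_zero[OF assms(3)])
      (use u z mh_zero[OF f D(2) module_regular[OF M.is_cring]] in auto)
  then show "\<exists>v. set v \<subseteq> carrier (P (Suc (Suc j))) \<times> carrier M \<and>
      (\<forall>f\<in>dual R (P (Suc j)). contract M (\<lambda>x. f (d (Suc j) x)) v = contract M f u)"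
    by (intro exI[of _ "[]"]) auto
qed

section \<open>FT-flat resolutions\<close>

text \<open>Frees FT-flatness from the chosen resolution in \<open>Tor\<close>: any finite
  resolution by finitely generated projectives may serve.\<close>

lemma FT_flat_iff:
  fixes F :: "('a, 'm) module"
  shows "FT_flat R F \<longleftrightarrow> module R F \<and> (\<forall>k (P :: nat \<Rightarrow> ('a, 'm) module) d e N.
     fg_resolution R k P d e N \<longrightarrow> tor_vanish R P d F 0)"
  unfolding FT_flat_def
proof (intro conj_cong refl)
  assume F: "module R F"
  have "trivial_group (Tor R 1 N F) \<longleftrightarrow> tor_vanish R P d F 0"
    if "fg_resolution R k P d e N" for k d e N and P :: "nat \<Rightarrow> ('a, 'm) module"
    using trivial_Tor_iff[OF fg_resolutionD(1,2)[OF that] F, of 0] by simp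
  then show "(\<forall>N\<in>FPR R :: ('a, 'm) module set. trivial_group (Tor R 1 N F)) \<longleftrightarrow>
    (\<forall>k (P :: nat \<Rightarrow> ('a, 'm) module) d e N. fg_resolution R k P d e N \<longrightarrow> tor_vanish R P d F 0)"
    unfolding Ball_def FPR_iff by blast
qed

text \<open>Tor of \<open>N\<close> in degree \<open>j + 1\<close> is Tor in degree 1 of the
  \<open>j\<close>-th syzygy of \<open>N\<close>, which again belongs to \<open>FPR\<close>.\<close>

lemma FT_flat_tor_vanish:
  fixes F N :: "('a, 'm) module"
  assumes F: "FT_flat R F" and N: "fg_resolution R k P d e N"
  shows "tor_vanish R P d F j"
  using N
proof (induction j arbitrary: k P d e N)
  case 0
  then show ?case using F unfolding FT_flat_iff by blast
next
  case (Suc j)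
  show ?case using Suc.IH[OF fg_resolution_shift[OF Suc.prems]] unfolding tor_vanish_shift .
qed

lemma ldb_tor_vanish_fg:
  assumes "fg_resolution R k P d e N" "ldb R F"
  shows "tor_vanish R P d F j"
proof -
  note D = resolutionD[OF fg_resolutionD(1)[OF assms(1)]]
  show ?thesis
    by (rule ldb_tor_vanish[where P = P and d = d and j = j, OF projective_ldb[OF fg_resolutionD(2)[OF assms(1)]] D(2) D(2) D(3) D(3) _ assms(2)])
      (simp add: D(7))
qed

lemma ldb_FT_flat: "ldb R F \<Longrightarrow> FT_flat R F"
  unfolding FT_flat_iff using ldb_tor_vanish_fg ldb_module by blast

lemma tor_vanish_step_down:
  assumes P: "fg_resolution R k P d e N"
    and F: "module R F" and M: "module R M" and g: "g \<in> module_hom R F M" "g ` carrier F = carrier M"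
    and "tor_vanish R P d (F\<lparr>carrier := a_kernel F M g\<rparr>) j" "tor_vanish R P d F (Suc j)"
  shows "tor_vanish R P d M (Suc j)"
proof -
  note D = fg_resolutionD[OF P]
  show ?thesis
    by (rule tor_vanish_down[OF projective_ldb[OF D(2)] resolutionD(3)[OF D(1)]
          resolution_dd(2)[OF D(1)] F M g assms(6,7)])
qed

lemma tor_vanish_step_up:
  assumes P: "fg_resolution R k P d e N"
    and F: "module R F" and M: "module R M" and g: "g \<in> module_hom R F M" "g ` carrier F = carrier M"
    and "tor_vanish R P d M (Suc j)" "tor_vanish R P d F j"
  shows "tor_vanish R P d (F\<lparr>carrier := a_kernel F M g\<rparr>) j"
proof -
  note D = fg_resolutionD[OF P]
  show ?thesis
    by (rule tor_vanish_up[OF projective_ldb[OF D(2)] resolutionD(3)[OF D(1)]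
          resolution_dd(2)[OF D(1)] F M g assms(6,7)])
qed

text \<open>A resolution of length 0 is an isomorphism \<open>F 0 -> M\<close>. Since
  \<open>M\<close> may lie outside \<open>'m\<close>, flatness is transported as
  \<open>tor_vanish\<close> and not as \<open>FT_flat\<close>.\<close>

lemma tor_vanish_length_0:
  fixes F P :: "nat \<Rightarrow> ('a, 'm) module" and M :: "('a, 'b) module"
  assumes F: "resolution_of_length R 0 F d' e' M" "FT_flat R (F 0)" and P: "fg_resolution R k P d e N"
  shows "tor_vanish R P d M j"
proof -
  have res: "resolution R F d' e' M" and z: "carrier (F (Suc 0)) = {\<zero>\<^bsub>F (Suc 0)\<^esub>}"
    using F(1) by (auto simp: resolution_of_length_def)
  note D = resolutionD[OF res] and PD = resolutionD[OF fg_resolutionD(1)[OF P]]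
  interpret F0: module R "F 0" by (rule D(2))
  interpret M: module R M by (rule D(1))
  have ker: "a_kernel (F 0) M e' = {\<zero>\<^bsub>F 0\<^esub>}"
    unfolding D(6)[symmetric] z using mh_zero[OF D(3) D(2) D(2)] by simp
  have "inj_on e' (carrier (F 0))"
  proof (rule inj_onI)
    fix x y assume x: "x \<in> carrier (F 0)" and y: "y \<in> carrier (F 0)" and "e' x = e' y"
    then have "e' (x \<ominus>\<^bsub>F 0\<^esub> y) = \<zero>\<^bsub>M\<^esub>"
      using mh_diff[OF D(4) D(2) D(1) x y] mh_closed[OF D(4) y] by (simp add: a_minus_def M.M.r_neg)
    then have "x \<ominus>\<^bsub>F 0\<^esub> y \<in> a_kernel (F 0) M e'"
      using F0.M.minus_closed[OF x y] by (simp add: a_kernel_def')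
    then show "x = y" unfolding ker using x y
      by (metis F0.M.a_inv_closed F0.M.minus_equality F0.M.minus_minus a_minus_def singletonD)
  qed
  then have bij: "bij_betw e' (carrier (F 0)) (carrier M)" using D(5) by (simp add: bij_betw_def)
  show ?thesis
  proof (rule tor_vanish_iso[OF FT_flat_tor_vanish[OF F(2) P] PD(2) PD(3) D(2) D(1) D(4)
        module_hom_inverse[OF D(2) D(1) D(4) bij]])
    fix y assume "y \<in> carrier M"
    then show "e' (the_inv_into (carrier (F 0)) e' y) = y"
      using f_the_inv_into_f_bij_betw[OF bij] by simp
  qed
qed

lemma tor_vanish_length_Suc:
  fixes F P :: "nat \<Rightarrow> ('a, 'm) module" and M :: "('a, 'b) module"
  assumes F: "resolution_of_length R n F d' e' M" "FT_flat R (F 0)" and P: "fg_resolution R k P d e N"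
    and K: "tor_vanish R P d (F 0\<lparr>carrier := a_kernel (F 0) M e'\<rparr>) j"
  shows "tor_vanish R P d M (Suc j)"
proof -
  have D: "resolution R F d' e' M" using F(1) by (simp add: resolution_of_length_def)
  note RD = resolutionD[OF D]
  show ?thesis
    by (rule tor_vanish_step_down[OF P RD(2) RD(1) RD(4) RD(5) K FT_flat_tor_vanish[OF F(2) P]])
qed

lemma tor_vanish_FT_resolution:
  fixes F P :: "nat \<Rightarrow> ('a, 'm) module" and M :: "('a, 'b) module"
  assumes F: "resolution_of_length R n F d' e' M" "\<And>i. i \<le> n \<Longrightarrow> FT_flat R (F i)"
    and P: "fg_resolution R k P d e N" and j: "n \<le> j"
  shows "tor_vanish R P d M j"
proof -
  \<comment> \<open>The induction runs inside \<open>'m\<close>; only the module that is resolved may have another type.\<close>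
  have *: "tor_vanish R P d M j" if "resolution_of_length R n F d' e' M"
    "\<And>i. i \<le> n \<Longrightarrow> FT_flat R (F i)" "n \<le> j"
    for n j d' e' and F :: "nat \<Rightarrow> ('a, 'm) module" and M :: "('a, 'm) module"
    using that
  proof (induction n arbitrary: F d' e' M j)
    case 0
    show ?case by (rule tor_vanish_length_0[OF 0(1) 0(2)[OF order_refl] P])
  next
    case (Suc n)
    then obtain i where i: "j = Suc i" "n \<le> i" by (cases j) auto
    show ?case
      unfolding i(1)
      by (rule tor_vanish_length_Suc[OF Suc.prems(1) Suc.prems(2)[OF le0] P], rule Suc.IH[OF _ _ i(2)])
        (use resolution_of_length_shift[OF Suc.prems(1)] Suc.prems(2) in auto)
  qed
  show ?thesis
  proof (cases n)
    case 0
    show ?thesis by (rule tor_vanish_length_0[OF F(1)[unfolded 0] F(2)[OF le0] P])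
  next
    case (Suc l)
    then obtain i where i: "j = Suc i" "l \<le> i" using j by (cases j) auto
    show ?thesis
      unfolding i(1)
      by (rule tor_vanish_length_Suc[OF F(1) F(2)[OF le0] P], rule *[OF _ _ i(2)])
        (use resolution_of_length_shift[OF F(1)] F(2) Suc in auto)
  qed
qed

text \<open>In the base case the hypothesis is FT-flatness itself. The covers are asked to have
  local dual bases, which makes them FT-flat and allows the degree shift.\<close>

lemma FT_resolution_exists:
  fixes M :: "('a, 'm) module"
  assumes cover: "\<And>M :: ('a, 'm) module. module R M \<Longrightarrow> \<exists>(F :: ('a, 'm) module) g.
      ldb R F \<and> g \<in> module_hom R F M \<and> g ` carrier F = carrier M"
    and "module R M"
    and "\<And>k (P :: nat \<Rightarrow> ('a, 'm) module) d e N. fg_resolution R k P d e N \<Longrightarrow> tor_vanish R P d M n"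
  shows "\<exists>(F :: nat \<Rightarrow> ('a, 'm) module) d e. resolution_of_length R n F d e M \<and> (\<forall>i \<le> n. FT_flat R (F i))"
  using assms(2,3)
proof (induction n arbitrary: M)
  case 0
  have "FT_flat R M" unfolding FT_flat_iff using 0 by blast
  then have "\<forall>i \<le> 0. FT_flat R (zero_extend M i)" by (simp add: zero_extend_def)
  then show ?case using resolution_zero_extend[OF 0(1)] by blast
next
  case (Suc n)
  obtain F :: "('a, 'm) module" and g where F: "ldb R F" "g \<in> module_hom R F M" "g ` carrier F = carrier M"
    using cover[OF Suc.prems(1)] by blast
  note mF = ldb_module[OF F(1)]
  have "\<exists>(G :: nat \<Rightarrow> ('a, 'm) module) d e.
      resolution_of_length R n G d e (F\<lparr>carrier := a_kernel F M g\<rparr>) \<and> (\<forall>i \<le> n. FT_flat R (G i))"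
  proof (rule Suc.IH[OF module_a_kernel[OF F(2) mF Suc.prems(1)]])
    fix k d e N and P :: "nat \<Rightarrow> ('a, 'm) module"
    assume P: "fg_resolution R k P d e N"
    show "tor_vanish R P d (F\<lparr>carrier := a_kernel F M g\<rparr>) n"
      by (rule tor_vanish_step_up[OF P mF Suc.prems(1) F(2,3) Suc.prems(2)[OF P] ldb_tor_vanish_fg[OF P F(1)]])
  qed
  then obtain G :: "nat \<Rightarrow> ('a, 'm) module" and d e where G:
    "resolution_of_length R n G d e (F\<lparr>carrier := a_kernel F M g\<rparr>)" "\<forall>i \<le> n. FT_flat R (G i)" by blast
  have "\<forall>i \<le> Suc n. FT_flat R (case_nat F G i)"
    using G(2) ldb_FT_flat[OF F(1)] by (auto split: nat.split)
  then show ?case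
    using resolution_of_length_splice[OF G(1) mF Suc.prems(1) F(2,3)] by blast
qed

section \<open>Covers inside the universe\<close>

text \<open>An infinite type absorbs pairs, so finite lists over it can be coded inside it. A
  function of finite support is coded by a list of its graph over the support.\<close>

lemma inj_finite_support:
  fixes \<kappa> :: "'a \<Rightarrow> 'm"
  assumes inf: "infinite (UNIV :: 'm set)" and \<kappa>: "inj_on \<kappa> C"
  shows "\<exists>\<phi> :: ('m \<Rightarrow> 'a) \<Rightarrow> 'm. inj_on \<phi> {f. finite {x. f x \<noteq> z} \<and> (\<forall>x. f x \<in> C)}"
proof -
  have "|UNIV \<times> UNIV :: ('m \<times> 'm) set| \<le>o |UNIV :: 'm set|"
    using card_of_Times_same_infinite[OF inf] ordIso_iff_ordLeq by blast
  then obtain \<pi> :: "'m \<times> 'm \<Rightarrow> 'm" where \<pi>: "inj \<pi>"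
    unfolding card_of_ordLeq[symmetric] by auto
  obtain \<nu> :: "nat \<Rightarrow> 'm" where \<nu>: "inj \<nu>"
    using infinite_countable_subset[OF inf] by blast
  \<comment> \<open>Folding with \<open>\<pi>\<close> separates only lists of equal length;
    therefore \<open>\<phi>\<close> codes the length as well.\<close>
  define enc where "enc xs = foldr (\<lambda>x y. \<pi> (x, y)) xs (\<nu> 0)" for xs
  have enc: "xs = ys" if "length xs = length ys" "enc xs = enc ys" for xs ys
    using that
  proof (induction xs ys rule: list_induct2)
    case (Cons x xs y ys)
    then show ?case using injD[OF \<pi>, of "(x, enc xs)" "(y, enc ys)"] by (simp add: enc_def)
  qed simp
  define graph where "graph f = (\<lambda>x. \<pi> (x, \<kappa> (f x))) ` {x. f x \<noteq> z}" for f
  define lst where "lst f = (SOME xs. set xs = graph f)" for f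
  define \<phi> where "\<phi> f = \<pi> (\<nu> (length (lst f)), enc (lst f))" for f
  have set_lst: "set (lst f) = graph f" if "finite {x. f x \<noteq> z}" for f
  proof -
    have "finite (graph f)" unfolding graph_def using that by (rule finite_imageI)
    then have "\<exists>xs. set xs = graph f" by (rule finite_list)
    then show ?thesis unfolding lst_def by (rule someI_ex)
  qed
  have val: "f x = g x" if gr: "graph f = graph g" and C: "\<forall>x. f x \<in> C" "\<forall>x. g x \<in> C" and "f x \<noteq> z" for f g x
  proof -
    have "\<pi> (x, \<kappa> (f x)) \<in> graph f" unfolding graph_def using that(4) by blast
    then have "\<pi> (x, \<kappa> (f x)) \<in> graph g" unfolding gr .
    then obtain y where "\<pi> (x, \<kappa> (f x)) = \<pi> (y, \<kappa> (g y))" by (auto simp: graph_def)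
    then have "(x, \<kappa> (f x)) = (y, \<kappa> (g y))" by (rule injD[OF \<pi>])
    then have "\<kappa> (f x) = \<kappa> (g x)" by auto
    then show ?thesis using inj_onD[OF \<kappa>] C by blast
  qed
  have "inj_on \<phi> {f. finite {x. f x \<noteq> z} \<and> (\<forall>x. f x \<in> C)}"
  proof (rule inj_onI)
    fix f g assume f: "f \<in> {f. finite {x. f x \<noteq> z} \<and> (\<forall>x. f x \<in> C)}"
      and g: "g \<in> {f. finite {x. f x \<noteq> z} \<and> (\<forall>x. f x \<in> C)}" and eq: "\<phi> f = \<phi> g"
    have "\<pi> (\<nu> (length (lst f)), enc (lst f)) = \<pi> (\<nu> (length (lst g)), enc (lst g))"
      using eq unfolding \<phi>_def .
    then have "(\<nu> (length (lst f)), enc (lst f)) = (\<nu> (length (lst g)), enc (lst g))"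
      by (rule injD[OF \<pi>])
    then have len: "\<nu> (length (lst f)) = \<nu> (length (lst g))" and code: "enc (lst f) = enc (lst g)" by auto
    have "length (lst f) = length (lst g)" by (rule injD[OF \<nu> len])
    then have "lst f = lst g" using code by (rule enc)
    then have gr: "graph f = graph g" using set_lst[of f] set_lst[of g] f g by simp
    have fC: "\<forall>x. f x \<in> C" and gC: "\<forall>x. g x \<in> C" using f g by auto
    show "f = g"
    proof
      fix x
      show "f x = g x"
        using val[OF gr fC gC, of x] val[OF gr[symmetric] gC fC, of x] by metis
    qed
  qed
  then show ?thesis by blast
qed

lemma module_copy:
  fixes A :: "('a, 'x) module" and \<phi> :: "'x \<Rightarrow> 'm"
  assumes A: "module R A" and \<phi>: "inj_on \<phi> (carrier A)"
  obtains B :: "('a, 'm) module" and \<psi> where "module R B" "\<phi> \<in> module_hom R A B" "\<psi> \<in> module_hom R B A"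
    "\<And>x. x \<in> carrier A \<Longrightarrow> \<psi> (\<phi> x) = x" "\<And>y. y \<in> carrier B \<Longrightarrow> \<phi> (\<psi> y) = y"
proof -
  interpret A: module R A by (rule A)
  define \<psi> where "\<psi> = the_inv_into (carrier A) \<phi>"
  have \<psi>\<phi>: "\<psi> (\<phi> x) = x" if "x \<in> carrier A" for x
    unfolding \<psi>_def by (rule the_inv_into_f_f[OF \<phi> that])
  define B :: "('a, 'm) module" where "B = \<lparr>carrier = \<phi> ` carrier A, monoid.mult = (\<lambda>x y. x),
    one = \<phi> \<zero>\<^bsub>A\<^esub>, ring.zero = \<phi> \<zero>\<^bsub>A\<^esub>, add = (\<lambda>x y. \<phi> (\<psi> x \<oplus>\<^bsub>A\<^esub> \<psi> y)),
    smult = (\<lambda>r x. \<phi> (r \<odot>\<^bsub>A\<^esub> \<psi> x))\<rparr>"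
  have B: "carrier B = \<phi> ` carrier A" "\<zero>\<^bsub>B\<^esub> = \<phi> \<zero>\<^bsub>A\<^esub>"
    "\<And>x y. x \<oplus>\<^bsub>B\<^esub> y = \<phi> (\<psi> x \<oplus>\<^bsub>A\<^esub> \<psi> y)" "\<And>r x. r \<odot>\<^bsub>B\<^esub> x = \<phi> (r \<odot>\<^bsub>A\<^esub> \<psi> x)"
    by (simp_all add: B_def)
  have "module R B"
  proof (rule moduleI)
    show "abelian_group B"
    proof (rule abelian_groupI)
      fix x assume "x \<in> carrier B"
      then obtain a where a: "a \<in> carrier A" "x = \<phi> a" by (auto simp: B)
      have "\<phi> (\<ominus>\<^bsub>A\<^esub> a) \<in> carrier B" "\<phi> (\<ominus>\<^bsub>A\<^esub> a) \<oplus>\<^bsub>B\<^esub> x = \<zero>\<^bsub>B\<^esub>"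
        using a by (simp_all add: B \<psi>\<phi> A.M.l_neg)
      then show "\<exists>y\<in>carrier B. y \<oplus>\<^bsub>B\<^esub> x = \<zero>\<^bsub>B\<^esub>" by blast
    qed (auto simp: B \<psi>\<phi> A.M.a_ac)
  qed (auto simp: B \<psi>\<phi> A.is_cring A.smult_l_distr A.smult_r_distr A.smult_assoc1)
  moreover have "\<phi> \<in> module_hom R A B" by (rule module_homI) (auto simp: B \<psi>\<phi>)
  moreover have "\<psi> \<in> module_hom R B A" by (rule module_homI) (auto simp: B \<psi>\<phi>)
  moreover have "\<phi> (\<psi> y) = y" if "y \<in> carrier B" for y using that \<psi>\<phi> by (auto simp: B)
  ultimately show thesis using that \<psi>\<phi> by blast
qed

text \<open>Lists that repeat a single element already have infinitely many images, so the universe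
  is infinite even over a finite ring.\<close>

lemma universe_infinite:
  fixes \<iota> :: "'a list \<Rightarrow> 'm"
  assumes "inj_on \<iota> (lists C)" "c \<in> C"
  shows "infinite (UNIV :: 'm set)" "inj_on (\<lambda>x. \<iota> [x]) C"
proof -
  have "inj (\<lambda>n. \<iota> (replicate n c))"
  proof (rule injI)
    fix i j assume "\<iota> (replicate i c) = \<iota> (replicate j c)"
    then have "replicate i c = replicate j c"
      by (rule inj_onD[OF assms(1)]) (use assms(2) in auto)
    then show "i = j" by (metis length_replicate)
  qed
  then show "infinite (UNIV :: 'm set)" using finite_imageD infinite_UNIV_nat finite_subset subset_UNIV by metis
  show "inj_on (\<lambda>x. \<iota> [x]) C"
  proof (rule inj_onI)
    fix x y assume "x \<in> C" "y \<in> C" "\<iota> [x] = \<iota> [y]"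
    then show "x = y" using inj_onD[OF assms(1), of "[x]" "[y]"] by auto
  qed
qed

text \<open>The free module on \<open>carrier M\<close> lives in a function type; its elements have
  finite support, so a copy fits into \<open>'m\<close> and inherits local dual bases.\<close>

lemma ldb_cover_exists:
  fixes M :: "('a, 'm) module" and \<kappa> :: "'a \<Rightarrow> 'm"
  assumes inf: "infinite (UNIV :: 'm set)" and \<kappa>: "inj_on \<kappa> (carrier R)" and M: "module R M"
  shows "\<exists>(F :: ('a, 'm) module) g. ldb R F \<and> g \<in> module_hom R F M \<and> g ` carrier F = carrier M"
proof -
  interpret M: module R M by (rule M)
  note cr = M.is_cring
  let ?F = "free_module R (carrier M)"
  note mF = module_free_module[OF cr, of "carrier M"]
  obtain \<phi> :: "('m \<Rightarrow> 'a) \<Rightarrow> 'm" where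
    "inj_on \<phi> {f. finite {x. f x \<noteq> \<zero>\<^bsub>R\<^esub>} \<and> (\<forall>x. f x \<in> carrier R)}"
    using inj_finite_support[OF inf \<kappa>] by blast
  moreover have "carrier ?F \<subseteq> {f. finite {x. f x \<noteq> \<zero>\<^bsub>R\<^esub>} \<and> (\<forall>x. f x \<in> carrier R)}"
  proof
    fix f assume f: "f \<in> carrier ?F"
    show "f \<in> {f. finite {x. f x \<noteq> \<zero>\<^bsub>R\<^esub>} \<and> (\<forall>x. f x \<in> carrier R)}"
      using free_module_value[OF cr f] f by (simp add: carrier_free_module)
  qed
  ultimately have "inj_on \<phi> (carrier ?F)" by (rule inj_on_subset)
  then obtain F :: "('a, 'm) module" and \<psi> where F: "module R F" "\<phi> \<in> module_hom R ?F F"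
    "\<psi> \<in> module_hom R F ?F" "\<And>x. x \<in> carrier ?F \<Longrightarrow> \<psi> (\<phi> x) = x" "\<And>y. y \<in> carrier F \<Longrightarrow> \<phi> (\<psi> y) = y"
    by (rule module_copy[OF mF]) blast
  have ldb: "ldb R F" by (rule ldb_retract[OF ldb_free_module[OF cr] F(1) F(3) F(2)]) (rule F(5))
  obtain g where g: "g \<in> module_hom R ?F M" "\<forall>f \<in> carrier ?F. \<forall>xs. distinct xs \<longrightarrow>
      set xs = {x. f x \<noteq> \<zero>\<^bsub>R\<^esub>} \<longrightarrow> g f = msum M (\<lambda>b. f b \<odot>\<^bsub>M\<^esub> b) xs"
    using free_module_hom[OF M, of "carrier M" "\<lambda>b. b"] by auto
  have gu: "g (unit_vec R b) = b" if b: "b \<in> carrier M" for b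
  \<comment> \<open>In the zero ring a unit vector has empty support, and every element of
    \<open>M\<close> is zero.\<close>
  proof (cases "\<one>\<^bsub>R\<^esub> = \<zero>\<^bsub>R\<^esub>")
    case True
    then have "\<one>\<^bsub>R\<^esub> \<odot>\<^bsub>M\<^esub> b = \<zero>\<^bsub>R\<^esub> \<odot>\<^bsub>M\<^esub> b" by simp
    then have b0: "b = \<zero>\<^bsub>M\<^esub>" using b by simp
    have "set [] = {x. unit_vec R b x \<noteq> \<zero>\<^bsub>R\<^esub>}" using True by (simp add: unit_vec_def)
    then have "g (unit_vec R b) = msum M (\<lambda>c. unit_vec R b c \<odot>\<^bsub>M\<^esub> c) []"
      using bspec[OF g(2) unit_vec_closed[OF cr b]] by (elim allE[of _ "[]"]) simp
    then show ?thesis using b0 by simp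
  next
    case False
    then have "set [b] = {x. unit_vec R b x \<noteq> \<zero>\<^bsub>R\<^esub>}" by (auto simp: unit_vec_def)
    then have "g (unit_vec R b) = msum M (\<lambda>c. unit_vec R b c \<odot>\<^bsub>M\<^esub> c) [b]"
      using bspec[OF g(2) unit_vec_closed[OF cr b]] by (elim allE[of _ "[b]"]) simp
    then show ?thesis using b by (simp add: unit_vec_def)
  qed
  have "(\<lambda>x. g (\<psi> x)) ` carrier F = carrier M"
  proof (intro equalityI subsetI)
    fix y assume "y \<in> (\<lambda>x. g (\<psi> x)) ` carrier F"
    then show "y \<in> carrier M" using mh_closed[OF g(1) mh_closed[OF F(3)]] by blast
  next
    fix y assume y: "y \<in> carrier M"
    note e = unit_vec_closed[OF cr y]
    have "y = g (\<psi> (\<phi> (unit_vec R y)))" using F(4)[OF e] gu[OF y] by simp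
    then show "y \<in> (\<lambda>x. g (\<psi> x)) ` carrier F" using mh_closed[OF F(2) e] by blast
  qed
  then show ?thesis using ldb mh_comp[OF g(1) F(3)] by blast
qed

text \<open>Moves the resolved module to another type while the resolving modules stay where they
  are.\<close>

lemma resolution_iso:
  assumes P: "resolution R P d e A" and B: "module R B"
    and "\<phi> \<in> module_hom R B A" and \<psi>: "\<psi> \<in> module_hom R A B"
    and "\<And>x. x \<in> carrier B \<Longrightarrow> \<psi> (\<phi> x) = x" and \<phi>\<psi>: "\<And>y. y \<in> carrier A \<Longrightarrow> \<phi> (\<psi> y) = y"
  shows "resolution R P d (\<lambda>x. \<psi> (e x)) B"
proof -
  note D = resolutionD[OF P]
  have "\<psi> ` carrier A = carrier B"
  proof (intro equalityI subsetI)
    fix y assume "y \<in> carrier B"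
    then show "y \<in> \<psi> ` carrier A" using assms(5) mh_closed[OF assms(3)] by (metis imageI)
  qed (use mh_closed[OF \<psi>] in blast)
  then have im: "(\<lambda>x. \<psi> (e x)) ` carrier (P 0) = carrier B"
    using D(5) by (metis image_image)
  have "\<psi> (e x) = \<zero>\<^bsub>B\<^esub> \<longleftrightarrow> e x = \<zero>\<^bsub>A\<^esub>" if "x \<in> carrier (P 0)" for x
    using \<phi>\<psi>[OF mh_closed[OF D(4) that]] mh_zero[OF assms(3) B D(1)] mh_zero[OF \<psi> D(1) B] by metis
  then have "a_kernel (P 0) B (\<lambda>x. \<psi> (e x)) = a_kernel (P 0) A e" by (auto simp: a_kernel_def')
  then show ?thesis
    using P im B mh_comp[OF \<psi> D(4)] by (simp add: resolution_def)
qed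

section \<open>Quotients by ideals\<close>

lemma quotient_module_simps:
  "carrier (quotient_module R I) = a_rcosets\<^bsub>R\<^esub> I"
  "add (quotient_module R I) = set_add R" "\<zero>\<^bsub>quotient_module R I\<^esub> = I"
  "r \<odot>\<^bsub>quotient_module R I\<^esub> C = rcoset_mult R I (I +>\<^bsub>R\<^esub> r) C"
  by (simp_all add: quotient_module_def FactRing_def)

lemma module_quotient_module:
  assumes "cring R" "ideal I R" shows "module R (quotient_module R I)"
proof -
  interpret cring R by fact
  interpret I: ideal I R by fact
  interpret Q: cring "R Quot I" by (rule I.quotient_is_cring[OF assms(1)])
  let ?Q = "quotient_module R I"
  have Q: "carrier ?Q = carrier (R Quot I)" "add ?Q = add (R Quot I)" "\<zero>\<^bsub>?Q\<^esub> = \<zero>\<^bsub>R Quot I\<^esub>"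
    "\<And>r C. r \<odot>\<^bsub>?Q\<^esub> C = (I +>\<^bsub>R\<^esub> r) \<otimes>\<^bsub>R Quot I\<^esub> C"
    by (simp_all add: quotient_module_def)
  have cos: "I +>\<^bsub>R\<^esub> r \<in> carrier (R Quot I)" if "r \<in> carrier R" for r
    using that I.a_subset by (simp add: FactRing_def a_rcosetsI)
  note hom = I.rcos_ring_hom
  show ?thesis
  proof (rule moduleI)
    show "abelian_group ?Q"
      by (rule abelian_groupI) (use Q.add.l_inv_ex in \<open>auto simp: Q Q.a_ac\<close>)
  qed (use assms cos in \<open>auto simp: Q Q.l_distr Q.r_distr Q.m_assoc ring_hom_add[OF hom]
      ring_hom_mult[OF hom] ring_hom_one[OF hom]\<close>)
qed

lemma inj_on_quotient:
  fixes R :: "('a, 'r) ring_scheme" and \<kappa> :: "'a \<Rightarrow> 'm"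
  assumes "cring R" "ideal I R" "inj_on \<kappa> (carrier R)"
  shows "\<exists>\<phi> :: 'a set \<Rightarrow> 'm. inj_on \<phi> (carrier (quotient_module R I))"
proof -
  interpret cring R by fact
  interpret I: ideal I R by fact
  define rep where "rep C = (SOME x. x \<in> C)" for C :: "'a set"
  have "C = I +>\<^bsub>R\<^esub> rep C \<and> rep C \<in> carrier R" if C: "C \<in> carrier (quotient_module R I)" for C
  proof -
    obtain c where c: "c \<in> carrier R" "C = I +>\<^bsub>R\<^esub> c"
      using C by (auto simp: quotient_module_simps A_RCOSETS_def')
    have "c \<in> C" using I.a_rcos_self c by simp
    then have r: "rep C \<in> C" unfolding rep_def by (rule someI)
    then have "I +>\<^bsub>R\<^esub> c = I +>\<^bsub>R\<^esub> rep C"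
      using a_repr_independence[OF _ c(1) I.a_subgroup] c(2) by simp
    moreover have "rep C \<in> carrier R" using a_r_coset_subset_G[OF I.a_subset c(1)] r c(2) by blast
    ultimately show ?thesis using c(2) by simp
  qed
  then have "inj_on (\<lambda>C. \<kappa> (rep C)) (carrier (quotient_module R I))"
    using inj_onD[OF assms(3)] by (intro inj_onI) metis
  then show ?thesis by blast
qed

section \<open>The main equivalences\<close>

lemma projective_resolution_Suc:
  fixes M :: "('a, 'm) module"
  assumes P: "fg_resolution R k P d e M"
    and "\<exists>(Q :: nat \<Rightarrow> ('a, 'm) module) d' e'.
      resolution_of_length R n Q d' e' (P 0\<lparr>carrier := a_kernel (P 0) M e\<rparr>) \<and> (\<forall>i \<le> n. projective R (Q i))"
  shows "\<exists>(Q :: nat \<Rightarrow> ('a, 'm) module) d e.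
    resolution_of_length R (Suc n) Q d e M \<and> (\<forall>i \<le> Suc n. projective R (Q i))"
proof -
  note D = fg_resolutionD[OF P] and RD = resolutionD[OF fg_resolutionD(1)[OF P]]
  obtain Q :: "nat \<Rightarrow> ('a, 'm) module" and d' e' where
    Q: "resolution_of_length R n Q d' e' (P 0\<lparr>carrier := a_kernel (P 0) M e\<rparr>)"
      "\<forall>i \<le> n. projective R (Q i)" using assms(2) by blast
  have "\<forall>i \<le> Suc n. projective R (case_nat (P 0) Q i)" using Q(2) D(2) by (auto split: nat.split)
  then show ?thesis using resolution_of_length_splice[OF Q(1) D(4) D(5) RD(4) RD(5)] by blast
qed

lemma projective_resolution_if_ext_vanish:
  fixes M :: "('a, 'm) module"
  assumes "fg_resolution R k P d e M"
    and "\<And>N :: ('a, 'm) module. N \<in> FPR R \<Longrightarrow> ext_vanish R P d N n"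
  shows "\<exists>(Q :: nat \<Rightarrow> ('a, 'm) module) d e. resolution_of_length R n Q d e M \<and> (\<forall>i \<le> n. projective R (Q i))"
  using assms
proof (induction n arbitrary: k P d e M)
  case 0
  note D = fg_resolutionD[OF 0(1)] and RD = resolutionD[OF fg_resolutionD(1)[OF 0(1)]]
  let ?K = "P 0\<lparr>carrier := a_kernel (P 0) M e\<rparr>"
  have "?K \<in> FPR R" unfolding FPR_iff using fg_resolution_shift[OF 0(1)] by blast
  then have van: "ext_vanish R P d ?K 0" by (rule 0(2))
  \<comment> \<open>The cocycle to be tested is \<open>d 0\<close> itself, seen as a map onto the
    syzygy \<open>?K\<close>; a solution \<open>g\<close> of the coboundary equation fixes
    \<open>?K\<close> pointwise.\<close>
  have d: "d 0 \<in> module_hom R (P (Suc 0)) ?K" by (rule mh_into[OF RD(3)]) (use RD(6) in blast)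
  have "\<forall>x \<in> carrier (P (Suc (Suc 0))). d 0 (d (Suc 0) x) = \<zero>\<^bsub>?K\<^esub>"
    using resolution_dd(2)[OF D(1)] by simp
  then obtain g where g: "g \<in> module_hom R (P 0) ?K"
    "\<forall>x \<in> carrier (P (Suc 0)). d 0 x = g (d 0 x)"
    using bspec[OF van[unfolded ext_vanish_def] d] by auto
  have gid: "g y = y" if "y \<in> a_kernel (P 0) M e" for y
    using that g(2) unfolding RD(6)[symmetric] by (elim imageE) simp
  have "projective R M" by (rule projective_quotient[OF D(2) D(5) RD(4) RD(5) g(1) gid])
  then have "\<forall>i \<le> 0. projective R (zero_extend M i)" by (simp add: zero_extend_def)
  then show ?case using resolution_zero_extend[OF D(5)] by blast
next
  case (Suc n)
  show ?case
    by (rule projective_resolution_Suc[OF Suc.prems(1)], rule Suc.IH[OF fg_resolution_shift[OF Suc.prems(1)]])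
      (use Suc.prems(2) in \<open>simp add: ext_vanish_shift\<close>)
qed

text \<open>Vanishing is assumed for all \<open>j\<close> because the induction passes to syzygies,
  whose Tor sits in higher degrees of the original complex.\<close>

lemma projective_if_tor_vanish:
  fixes M :: "('a, 'm) module"
  assumes "fg_resolution R k P d e M"
    and "\<And>m j. maximalideal m R \<Longrightarrow> tor_vanish R P d (quotient_module R m) j"
  shows "projective R M"
  using assms
proof (induction k arbitrary: P d e M)
  case 0
  note D = fg_resolutionD[OF 0(1)] and RD = resolutionD[OF fg_resolutionD(1)[OF 0(1)]]
  let ?K = "P 0\<lparr>carrier := a_kernel (P 0) M e\<rparr>"
  have ker: "a_kernel (P 0) M e = {\<zero>\<^bsub>P 0\<^esub>}"
    unfolding RD(6)[symmetric] using D(6)[of "Suc 0"] mh_zero[OF RD(3) D(4) D(4)] by simp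
  have "(\<lambda>x. \<zero>\<^bsub>P 0\<^esub>) \<in> module_hom R (P 0) ?K"
    by (rule mh_into[OF mh_zero_fun[OF D(4) D(4)]]) (simp add: ker)
  then show ?case by (rule projective_quotient[OF D(2) D(5) RD(4) RD(5)]) (simp add: ker)
next
  case (Suc k)
  note D = fg_resolutionD[OF Suc.prems(1)] and RD = resolutionD[OF fg_resolutionD(1)[OF Suc.prems(1)]]
  let ?K = "P 0\<lparr>carrier := a_kernel (P 0) M e\<rparr>"
  note mK = module_a_kernel[OF RD(4) D(4) D(5)]
  interpret P0: module R "P 0" by (rule D(4))
  have d: "d 0 \<in> module_hom R (P (Suc 0)) ?K" by (rule mh_into[OF RD(3)]) (use RD(6) in blast)
  have dK: "d 0 ` carrier (P (Suc 0)) = carrier ?K" using RD(6) by simp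
  have "projective R ?K"
  proof (rule Suc.IH)
    show "fg_resolution R k (\<lambda>i. P (Suc i)) (\<lambda>i. d (Suc i)) (d 0) ?K"
      using fg_resolution_shift[OF Suc.prems(1)] by simp
  qed (use Suc.prems(2) in \<open>simp add: tor_vanish_shift\<close>)
  moreover have "fin_gen R ?K" by (rule fin_gen_image[OF D(4) mK d dK D(3)])
  ultimately have "fdb R ?K" using fin_gen_projective_fdb by blast
  moreover have "fdb R (P 0)" by (rule fin_gen_projective_fdb[OF D(3) D(2)])
  moreover have "(\<lambda>x. x) \<in> module_hom R ?K (P 0)"
    by (rule mh_sub[OF mh_id]) (auto simp: a_kernel_def')
  ultimately have "\<exists>r \<in> module_hom R (P 0) ?K. \<forall>y \<in> carrier ?K. r y = y"
  proof (rule split_mod_maximalideals)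
    fix m y h assume m: "maximalideal m R" and y: "y \<in> carrier ?K"
      and fy: "\<And>f. f \<in> dual R (P 0) \<Longrightarrow> f y \<in> m" and h: "h \<in> dual R ?K"
    interpret m: maximalideal m R by (rule m)
    let ?Q = "quotient_module R m"
    note mQ = module_quotient_module[OF P0.is_cring m.is_ideal]
    interpret Q: module R ?Q by (rule mQ)
    obtain x where x: "x \<in> carrier (P (Suc 0))" "y = d 0 x" using y unfolding dK[symmetric] by blast
    have coset: "m +>\<^bsub>R\<^esub> r \<in> carrier ?Q" if "r \<in> carrier R" for r
      using that m.a_subset by (simp add: quotient_module_simps P0.R.a_rcosetsI)
    \<comment> \<open>The test tensor \<open>x\<close> tensor 1 is a cycle modulo \<open>m\<close>
      by \<open>fy\<close>, hence a boundary. Although \<open>h\<close> is defined on the syzygy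
      only, \<open>h o d 0\<close> is a functional on \<open>P (Suc 0)\<close>; it kills boundaries,
      so \<open>h y\<close> is zero in \<open>R/m\<close>.\<close>
    let ?u = "[(x, m +>\<^bsub>R\<^esub> \<one>\<^bsub>R\<^esub>)]"
    have u: "set ?u \<subseteq> carrier (P (Suc 0)) \<times> carrier ?Q" using x coset by simp
    have con: "contract ?Q f ?u = m +>\<^bsub>R\<^esub> f x" if "f x \<in> carrier R" for f
    proof -
      have "f x \<odot>\<^bsub>?Q\<^esub> (m +>\<^bsub>R\<^esub> \<one>\<^bsub>R\<^esub>) = m +>\<^bsub>R\<^esub> f x"
        using that m.rcoset_mult_add[of "f x" "\<one>\<^bsub>R\<^esub>"] by (simp add: quotient_module_simps)
      then show ?thesis using Q.M.r_zero[OF coset[OF that]] by (simp add: contract_def)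
    qed
    have zero: "m +>\<^bsub>R\<^esub> r = \<zero>\<^bsub>?Q\<^esub>" if "r \<in> m" for r
      using P0.R.a_coset_join2[OF m.a_Hcarr[OF that] m.a_subgroup that] by (simp add: quotient_module_simps)
    have "contract ?Q (\<lambda>x. f (d 0 x)) ?u = \<zero>\<^bsub>?Q\<^esub>" if f: "f \<in> dual R (P 0)" for f
      using con[of "\<lambda>x. f (d 0 x)"] zero[OF fy[OF f]] m.a_Hcarr[OF fy[OF f]] x(2) by simp
    then obtain v where v: "set v \<subseteq> carrier (P (Suc (Suc 0))) \<times> carrier ?Q"
      "\<And>f. f \<in> dual R (P (Suc 0)) \<Longrightarrow> contract ?Q (\<lambda>x. f (d (Suc 0) x)) v = contract ?Q f ?u"
      using tor_vanishD[OF Suc.prems(2)[OF m] u] by blast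
    have hd: "(\<lambda>x. h (d 0 x)) \<in> dual R (P (Suc 0))" by (rule mh_comp[OF h d])
    have h0: "h \<zero>\<^bsub>P 0\<^esub> = \<zero>\<^bsub>R\<^esub>" using mh_zero[OF h mK module_regular[OF P0.is_cring]] by simp
    have "contract ?Q (\<lambda>x. h (d 0 (d (Suc 0) x))) v = \<zero>\<^bsub>?Q\<^esub>"
      unfolding contract_def
      by (rule msum_zero[OF mQ]) (use v(1) resolution_dd(2)[OF D(1)] h0 in auto)
    moreover have hy: "h (d 0 x) \<in> carrier R" using mh_closed[OF hd x(1)] by simp
    ultimately have "m +>\<^bsub>R\<^esub> h (d 0 x) = m"
      using v(2)[OF hd] con[of "\<lambda>x. h (d 0 x)"] by (simp add: quotient_module_simps)
    then show "h y \<in> m" unfolding x(2) by (rule P0.R.a_coset_join1[OF _ hy m.a_subgroup])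
  qed
  then obtain r where r: "r \<in> module_hom R (P 0) ?K" "\<forall>y \<in> carrier ?K. r y = y" by blast
  show ?case by (rule projective_quotient[OF D(2) D(5) RD(4) RD(5) r(1)]) (use r(2) in simp)
qed

lemma projective_resolution_if_tor_vanish:
  fixes M :: "('a, 'm) module"
  assumes "fg_resolution R k P d e M"
    and "\<And>m j. maximalideal m R \<Longrightarrow> n \<le> j \<Longrightarrow> tor_vanish R P d (quotient_module R m) j"
  shows "\<exists>(Q :: nat \<Rightarrow> ('a, 'm) module) d e. resolution_of_length R n Q d e M \<and> (\<forall>i \<le> n. projective R (Q i))"
  using assms
proof (induction n arbitrary: k P d e M)
  case 0
  have "projective R M" by (rule projective_if_tor_vanish[OF 0(1)]) (use 0(2) in simp)
  then have "\<forall>i \<le> 0. projective R (zero_extend M i)" by (simp add: zero_extend_def)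
  then show ?case using resolution_zero_extend[OF fg_resolutionD(5)[OF 0(1)]] by blast
next
  case (Suc n)
  show ?case
    by (rule projective_resolution_Suc[OF Suc.prems(1)], rule Suc.IH[OF fg_resolution_shift[OF Suc.prems(1)]])
      (use Suc.prems(2) in \<open>simp add: tor_vanish_shift\<close>)
qed

text \<open>For nonempty \<open>S\<close> the infimum is attained; for empty \<open>S\<close> it is
  infinite and both sides are false.\<close>

lemma Inf_enat_le_iff: "Inf (enat ` S) \<le> enat n \<longleftrightarrow> (\<exists>k \<in> S. k \<le> n)"
proof
  assume le: "Inf (enat ` S) \<le> enat n"
  then have "S \<noteq> {}" by (auto simp: Inf_enat_def)
  then have "Inf (enat ` S) \<in> enat ` S"
    unfolding Inf_enat_def using LeastI_ex[of "\<lambda>x. x \<in> enat ` S"] by auto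
  then show "\<exists>k \<in> S. k \<le> n" using le by auto
next
  assume "\<exists>k \<in> S. k \<le> n"
  then show "Inf (enat ` S) \<le> enat n" by (meson Inf_lower enat_ord_simps(1) imageI order_trans)
qed

lemma pd_le_iff:
  fixes M :: "('a, 'm) module"
  shows "pd R M \<le> enat n \<longleftrightarrow> (\<exists>k \<le> n. \<exists>(P :: nat \<Rightarrow> ('a, 'm) module) d e.
     resolution_of_length R k P d e M \<and> (\<forall>i \<le> k. projective R (P i)))"
  unfolding pd_def Inf_enat_le_iff by auto

lemma FT_fd_le_iff:
  "FT_fd TYPE('m) R M \<le> enat n \<longleftrightarrow> (\<exists>k \<le> n. \<exists>(P :: nat \<Rightarrow> ('a, 'm) module) d e.
     resolution_of_length R k P d e M \<and> (\<forall>i \<le> k. FT_flat R (P i)))"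
  unfolding FT_fd_def Inf_enat_le_iff by auto

lemma fPD_le_iff: "fPD TYPE('m) R \<le> enat n \<longleftrightarrow> (\<forall>M \<in> (FPR R :: ('a, 'm) module set). pd R M \<le> enat n)"
  unfolding fPD_def by (simp add: SUP_le_iff)

text \<open>\<open>N\<close> may have any type, so that \<open>R\<close> as a module over itself,
  which lives in \<open>'a\<close>, is covered.\<close>

lemma ext_trivial_if_fPD_le:
  fixes M :: "('a, 'm) module" and N :: "('a, 'b) module"
  assumes "fPD TYPE('m) R \<le> enat n" "M \<in> FPR R" "module R N" "n \<le> j"
  shows "trivial_group (Ext R (Suc j) M N)"
proof -
  obtain k d e and P :: "nat \<Rightarrow> ('a, 'm) module" where P: "k \<le> n" "resolution_of_length R k P d e M"
    "\<And>i. i \<le> k \<Longrightarrow> projective R (P i)"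
    using assms(1,2) unfolding fPD_le_iff pd_le_iff by blast
  have res: "resolution R P d e M" using P(2) by (simp add: resolution_of_length_def)
  have "ext_vanish R P d N j"
    by (rule ext_vanish_short[OF P(2) _ assms(3)]) (use P(1) assms(4) in simp)
  then show ?thesis
    using trivial_Ext_iff[OF res projective_everywhere[OF P(2,3)] assms(3), of j] by simp
qed

lemma fPD_le_if_ext_trivial:
  assumes "\<And>(M :: ('a, 'm) module) (N :: ('a, 'm) module). M \<in> FPR R \<Longrightarrow> N \<in> FPR R \<Longrightarrow> trivial_group (Ext R (Suc n) M N)"
  shows "fPD TYPE('m) R \<le> enat n"
  unfolding fPD_le_iff
proof
  fix M :: "('a, 'm) module" assume M: "M \<in> FPR R"
  then obtain k d e and P :: "nat \<Rightarrow> ('a, 'm) module" where P: "fg_resolution R k P d e M"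
    unfolding FPR_iff by blast
  have "ext_vanish R P d N n" if N: "N \<in> FPR R" for N :: "('a, 'm) module"
  proof -
    have "module R N" using N unfolding FPR_iff using fg_resolutionD(5) by blast
    then show ?thesis using assms[OF M N] trivial_Ext_iff[OF fg_resolutionD(1,2)[OF P]] by blast
  qed
  then show "pd R M \<le> enat n"
    unfolding pd_le_iff using projective_resolution_if_ext_vanish[OF P] by blast
qed

lemma fPD_le_if_FT_fd_le:
  assumes R: "cring R"
    and fd: "\<And>m. maximalideal m R \<Longrightarrow> FT_fd TYPE('m) R (quotient_module R m) \<le> enat n"
  shows "fPD TYPE('m) R \<le> enat n"
  unfolding fPD_le_iff
proof
  fix M :: "('a, 'm) module" assume M: "M \<in> FPR R"
  then obtain k d e and P :: "nat \<Rightarrow> ('a, 'm) module" where P: "fg_resolution R k P d e M"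
    unfolding FPR_iff by blast
  have "tor_vanish R P d (quotient_module R m) j" if m: "maximalideal m R" and j: "n \<le> j" for m j
  proof -
    obtain k' d' e' and F :: "nat \<Rightarrow> ('a, 'm) module" where F: "k' \<le> n"
      "resolution_of_length R k' F d' e' (quotient_module R m)" "\<And>i. i \<le> k' \<Longrightarrow> FT_flat R (F i)"
      using fd[OF m] unfolding FT_fd_le_iff by blast
    show ?thesis by (rule tor_vanish_FT_resolution[OF F(2,3) P]) (use F(1) j in simp_all)
  qed
  then show "pd R M \<le> enat n"
    unfolding pd_le_iff using projective_resolution_if_tor_vanish[OF P] by blast
qed

text \<open>The quotient lives in \<open>'a set\<close>; its resolution is built for a copy in
  \<open>'m\<close> and carried back at the end.\<close>

lemma FT_fd_le_if_fPD_le: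
  fixes R :: "('a, 'r) ring_scheme" and \<iota> :: "'a list \<Rightarrow> 'm"
  assumes R: "cring R" and \<iota>: "inj_on \<iota> (lists (carrier R))" and fPD: "fPD TYPE('m) R \<le> enat n"
    and I: "ideal I R"
  shows "FT_fd TYPE('m) R (quotient_module R I) \<le> enat n"
proof -
  interpret cring R by (rule R)
  note inf = universe_infinite(1)[OF \<iota> zero_closed] and \<kappa> = universe_infinite(2)[OF \<iota> zero_closed]
  let ?Q = "quotient_module R I"
  note mQ = module_quotient_module[OF R I]
  obtain \<phi> :: "'a set \<Rightarrow> 'm" where "inj_on \<phi> (carrier ?Q)" using inj_on_quotient[OF R I \<kappa>] by blast
  then obtain M :: "('a, 'm) module" and \<psi> where M: "module R M" "\<phi> \<in> module_hom R ?Q M"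
    "\<psi> \<in> module_hom R M ?Q" "\<And>x. x \<in> carrier ?Q \<Longrightarrow> \<psi> (\<phi> x) = x" "\<And>y. y \<in> carrier M \<Longrightarrow> \<phi> (\<psi> y) = y"
    by (rule module_copy[OF mQ]) blast
  have "\<exists>(F :: nat \<Rightarrow> ('a, 'm) module) d e. resolution_of_length R n F d e M \<and> (\<forall>i \<le> n. FT_flat R (F i))"
  proof (rule FT_resolution_exists[OF ldb_cover_exists[OF inf \<kappa>] M(1)])
    fix k d e N and P :: "nat \<Rightarrow> ('a, 'm) module"
    assume P: "fg_resolution R k P d e N"
    then have "N \<in> FPR R" unfolding FPR_iff by blast
    \<comment> \<open>The bound gives a short projective resolution \<open>P'\<close>, not
      necessarily by finitely generated modules; its vanishing is moved to the given
      \<open>P\<close>.\<close>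
    then obtain k' d' e' and P' :: "nat \<Rightarrow> ('a, 'm) module" where P': "k' \<le> n"
      "resolution_of_length R k' P' d' e' N" "\<And>i. i \<le> k' \<Longrightarrow> projective R (P' i)"
      using fPD unfolding fPD_le_iff pd_le_iff by blast
    have res: "resolution R P' d' e' N" using P'(2) by (simp add: resolution_of_length_def)
    show "tor_vanish R P d M n"
      by (rule tor_vanish_change[OF res projective_everywhere[OF P'(2,3)] fg_resolutionD(1,2)[OF P] M(1)
            tor_vanish_short[OF P'(2,1) M(1)]])
  qed
  then obtain F :: "nat \<Rightarrow> ('a, 'm) module" and d e where F: "resolution_of_length R n F d e M"
    "\<forall>i \<le> n. FT_flat R (F i)" by blast
  have "resolution_of_length R n F d (\<lambda>x. \<psi> (e x)) ?Q"
    using F(1) resolution_iso[OF _ mQ M(2,3,4,5)] unfolding resolution_of_length_def by blast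
  then show ?thesis unfolding FT_fd_le_iff using F(2) by blast
qed

theorem theorem3p1:
  fixes R :: "('a, 'r) ring_scheme" and n :: nat
  assumes "cring R"
    and universe: "\<exists>\<iota> :: 'a list \<Rightarrow> 'm. inj_on \<iota> (lists (carrier R))"
  defines "c1 \<equiv> fPD TYPE('m) R \<le> enat n"
    and "c2 \<equiv> \<forall>p. primeideal p R \<longrightarrow> FT_fd TYPE('m) R (quotient_module R p) \<le> enat n"
    and "c3 \<equiv> \<forall>m. maximalideal m R \<longrightarrow> FT_fd TYPE('m) R (quotient_module R m) \<le> enat n"
    and "c4 \<equiv> \<forall>M \<in> (FPR R :: ('a, 'm) module set). \<forall>N \<in> (FPR R :: ('a, 'm) module set).
                trivial_group (Ext R (n + 1) M N)"
    and "c5 \<equiv> \<forall>M \<in> (FPR R :: ('a, 'm) module set). \<forall>m.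
                trivial_group (Ext R (n + 1 + m) M (regular_module R))"
  shows "(c1 \<longleftrightarrow> c2) \<and> (c1 \<longleftrightarrow> c3) \<and> (c1 \<longleftrightarrow> c4) \<and>
    ((c5 \<longrightarrow> c1) \<longrightarrow> (c5 \<longleftrightarrow> c1) \<and> (c5 \<longleftrightarrow> c2) \<and> (c5 \<longleftrightarrow> c3) \<and> (c5 \<longleftrightarrow> c4))"
proof -
  obtain \<iota> :: "'a list \<Rightarrow> 'm" where \<iota>: "inj_on \<iota> (lists (carrier R))" using universe by blast
  have 12: "c2" if c1
    unfolding c2_def using FT_fd_le_if_fPD_le[OF assms(1) \<iota> that[unfolded c1_def]] primeideal.axioms(1) by blast
  have 23: "c3" if c2
    using that cring.maximalideal_prime[OF assms(1)] unfolding c2_def c3_def by blast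
  have 31: "c1" if c3
    unfolding c1_def by (rule fPD_le_if_FT_fd_le[OF assms(1)]) (use that in \<open>simp add: c3_def\<close>)
  have 14: "c4" if c1
    unfolding c4_def
  proof (intro ballI)
    fix M N :: "('a, 'm) module" assume M: "M \<in> FPR R" and N: "N \<in> FPR R"
    have "module R N" using N unfolding FPR_iff using fg_resolutionD(5) by blast
    from ext_trivial_if_fPD_le[OF that[unfolded c1_def] M this order_refl]
    show "trivial_group (Ext R (n + 1) M N)" by simp
  qed
  have 41: "c1" if c4
    unfolding c1_def by (rule fPD_le_if_ext_trivial) (use that in \<open>simp add: c4_def\<close>)
  \<comment> \<open>This direction holds unconditionally; the converse is exactly the extra
    hypothesis.\<close>
  have 15: "c5" if c1
    unfolding c5_def
    using ext_trivial_if_fPD_le[OF that[unfolded c1_def] _ module_regular[OF assms(1)]] by simp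
  show ?thesis using 12 23 31 14 41 15 by blast
qed

end
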